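(* Let $d\ge 2$ and let $E=(e_{ij})_{1\le i,j\le d}$ be partitioned as $E=\begin{pmatrix} E_{11} & E_{12} \\ E_{21} & E_{22} \end{pmatrix}$ with $E_{11}=(e_{ij})_{1\le i,j\le d-1}$. The restriction of the morphisms $j_n$, $n\ge1$, to the subalgebra $$\langle \mathbf{Tr}(E_{11}^{k-1}),\ \mathbf{Tr}(E^{k}),\ k\in\{1,\dots,d\}\rangle$$ of $\mathcal U(\mathfrak g)$ defines a quantum Markov process.
   Context: $\mathfrak g=\operatorname{M}_d(\mathbb C)$ is the Lie algebra of $G=\operatorname{GL}_d(\mathbb C)$, with matrix units $e_{ij}$; $\mathcal U(\mathfrak g)$ is its universal enveloping algebra (the unital associative algebra generated by the $e_{ij}$ with relations $[e_{ij},e_{kl}]=\delta_{jk}e_{il}-\delta_{il}e_{kj}$), with unit $1$; $I=\sum_i e_{ii}\in\mathfrak g$ is the identity matrix and $h_i=e_{ii}-e_{i+1\,i+1}$. The coproduct $\Delta:\mathcal U(\mathfrak g)\to\mathcal U(\mathfrak g)\otimes\mathcal U(\mathfrak g)$ is the unital algebra homomorphism with $\Delta(I)=I\otimes I$, $\Delta(e_{ij})=1\otimes e_{ij}+e_{ij}\otimes 1$ for $i\neq j$, and $\Delta(h_i)=1\otimes h_i+h_i\otimes 1$ for $1\le i\le d-1$. $\rho$ is the standard representation of $\mathfrak g$ on $\mathbb C^d$, extended to $\mathcal U(\mathfrak g)$; $\rho^{\otimes 1}=\rho$ and $\rho^{\otimes n}(x)=(\rho^{\otimes n-1}\otimes\rho)\Delta(x)$.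 $\operatorname{tr}=\frac1d\operatorname{Tr}$ is the normalized trace on $\operatorname{M}_d(\mathbb C)$, and $\mathcal W=\operatorname{M}_d(\mathbb C)^{\otimes\infty}$ is the infinite tensor product in the sense of von Neumann algebras with respect to the product state $\omega=\operatorname{tr}^{\otimes\infty}$; $\operatorname{M}_d(\mathbb C)^{\otimes n}$ is embedded in $\mathcal W$ by $a\mapsto a\otimes I^{\otimes\infty}$. The morphism $j_n:\mathcal U(\mathfrak g)\to\mathcal W$ is $j_n(x)=\rho^{\otimes n}(x)$. Let $\eta(x)=\operatorname{tr}(\rho(x))$ and $P=(\mathrm{id}\otimes\eta)\circ\Delta:\mathcal U(\mathfrak g)\to\mathcal U(\mathfrak g)$. For a subalgebra $\mathcal B\subset\mathcal U(\mathfrak g)$, "the restriction of the $j_n$'s to $\mathcal B$ defines a quantum Markov process (chain)" means that $P\mathcal B\subset\mathcal B$, so that $P|_{\mathcal B}$ is a transition operator on $\mathcal B$: for all $n\ge 2$, $x\in\mathcal B$ and $\xi$ in the von Neumann algebra generated by $\{j_k(\mathcal B),k\le n-1\}$, one has $\omega(j_n(x)\xi)=\omega(j_{n-1}(Px)\xi)$ with $Px\in\mathcal B$. Matrices with entries in $\mathcal U(\mathfrak g)$ are added and multiplied by the usual rules, and for a square matrix $M=(m_{ij})$ with entries in $\mathcal U(\mathfrak g)$, $\mathbf{Tr}(M)=\sum_i m_{ii}\in\mathcal U(\mathfrak g)$. $\langle a_1,a_2,\dots\rangle$ denotes the subalgebra of $\mathcal U(\mathfrak g)$ generated by the constants and $a_1,a_2,\dots$.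 *)

theory Defs
  imports "HOL-Analysis.Analysis" "HOL-Library.Poly_Mapping"
begin

section \<open>Complex vector spaces and complex algebras\<close>

class scaleC =
  fixes scaleC :: "complex \<Rightarrow> 'a \<Rightarrow> 'a"  (infixr "*\<^sub>C" 75)

class complex_vector = scaleC + ab_group_add +
  assumes scaleC_add_right: "c *\<^sub>C (x + y) = c *\<^sub>C x + c *\<^sub>C y"
    and scaleC_add_left: "(c + c') *\<^sub>C x = c *\<^sub>C x + c' *\<^sub>C x"
    and scaleC_scaleC: "c *\<^sub>C c' *\<^sub>C x = (c * c') *\<^sub>C x"
    and scaleC_one: "1 *\<^sub>C x = x"

text \<open>Associative unital algebras; \<open>0 \<noteq> 1\<close> is not demanded.\<close>

class complex_algebra_1 = complex_vector + ring + monoid_mult +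
  assumes scaleC_mult_left: "c *\<^sub>C x * y = c *\<^sub>C (x * y)"
    and scaleC_mult_right: "x * c *\<^sub>C y = c *\<^sub>C (x * y)"

definition clinear :: "('a::complex_vector \<Rightarrow> 'b::complex_vector) \<Rightarrow> bool" where
  "clinear f \<longleftrightarrow> (\<forall>x y. f (x + y) = f x + f y) \<and> (\<forall>c x. f (c *\<^sub>C x) = c *\<^sub>C f x)"

definition cbilinear :: "('a::complex_vector \<Rightarrow> 'b::complex_vector \<Rightarrow> 'v::complex_vector) \<Rightarrow> bool" where
  "cbilinear f \<longleftrightarrow> (\<forall>x. clinear (f x)) \<and> (\<forall>y. clinear (\<lambda>x. f x y))"

definition calg_hom :: "('a::complex_algebra_1 \<Rightarrow> 'b::complex_algebra_1) \<Rightarrow> bool" where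
  "calg_hom f \<longleftrightarrow> clinear f \<and> f 1 = 1 \<and> (\<forall>x y. f (x * y) = f x * f y)"

definition subalgebra :: "'a::complex_algebra_1 set \<Rightarrow> bool" where
  "subalgebra B \<longleftrightarrow> 1 \<in> B \<and> (\<forall>x\<in>B. \<forall>y\<in>B. x + y \<in> B \<and> x * y \<in> B) \<and> (\<forall>c. \<forall>x\<in>B. c *\<^sub>C x \<in> B)"

instantiation complex :: complex_algebra_1
begin
definition scaleC_complex :: "complex \<Rightarrow> complex \<Rightarrow> complex" where
  "scaleC_complex c x = c * x"
instance
  by intro_classes (simp_all add: scaleC_complex_def algebra_simps)
end

instantiation vec :: (complex_vector, finite) complex_vector
begin
definition scaleC_vec :: "complex \<Rightarrow> 'a ^ 'b \<Rightarrow> 'a ^ 'b" where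
  "scaleC_vec c v = (\<chi> i. c *\<^sub>C v $ i)"
instance
  by intro_classes
    (simp_all add: scaleC_vec_def vec_eq_iff scaleC_add_right scaleC_add_left scaleC_scaleC scaleC_one)
end

lemma scaleC_zero_right [simp]: "c *\<^sub>C (0::'a::complex_vector) = 0"
  using scaleC_add_right[of c "0::'a" 0] by simp

lemma scaleC_zero_left [simp]: "0 *\<^sub>C (x::'a::complex_vector) = 0"
  using scaleC_add_left[of 0 0 x] by simp

lemma scaleC_minus_right: "c *\<^sub>C (- x) = - (c *\<^sub>C (x::'a::complex_vector))"
  using scaleC_add_right[of c x "-x"] by (simp add: eq_neg_iff_add_eq_0 add.commute)

lemma scaleC_minus_left: "(- c) *\<^sub>C x = - (c *\<^sub>C (x::'a::complex_vector))"
  using scaleC_add_left[of c "-c" x] by (simp add: eq_neg_iff_add_eq_0 add.commute)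

lemma scaleC_diff_right: "c *\<^sub>C (x - y) = c *\<^sub>C x - c *\<^sub>C (y::'a::complex_vector)"
  using scaleC_add_right[of c x "-y"] by (simp add: scaleC_minus_right)

lemma scaleC_sum_right: "c *\<^sub>C (\<Sum>i\<in>A. f i) = (\<Sum>i\<in>A. c *\<^sub>C (f i :: 'a::complex_vector))"
  by (induction A rule: infinite_finite_induct) (auto simp: scaleC_add_right)

lemma clinear_zero: "clinear f \<Longrightarrow> f 0 = 0"
  unfolding clinear_def by (metis scaleC_zero_left)

lemma clinear_minus: "clinear f \<Longrightarrow> f (- x) = - f x"
  unfolding clinear_def by (metis scaleC_minus_left scaleC_one)

lemma clinear_diff: "clinear f \<Longrightarrow> f (x - y) = f x - f y"
  by (metis (no_types, lifting) clinear_def clinear_minus diff_conv_add_uminus)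

lemma clinear_sum: "clinear f \<Longrightarrow> f (\<Sum>i\<in>A. g i) = (\<Sum>i\<in>A. f (g i))"
  by (induction A rule: infinite_finite_induct) (auto simp: clinear_zero clinear_def)


section \<open>Monoid algebras and their quotients\<close>

text \<open>For an (additively written) monoid \<open>M\<close>, the library's \<open>M \<Rightarrow>\<^sub>0 complex\<close> is the monoid algebra
  \<open>\<complex>[M]\<close>. The scalar \<open>c\<close> is \<open>single 0 c\<close>.\<close>

inductive_set two_sided_ideal :: "'a::ring_1 set \<Rightarrow> 'a set" for R where
  zero: "0 \<in> two_sided_ideal R"
| step: "x \<in> two_sided_ideal R \<Longrightarrow> r \<in> R \<Longrightarrow> x + a * r * b \<in> two_sided_ideal R"

lemma two_sided_ideal_gen: "r \<in> R \<Longrightarrow> r \<in> two_sided_ideal R"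
  using two_sided_ideal.step[OF two_sided_ideal.zero, of r R 1 1] by simp

lemma two_sided_ideal_add:
  assumes "x \<in> two_sided_ideal R" "y \<in> two_sided_ideal R"
  shows "x + y \<in> two_sided_ideal R"
  using assms(2) assms(1)
proof (induction rule: two_sided_ideal.induct)
  case (step y r a b)
  then show ?case using two_sided_ideal.step[of "x + y" R r a b] by (simp add: add.assoc)
qed simp

lemma two_sided_ideal_mult_left:
  assumes "x \<in> two_sided_ideal R"
  shows "c * x \<in> two_sided_ideal R"
  using assms
proof (induction rule: two_sided_ideal.induct)
  case (step y r a b)
  then show ?case using two_sided_ideal.step[of "c * y" R r "c * a" b]
    by (simp add: distrib_left mult.assoc)
qed (simp add: two_sided_ideal.zero)

lemma two_sided_ideal_mult_right:
  assumes "x \<in> two_sided_ideal R"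
  shows "x * c \<in> two_sided_ideal R"
  using assms
proof (induction rule: two_sided_ideal.induct)
  case (step y r a b)
  then show ?case using two_sided_ideal.step[of "y * c" R r "a" "b * c"]
    by (simp add: distrib_right mult.assoc)
qed (simp add: two_sided_ideal.zero)

lemma two_sided_ideal_minus: "x \<in> two_sided_ideal R \<Longrightarrow> - x \<in> two_sided_ideal R"
  using two_sided_ideal_mult_left[of x R "- 1"] by simp

lemma two_sided_ideal_diff:
  "x \<in> two_sided_ideal R \<Longrightarrow> y \<in> two_sided_ideal R \<Longrightarrow> x - y \<in> two_sided_ideal R"
  using two_sided_ideal_add[of x R "- y"] two_sided_ideal_minus[of y R] by simp

definition ideal_cong :: "'a::ring_1 set \<Rightarrow> 'a \<Rightarrow> 'a \<Rightarrow> bool" where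
  "ideal_cong R x y \<longleftrightarrow> x - y \<in> two_sided_ideal R"

lemma ideal_cong_refl: "ideal_cong R x x"
  by (simp add: ideal_cong_def two_sided_ideal.zero)

lemma equivp_ideal_cong: "equivp (ideal_cong R)"
proof (rule equivpI)
  show "reflp (ideal_cong R)" by (simp add: reflp_def ideal_cong_refl)
  show "symp (ideal_cong R)"
    by (metis ideal_cong_def minus_diff_eq symp_def two_sided_ideal_minus)
  show "transp (ideal_cong R)"
    unfolding transp_def ideal_cong_def
    by (metis diff_add_cancel add_diff_eq two_sided_ideal_add)
qed

lemma ideal_cong_add: "ideal_cong R x x' \<Longrightarrow> ideal_cong R y y' \<Longrightarrow> ideal_cong R (x + y) (x' + y')"
  unfolding ideal_cong_def by (metis add_diff_add two_sided_ideal_add)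

lemma ideal_cong_minus: "ideal_cong R x x' \<Longrightarrow> ideal_cong R (- x) (- x')"
  unfolding ideal_cong_def by (metis minus_diff_minus two_sided_ideal_minus)

lemma ideal_cong_diff: "ideal_cong R x x' \<Longrightarrow> ideal_cong R y y' \<Longrightarrow> ideal_cong R (x - y) (x' - y')"
  using ideal_cong_add[of R x x' "- y" "- y'"] ideal_cong_minus[of R y y'] by simp

lemma ideal_cong_mult:
  assumes "ideal_cong R x x'" "ideal_cong R y y'"
  shows "ideal_cong R (x * y) (x' * y')"
proof -
  have "x * y - x' * y' = (x - x') * y + x' * (y - y')" by (simp add: algebra_simps)
  then show ?thesis using assms unfolding ideal_cong_def
    by (metis two_sided_ideal_add two_sided_ideal_mult_left two_sided_ideal_mult_right)
qed

definition lin_ext :: "('m \<Rightarrow> 'v::complex_vector) \<Rightarrow> ('m \<Rightarrow>\<^sub>0 complex) \<Rightarrow> 'v" where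
  "lin_ext f p = (\<Sum>m\<in>Poly_Mapping.keys p. Poly_Mapping.lookup p m *\<^sub>C f m)"

lemma lin_ext_superset:
  assumes "finite K" "Poly_Mapping.keys p \<subseteq> K"
  shows "lin_ext f p = (\<Sum>m\<in>K. Poly_Mapping.lookup p m *\<^sub>C f m)"
  unfolding lin_ext_def using assms
  by (intro sum.mono_neutral_left) (auto simp: in_keys_iff)

lemma lin_ext_zero [simp]: "lin_ext f 0 = 0"
  by (simp add: lin_ext_def)

lemma lin_ext_add: "lin_ext f (p + q) = lin_ext f p + lin_ext f q"
proof -
  let ?K = "Poly_Mapping.keys p \<union> Poly_Mapping.keys q"
  have "Poly_Mapping.keys (p + q) \<subseteq> ?K" by (rule keys_add)
  then show ?thesis
    using lin_ext_superset[of ?K "p + q" f] lin_ext_superset[of ?K p f] lin_ext_superset[of ?K q f]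
    by (simp add: lookup_add scaleC_add_left sum.distrib)
qed

lemma lin_ext_minus: "lin_ext f (- p) = - lin_ext f p"
  using lin_ext_add[of f p "- p"] by (simp add: eq_neg_iff_add_eq_0 add.commute)

lemma lin_ext_diff: "lin_ext f (p - q) = lin_ext f p - lin_ext f q"
  using lin_ext_add[of f p "- q"] by (simp add: lin_ext_minus)

lemma lin_ext_single [simp]: "lin_ext f (Poly_Mapping.single m c) = c *\<^sub>C f m"
  by (cases "c = 0") (simp_all add: lin_ext_def)

lemma poly_mapping_single_induct [case_names single add]:
  assumes single: "\<And>m c. P (Poly_Mapping.single m (c::complex))"
    and add: "\<And>p q. P p \<Longrightarrow> P q \<Longrightarrow> P (p + q)"
  shows "P (p::'m \<Rightarrow>\<^sub>0 complex)"
proof -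
  have zero: "P 0" using single[of undefined 0] by simp
  have *: "P (\<Sum>m\<in>K. Poly_Mapping.single m (Poly_Mapping.lookup p m))" for K
    by (induction K rule: infinite_finite_induct) (auto simp: zero single add)
  have "p = (\<Sum>m\<in>Poly_Mapping.keys p. Poly_Mapping.single m (Poly_Mapping.lookup p m))"
    by (rule poly_mapping_eqI)
       (auto simp: lookup_sum lookup_single when_def in_keys_iff sum.delta')
  then show ?thesis using *[of "Poly_Mapping.keys p"] by simp
qed

lemma lin_ext_mult:
  assumes bil: "cbilinear mul" and f: "\<And>m n. f (m + n) = mul (f m) (f n)"
  shows "lin_ext f (p * q) = mul (lin_ext f p) (lin_ext f q)"
proof (induction p rule: poly_mapping_single_induct)
  case (single m c)
  show ?case
  proof (induction q rule: poly_mapping_single_induct)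
    case (single n c')
    show ?case using bil
      by (simp add: mult_single f cbilinear_def clinear_def scaleC_scaleC mult.commute)
  next
    case (add p q)
    then show ?case using bil by (simp add: distrib_left lin_ext_add cbilinear_def clinear_def)
  qed
next
  case (add p q)
  then show ?case using bil by (simp add: distrib_right lin_ext_add cbilinear_def clinear_def)
qed

lemma lin_ext_scalar: 
  fixes f :: "'m::monoid_add \<Rightarrow> 'v::complex_vector"
  shows "lin_ext f (Poly_Mapping.single 0 c * p) = c *\<^sub>C lin_ext f p"
  by (induction p rule: poly_mapping_single_induct)
     (auto simp: mult_single distrib_left lin_ext_add scaleC_add_right scaleC_scaleC)

lemma single_0_commute:
  "Poly_Mapping.single 0 c * p = p * Poly_Mapping.single (0::'m::monoid_add) (c::complex)"
  by (induction p rule: poly_mapping_single_induct)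
     (auto simp: mult_single distrib_left distrib_right mult.commute)

section \<open>The universal enveloping algebra of \<open>gl\<^sub>d\<close>\<close>

text \<open>The index set \<open>{1, \<dots>, d}\<close> is a finite linearly ordered type \<open>'n\<close> with \<open>CARD('n) = d\<close>.\<close>

datatype 'a free_monoid = Word "'a list"

instantiation free_monoid :: (type) monoid_add
begin
definition zero_free_monoid :: "'a free_monoid" where "0 = Word []"
fun plus_free_monoid :: "'a free_monoid \<Rightarrow> 'a free_monoid \<Rightarrow> 'a free_monoid" where
  "Word u + Word v = Word (u @ v)"
instance
proof
  fix a b c :: "'a free_monoid"
  show "a + b + c = a + (b + c)" by (cases a; cases b; cases c) simp
  show "0 + a = a" "a + 0 = a" by (cases a; simp add: zero_free_monoid_def)+
qed
end

type_synonym 'n free_alg = "('n \<times> 'n) free_monoid \<Rightarrow>\<^sub>0 complex"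

definition free_gen :: "'n \<Rightarrow> 'n \<Rightarrow> 'n free_alg" where
  "free_gen i j = Poly_Mapping.single (Word [(i, j)]) 1"

definition gl_relations :: "'n free_alg set" where
  "gl_relations = {free_gen i j * free_gen k l - free_gen k l * free_gen i j
     - ((if j = k then free_gen i l else 0) - (if i = l then free_gen k j else 0)) | i j k l. True}"

quotient_type 'n ugl = "'n free_alg" / "ideal_cong gl_relations"
  by (rule equivp_ideal_cong)

lift_definition egl :: "'n \<Rightarrow> 'n \<Rightarrow> 'n ugl" is free_gen .

lemma lookup_mult_empty_word:
  "Poly_Mapping.lookup (p * q) (0::'a free_monoid) = Poly_Mapping.lookup p 0 * Poly_Mapping.lookup q (0) "
  for p q :: "'a free_monoid \<Rightarrow>\<^sub>0 complex"
proof (induction p rule: poly_mapping_single_induct)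
  case (single m c)
  show ?case
  proof (induction q rule: poly_mapping_single_induct)
    case (single n c')
    show ?case
      by (cases m; cases n) (auto simp: mult_single lookup_single when_def zero_free_monoid_def)
  next
    case (add p q)
    then show ?case by (simp add: distrib_left lookup_add)
  qed
next
  case (add p q)
  then show ?case by (simp add: distrib_right lookup_add)
qed

lemma one_notin_gl_ideal: "(1 :: 'n free_alg) \<notin> two_sided_ideal gl_relations"
proof -
  have "Poly_Mapping.lookup p 0 = 0" if "p \<in> two_sided_ideal gl_relations" for p :: "'n free_alg"
    using that
  proof (induction rule: two_sided_ideal.induct)
    case (step x r a b)
    have "Poly_Mapping.lookup r 0 = 0" using step(2)
      by (auto simp: gl_relations_def free_gen_def lookup_minus mult_single lookup_single when_def
          zero_free_monoid_def)
    then show ?case using step by (simp add: lookup_add lookup_mult_empty_word)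
  qed simp
  then show ?thesis by fastforce
qed

instantiation ugl :: (type) "{ring_1, complex_algebra_1}"
begin
lift_definition zero_ugl :: "'a ugl" is 0 .
lift_definition one_ugl :: "'a ugl" is 1 .
lift_definition plus_ugl :: "'a ugl \<Rightarrow> 'a ugl \<Rightarrow> 'a ugl" is "(+)" by (rule ideal_cong_add)
lift_definition minus_ugl :: "'a ugl \<Rightarrow> 'a ugl \<Rightarrow> 'a ugl" is "(-)" by (rule ideal_cong_diff)
lift_definition uminus_ugl :: "'a ugl \<Rightarrow> 'a ugl" is uminus by (rule ideal_cong_minus)
lift_definition times_ugl :: "'a ugl \<Rightarrow> 'a ugl \<Rightarrow> 'a ugl" is "(*)" by (rule ideal_cong_mult)
lift_definition scaleC_ugl :: "complex \<Rightarrow> 'a ugl \<Rightarrow> 'a ugl" is "\<lambda>c p. Poly_Mapping.single 0 c * p"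
  by (rule ideal_cong_mult[OF ideal_cong_refl])
instance
proof
  fix a b x y z :: "'a ugl" and c c' :: complex
  show "x + y + z = x + (y + z)" "x + y = y + x" "0 + x = x" "- x + x = 0" "x - y = x + - y"
    "x * y * z = x * (y * z)" "(x + y) * z = x * z + y * z" "x * (y + z) = x * y + x * z"
    "1 * x = x" "x * 1 = x"
    "c *\<^sub>C (x + y) = c *\<^sub>C x + c *\<^sub>C y" 
    by (transfer; simp add: algebra_simps ideal_cong_refl)+
  show "(0::'a ugl) \<noteq> 1"
    by transfer (metis one_notin_gl_ideal ideal_cong_def minus_diff_eq diff_0_right two_sided_ideal_minus)
  show "(c + c') *\<^sub>C x = c *\<^sub>C x + c' *\<^sub>C x"
    by transfer (simp add: single_add distrib_right ideal_cong_refl)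
  show "c *\<^sub>C c' *\<^sub>C x = (c * c') *\<^sub>C x"
    by transfer (simp add: mult_single ideal_cong_refl flip: mult.assoc)
  show "1 *\<^sub>C x = x"
    by transfer (simp add: ideal_cong_refl)
  show "c *\<^sub>C x * y = c *\<^sub>C (x * y)"
    by transfer (simp add: mult.assoc ideal_cong_refl)
  show "x * c *\<^sub>C y = c *\<^sub>C (x * y)"
    by transfer (metis mult.assoc ideal_cong_refl single_0_commute)
qed
end

lemma egl_commutator:
  "egl i j * egl k l - egl k l * egl i j = (if j = k then egl i l else 0) - (if i = l then egl k j else (0::'n ugl))"
proof -
  have *: "ideal_cong gl_relations (free_gen i j * free_gen k l - free_gen k l * free_gen i j)
     ((if j = k then free_gen i l else 0) - (if i = l then free_gen k j else 0))"
    for i j k l :: 'n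
    unfolding ideal_cong_def by (rule two_sided_ideal_gen) (auto simp: gl_relations_def)
  have "abs_ugl (free_gen i j * free_gen k l - free_gen k l * free_gen i j)
     = abs_ugl ((if j = k then free_gen i l else 0) - (if i = l then free_gen k j else 0))"
    using * by (simp only: ugl.abs_eq_iff)
  then show ?thesis
    by (simp add: egl.abs_eq times_ugl.abs_eq minus_ugl.abs_eq zero_ugl_def uminus_ugl.abs_eq
        plus_ugl.abs_eq split: if_splits)
qed

text \<open>Universal property. The multiplication of the target is an explicit argument because that of
  the library's square matrices is not the type class operation.\<close>

definition assoc_unital :: "('v \<Rightarrow> 'v \<Rightarrow> 'v) \<Rightarrow> 'v \<Rightarrow> bool" where
  "assoc_unital mul u \<longleftrightarrow> (\<forall>x y z. mul (mul x y) z = mul x (mul y z)) \<and> (\<forall>x. mul u x = x \<and> mul x u = x)"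

lemma ugl_induct [case_names one gen add scale]:
  fixes x :: "'n ugl"
  assumes one: "P 1" and gen: "\<And>i j x. P x \<Longrightarrow> P (egl i j * x)"
    and add: "\<And>x y. P x \<Longrightarrow> P y \<Longrightarrow> P (x + y)"
    and scale: "\<And>c x. P x \<Longrightarrow> P (c *\<^sub>C x)"
  shows "P x"
proof -
  have word: "P (abs_ugl (Poly_Mapping.single (Word w) 1))" for w :: "('n \<times> 'n) list"
  proof (induction w)
    case Nil
    have "abs_ugl (Poly_Mapping.single (Word []) 1) = (1 :: 'n ugl)"
      unfolding one_ugl_def by (simp flip: zero_free_monoid_def)
    then show ?case using one by simp
  next
    case (Cons a w)
    obtain i j where a: "a = (i, j)" by force
    have "abs_ugl (Poly_Mapping.single (Word (a # w)) 1) =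
       egl i j * abs_ugl (Poly_Mapping.single (Word w) 1)"
      by (simp add: egl.abs_eq times_ugl.abs_eq free_gen_def mult_single a)
    then show ?case using gen Cons by simp
  qed
  have "P (abs_ugl p)" for p
  proof (induction p rule: poly_mapping_single_induct)
    case (single m c)
    obtain w where m: "m = Word w" by (cases m)
    have "abs_ugl (Poly_Mapping.single m c) = c *\<^sub>C abs_ugl (Poly_Mapping.single (Word w) 1)"
      by (simp add: scaleC_ugl.abs_eq mult_single m)
    then show ?case using scale word by simp
  next
    case (add p q)
    then show ?case using assms(3) by (simp flip: plus_ugl.abs_eq)
  qed
  then show ?thesis by (metis ugl.abs_induct)
qed

lemma ugl_hom_unique:
  fixes \<phi> \<psi> :: "'n ugl \<Rightarrow> 'v::complex_vector"
  assumes "clinear \<phi>" "clinear \<psi>" "\<phi> 1 = \<psi> 1"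
    and "\<And>x y. \<phi> (x * y) = mul (\<phi> x) (\<phi> y)" "\<And>x y. \<psi> (x * y) = mul (\<psi> x) (\<psi> y)"
    and "\<And>i j. \<phi> (egl i j) = \<psi> (egl i j)"
  shows "\<phi> = \<psi>"
proof
  fix x show "\<phi> x = \<psi> x"
    using assms by (induction x rule: ugl_induct) (simp_all add: clinear_def)
qed

lemma ugl_hom_exists:
  fixes g :: "'n \<Rightarrow> 'n \<Rightarrow> 'v::complex_vector"
  assumes bil: "cbilinear mul" and mon: "assoc_unital mul u"
    and rel: "\<And>i j k l. mul (g i j) (g k l) - mul (g k l) (g i j)
               = (if j = k then g i l else 0) - (if i = l then g k j else 0)"
  shows "\<exists>\<phi>. clinear \<phi> \<and> \<phi> 1 = u \<and> (\<forall>x y. \<phi> (x * y) = mul (\<phi> x) (\<phi> y)) \<and> (\<forall>i j. \<phi> (egl i j) = g i j)"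
proof -
  define f where "f m = (case m of Word w \<Rightarrow> foldr (\<lambda>(i, j). mul (g i j)) w u)" for m
  have f_append: "f (Word (v @ w)) = mul (f (Word v)) (f (Word w))" for v w
    using mon by (induction v) (auto simp: f_def assoc_unital_def)
  have f_add: "f (m + n) = mul (f m) (f n)" for m n
    by (cases m; cases n) (simp add: f_append)
  note hom = lin_ext_mult[of mul f, OF bil f_add]
  have f1: "lin_ext f 1 = u"
    using lin_ext_single[of f 0 1] unfolding single_one
    by (simp add: scaleC_one f_def zero_free_monoid_def)
  have fg: "lin_ext f (free_gen i j) = g i j" for i j
    using mon by (simp add: free_gen_def scaleC_one f_def assoc_unital_def)
  have kill_rel: "lin_ext f r = 0" if "r \<in> gl_relations" for r
    using that rel unfolding gl_relations_def
    by (auto simp: lin_ext_diff hom fg)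
  have mul0: "mul x 0 = 0" "mul 0 x = 0" for x
    using bil unfolding cbilinear_def by (metis clinear_zero)+
  have kill: "lin_ext f p = 0" if "p \<in> two_sided_ideal gl_relations" for p
    using that by (induction) (simp_all add: lin_ext_add hom kill_rel mul0)
  have resp: "lin_ext f p = lin_ext f q" if "ideal_cong gl_relations p q" for p q
    using kill[of "p - q"] that by (simp add: ideal_cong_def lin_ext_diff)
  define \<phi> where "\<phi> x = lin_ext f (rep_ugl x)" for x
  have phi_abs: "\<phi> (abs_ugl p) = lin_ext f p" for p
    unfolding \<phi>_def by (rule resp) (metis Quotient3_rep_abs Quotient3_ugl ideal_cong_refl)
  have "\<phi> (x + y) = \<phi> x + \<phi> y" "\<phi> (x * y) = mul (\<phi> x) (\<phi> y)" for x y
    by (induction x rule: ugl.abs_induct; induction y rule: ugl.abs_induct;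
        simp add: phi_abs plus_ugl.abs_eq times_ugl.abs_eq lin_ext_add hom)+
  moreover have "\<phi> (c *\<^sub>C x) = c *\<^sub>C \<phi> x" for c x
    by (induction x rule: ugl.abs_induct) (simp add: phi_abs scaleC_ugl.abs_eq lin_ext_scalar)
  moreover have "\<phi> 1 = u" "\<phi> (egl i j) = g i j" for i j
    by (simp_all add: one_ugl_def phi_abs f1 egl.abs_eq fg)
  ultimately show ?thesis by (intro exI[of _ \<phi>]) (simp add: clinear_def)
qed

definition Igl :: "'n::finite ugl" where
  "Igl = (\<Sum>i\<in>UNIV. egl i i)"

definition last_index :: "'n::{finite,linorder}" where
  "last_index = Max UNIV"

definition next_index :: "'n::{finite,linorder} \<Rightarrow> 'n" where
  "next_index i = Min {i<..}"

definition hgl :: "'n::{finite,linorder} \<Rightarrow> 'n ugl" where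
  "hgl i = egl i i - egl (next_index i) (next_index i)"

section \<open>Tensor products of algebras\<close>

text \<open>\<open>A \<otimes> B\<close> is the algebra of the monoid of pairs \<open>(a, b)\<close> under componentwise multiplication,
  modulo the bilinearity relations.\<close>

datatype ('a, 'b) simple_tensor = Simple 'a 'b

instantiation simple_tensor :: (monoid_mult, monoid_mult) monoid_add
begin
definition zero_simple_tensor :: "('a, 'b) simple_tensor" where "0 = Simple 1 1"
fun plus_simple_tensor :: "('a, 'b) simple_tensor \<Rightarrow> ('a, 'b) simple_tensor \<Rightarrow> ('a, 'b) simple_tensor"
  where "Simple a b + Simple a' b' = Simple (a * a') (b * b')"
instance
proof
  fix a b c :: "('a, 'b) simple_tensor"
  show "a + b + c = a + (b + c)" by (cases a; cases b; cases c) (simp add: mult.assoc)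
  show "0 + a = a" "a + 0 = a" by (cases a; simp add: zero_simple_tensor_def)+
qed
end

type_synonym ('a, 'b) pre_tensor = "('a, 'b) simple_tensor \<Rightarrow>\<^sub>0 complex"

abbreviation (input) pure_tensor :: "'a \<Rightarrow> 'b \<Rightarrow> complex \<Rightarrow> ('a, 'b) pre_tensor" where
  "pure_tensor x y c \<equiv> Poly_Mapping.single (Simple x y) c"

definition tensor_relations :: "('a::complex_algebra_1, 'b::complex_algebra_1) pre_tensor set" where
  "tensor_relations =
     {pure_tensor (x + x') y 1 - pure_tensor x y 1 - pure_tensor x' y 1 | x x' y. True} \<union>
     {pure_tensor x (y + y') 1 - pure_tensor x y 1 - pure_tensor x y' 1 | x y y'. True} \<union>
     {pure_tensor (c *\<^sub>C x) y 1 - pure_tensor x y c | c x y. True} \<union>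
     {pure_tensor x (c *\<^sub>C y) 1 - pure_tensor x y c | c x y. True}"

quotient_type (overloaded) ('a, 'b) tensor = "('a::complex_algebra_1, 'b::complex_algebra_1) pre_tensor" /
    "ideal_cong tensor_relations"
  by (rule equivp_ideal_cong)

instantiation tensor :: (complex_algebra_1, complex_algebra_1) complex_algebra_1
begin
lift_definition zero_tensor :: "('a, 'b) tensor" is 0 .
lift_definition one_tensor :: "('a, 'b) tensor" is 1 .
lift_definition plus_tensor :: "('a, 'b) tensor \<Rightarrow> ('a, 'b) tensor \<Rightarrow> ('a, 'b) tensor" is "(+)"
  by (rule ideal_cong_add)
lift_definition minus_tensor :: "('a, 'b) tensor \<Rightarrow> ('a, 'b) tensor \<Rightarrow> ('a, 'b) tensor" is "(-)"
  by (rule ideal_cong_diff)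
lift_definition uminus_tensor :: "('a, 'b) tensor \<Rightarrow> ('a, 'b) tensor" is uminus
  by (rule ideal_cong_minus)
lift_definition times_tensor :: "('a, 'b) tensor \<Rightarrow> ('a, 'b) tensor \<Rightarrow> ('a, 'b) tensor" is "(*)"
  by (rule ideal_cong_mult)
lift_definition scaleC_tensor :: "complex \<Rightarrow> ('a, 'b) tensor \<Rightarrow> ('a, 'b) tensor"
  is "\<lambda>c p. Poly_Mapping.single 0 c * p"
  by (rule ideal_cong_mult[OF ideal_cong_refl])
instance
proof
  fix a b x y z :: "('a, 'b) tensor" and c c' :: complex
  show "x + y + z = x + (y + z)" "x + y = y + x" "0 + x = x" "- x + x = 0" "x - y = x + - y"
    "x * y * z = x * (y * z)" "(x + y) * z = x * z + y * z" "x * (y + z) = x * y + x * z"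
    "1 * x = x" "x * 1 = x"
    "c *\<^sub>C (x + y) = c *\<^sub>C x + c *\<^sub>C y" 
    by (transfer; simp add: algebra_simps ideal_cong_refl)+
  show "(c + c') *\<^sub>C x = c *\<^sub>C x + c' *\<^sub>C x"
    by transfer (simp add: single_add distrib_right ideal_cong_refl)
  show "c *\<^sub>C c' *\<^sub>C x = (c * c') *\<^sub>C x"
    by transfer (simp add: mult_single ideal_cong_refl flip: mult.assoc)
  show "1 *\<^sub>C x = x"
    by transfer (simp add: ideal_cong_refl)
  show "c *\<^sub>C x * y = c *\<^sub>C (x * y)"
    by transfer (simp add: mult.assoc ideal_cong_refl)
  show "x * c *\<^sub>C y = c *\<^sub>C (x * y)"
    by transfer (metis mult.assoc ideal_cong_refl single_0_commute)
qed
end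

lift_definition tensor_of :: "'a::complex_algebra_1 \<Rightarrow> 'b::complex_algebra_1 \<Rightarrow> ('a, 'b) tensor"
    (infixr "\<otimes>" 76)
  is "\<lambda>x y. pure_tensor x y 1" .

lemma tensor_mult: "(a \<otimes> b) * (a' \<otimes> b') = (a * a') \<otimes> (b * b')"
  by transfer (simp add: mult_single ideal_cong_refl)

lemma one_tensor_one: "1 \<otimes> 1 = 1"
proof -
  have "pure_tensor 1 1 1 = (1 :: ('a, 'b) pre_tensor)"
    unfolding zero_simple_tensor_def[symmetric] by (rule single_one)
  then show ?thesis by transfer (simp add: ideal_cong_refl)
qed

lemma tensor_add_left: "(x + x') \<otimes> y = x \<otimes> y + x' \<otimes> y"
  apply transfer
  apply (simp only: ideal_cong_def diff_diff_add[symmetric])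
  apply (rule two_sided_ideal_gen)
  unfolding tensor_relations_def by blast

lemma tensor_add_right: "x \<otimes> (y + y') = x \<otimes> y + x \<otimes> y'"
  apply transfer
  apply (simp only: ideal_cong_def diff_diff_add[symmetric])
  apply (rule two_sided_ideal_gen)
  unfolding tensor_relations_def by blast

lemma pt_scalar: "Poly_Mapping.single 0 c * pure_tensor x y 1 = pure_tensor x y (c::complex)"
  for x :: "'a::monoid_mult" and y :: "'b::monoid_mult"
  by (simp add: mult_single)

lemma tensor_scaleC_left: "(c *\<^sub>C x) \<otimes> y = c *\<^sub>C (x \<otimes> y)"
  apply transfer
  apply (simp only: ideal_cong_def pt_scalar)
  apply (rule two_sided_ideal_gen)
  unfolding tensor_relations_def by blast

lemma tensor_scaleC_right: "x \<otimes> (c *\<^sub>C y) = c *\<^sub>C (x \<otimes> y)"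
  apply transfer
  apply (simp only: ideal_cong_def pt_scalar)
  apply (rule two_sided_ideal_gen)
  unfolding tensor_relations_def by blast

lemma cbilinear_tensor: "cbilinear (\<otimes>)"
  by (simp add: cbilinear_def clinear_def tensor_add_left tensor_add_right tensor_scaleC_left
      tensor_scaleC_right)

lemma tensor_induct [case_names simple add]:
  fixes t :: "('a::complex_algebra_1, 'b::complex_algebra_1) tensor"
  assumes simple: "\<And>x y. P (x \<otimes> y)" and add: "\<And>s t. P s \<Longrightarrow> P t \<Longrightarrow> P (s + t)"
  shows "P t"
proof -
  have "P (abs_tensor p)" for p
  proof (induction p rule: poly_mapping_single_induct)
    case (single m c)
    obtain x y where m: "m = Simple x y" by (cases m)
    have "abs_tensor (Poly_Mapping.single m c) = c *\<^sub>C (x \<otimes> y)"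
      by (simp add: scaleC_tensor.abs_eq tensor_of.abs_eq mult_single m)
    also have "\<dots> = (c *\<^sub>C x) \<otimes> y" by (simp add: tensor_scaleC_left)
    finally show ?case using simple by simp
  next
    case (add p q)
    then show ?case using assms(2) by (simp flip: plus_tensor.abs_eq)
  qed
  then show ?thesis by (metis tensor.abs_induct)
qed

lemma tensor_map_unique:
  assumes "clinear L" "clinear L'" "\<And>x y. L (x \<otimes> y) = L' (x \<otimes> y)"
  shows "L = L'"
proof
  fix t show "L t = L' t"
    using assms by (induction t rule: tensor_induct) (simp_all add: clinear_def)
qed

lemma tensor_map_exists:
  fixes \<beta> :: "'a::complex_algebra_1 \<Rightarrow> 'b::complex_algebra_1 \<Rightarrow> 'v::complex_vector"
  assumes bil: "cbilinear \<beta>"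
  shows "\<exists>L. clinear L \<and> (\<forall>x y. L (x \<otimes> y) = \<beta> x y)"
proof -
  define f where "f m = (case m of Simple x y \<Rightarrow> \<beta> x y)" for m
  have f_simps [simp]: "f (Simple x y) = \<beta> x y" for x y by (simp add: f_def)
  have bil': "\<beta> (x + x') y = \<beta> x y + \<beta> x' y" "\<beta> x (y + y') = \<beta> x y + \<beta> x y'"
    "\<beta> (c *\<^sub>C x) y = c *\<^sub>C \<beta> x y" "\<beta> x (c *\<^sub>C y) = c *\<^sub>C \<beta> x y" for x x' y y' c
    using bil by (simp_all add: cbilinear_def clinear_def)
  have kill_simple: "lin_ext f (Poly_Mapping.single m c * r * Poly_Mapping.single n c') = 0"
    if "r \<in> tensor_relations" for r m n c c'
  proof -
    obtain a b a' b' where mn: "m = Simple a b" "n = Simple a' b'" by (cases m; cases n)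
    have comm: "c * c' * w = c * w * c'" for w by simp
    show ?thesis
      using that unfolding tensor_relations_def Un_iff mem_Collect_eq
      by (elim disjE exE conjE)
         (simp_all add: mn mult_single left_diff_distrib right_diff_distrib lin_ext_diff distrib_left
          distrib_right bil' scaleC_mult_left scaleC_mult_right scaleC_add_right scaleC_scaleC comm)
  qed
  have kill_left: "lin_ext f (Poly_Mapping.single m c * r * b) = 0"
    if "r \<in> tensor_relations" for r m c b
    by (induction b rule: poly_mapping_single_induct)
       (simp_all add: kill_simple[OF that] distrib_left lin_ext_add)
  have kill_rel: "lin_ext f (a * r * b) = 0" if "r \<in> tensor_relations" for r a b
    by (induction a rule: poly_mapping_single_induct)
       (simp_all add: kill_left[OF that] distrib_right lin_ext_add)
  have kill: "lin_ext f p = 0" if "p \<in> two_sided_ideal tensor_relations" for p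
    using that by (induction) (simp_all add: lin_ext_add kill_rel)
  have resp: "lin_ext f p = lin_ext f q" if "ideal_cong tensor_relations p q" for p q
    using kill[of "p - q"] that by (simp add: ideal_cong_def lin_ext_diff)
  define L where "L t = lin_ext f (rep_tensor t)" for t
  have L_abs: "L (abs_tensor p) = lin_ext f p" for p
    unfolding L_def by (rule resp) (metis Quotient3_rep_abs Quotient3_tensor ideal_cong_refl)
  have "L (s + t) = L s + L t" for s t
    by (induction s rule: tensor.abs_induct; induction t rule: tensor.abs_induct)
       (simp add: L_abs plus_tensor.abs_eq lin_ext_add)
  moreover have "L (c *\<^sub>C t) = c *\<^sub>C L t" for c t
    by (induction t rule: tensor.abs_induct) (simp add: L_abs scaleC_tensor.abs_eq lin_ext_scalar)
  moreover have "L (x \<otimes> y) = \<beta> x y" for x y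
    by (simp add: tensor_of.abs_eq L_abs scaleC_one)
  ultimately show ?thesis by (intro exI[of _ L]) (simp add: clinear_def)
qed

text \<open>The linear map \<open>A \<otimes> B \<rightarrow> V\<close> with \<open>x \<otimes> y \<mapsto> \<beta> x y\<close>, for bilinear \<open>\<beta>\<close>.\<close>

definition tensor_map ::
    "('a::complex_algebra_1 \<Rightarrow> 'b::complex_algebra_1 \<Rightarrow> 'v::complex_vector) \<Rightarrow> ('a, 'b) tensor \<Rightarrow> 'v" where
  "tensor_map \<beta> = (THE L. clinear L \<and> (\<forall>x y. L (x \<otimes> y) = \<beta> x y))"

lemma tensor_map:
  assumes "cbilinear \<beta>"
  shows "clinear (tensor_map \<beta>)" "tensor_map \<beta> (x \<otimes> y) = \<beta> x y"
proof -
  have "\<exists>!L. clinear L \<and> (\<forall>x y. L (x \<otimes> y) = \<beta> x y)"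
  proof (rule ex_ex1I[OF tensor_map_exists[OF assms]])
    fix L L' assume "clinear L \<and> (\<forall>x y. L (x \<otimes> y) = \<beta> x y)" "clinear L' \<and> (\<forall>x y. L' (x \<otimes> y) = \<beta> x y)"
    then show "L = L'" by (intro tensor_map_unique) auto
  qed
  from theI'[OF this] show "clinear (tensor_map \<beta>)" "tensor_map \<beta> (x \<otimes> y) = \<beta> x y"
    by (simp_all add: tensor_map_def)
qed


section \<open>The coproduct, the standard representation and the operator \<open>P\<close>\<close>

definition is_coproduct :: "('n::{finite,linorder} ugl \<Rightarrow> ('n ugl, 'n ugl) tensor) \<Rightarrow> bool" where
  "is_coproduct D \<longleftrightarrow> calg_hom D \<and> D Igl = Igl \<otimes> Igl
     \<and> (\<forall>i j. i \<noteq> j \<longrightarrow> D (egl i j) = 1 \<otimes> egl i j + egl i j \<otimes> 1)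
     \<and> (\<forall>i. i \<noteq> last_index \<longrightarrow> D (hgl i) = 1 \<otimes> hgl i + hgl i \<otimes> 1)"

definition coproduct :: "'n::{finite,linorder} ugl \<Rightarrow> ('n ugl, 'n ugl) tensor" where
  "coproduct = (THE D. is_coproduct D)"

lemma Igl_central: "Igl * x = x * (Igl :: 'n::finite ugl)"
proof (induction x rule: ugl_induct)
  case (gen k l x)
  have "Igl * egl k l - egl k l * Igl = (0 :: 'n ugl)"
    by (simp add: Igl_def sum_distrib_left sum_distrib_right egl_commutator sum_subtractf
        flip: sum_subtractf)
       (simp add: sum_subtractf)
  then have "Igl * egl k l = egl k l * (Igl :: 'n ugl)" by simp
  then show ?case by (metis gen mult.assoc)
qed (simp_all add: distrib_left distrib_right scaleC_mult_left scaleC_mult_right)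

lemma coproduct_exists: "\<exists>D :: 'n::{finite,linorder} ugl \<Rightarrow> ('n ugl, 'n ugl) tensor. is_coproduct D"
proof -
  define prim :: "'n ugl \<Rightarrow> ('n ugl, 'n ugl) tensor" where "prim x = 1 \<otimes> x + x \<otimes> 1" for x
  have lin: "clinear prim"
    by (simp add: clinear_def prim_def tensor_add_left tensor_add_right tensor_scaleC_left
        tensor_scaleC_right scaleC_add_right)
  have comm: "prim x * prim y - prim y * prim x = prim (x * y - y * x)" for x y
    by (simp add: clinear_diff[OF lin])
       (simp add: prim_def algebra_simps tensor_mult)
  define d where "d = complex_of_nat CARD('n)"
  have d: "d \<noteq> 0" by (simp add: d_def)
  define C :: "('n ugl, 'n ugl) tensor" where "C = (1 / d) *\<^sub>C (Igl \<otimes> Igl) - prim ((1 / d) *\<^sub>C Igl)"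
  have central: "C * prim x = prim x * C" for x
    by (simp add: C_def prim_def algebra_simps tensor_mult Igl_central scaleC_mult_left
        scaleC_mult_right tensor_scaleC_left tensor_scaleC_right scaleC_add_right)
  define g where "g i j = prim (egl i j) + (if i = j then C else 0)" for i j
  have gcomm: "g i j * g k l - g k l * g i j = prim (egl i j * egl k l - egl k l * egl i j)" for i j k l
    unfolding comm[symmetric] g_def by (simp add: algebra_simps central)
  have rel: "g i j * g k l - g k l * g i j
     = (if j = k then g i l else 0) - (if i = l then g k j else 0)" for i j k l
    unfolding gcomm egl_commutator clinear_diff[OF lin]
    by (auto simp: g_def clinear_zero[OF lin])
  have bil: "cbilinear ((*) :: ('n ugl, 'n ugl) tensor \<Rightarrow> _)"
    by (simp add: cbilinear_def clinear_def distrib_left distrib_right scaleC_mult_left scaleC_mult_right)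
  have mon: "assoc_unital (*) (1 :: ('n ugl, 'n ugl) tensor)"
    by (simp add: assoc_unital_def mult.assoc)
  obtain D where D: "clinear D" "D 1 = 1" "\<And>x y. D (x * y) = D x * D y" "\<And>i j. D (egl i j) = g i j"
    using ugl_hom_exists[OF bil mon rel] by blast
  have sum_const: "(\<Sum>i\<in>(UNIV::'n set). x) = d *\<^sub>C x" for x :: "('n ugl, 'n ugl) tensor"
  proof -
    have "(\<Sum>i\<in>A. x) = of_nat (card A) *\<^sub>C x" if "finite A" for A :: "'n set"
      using that by induction (simp_all add: scaleC_add_left scaleC_one)
    then show ?thesis by (simp add: d_def)
  qed
  have "D Igl = prim Igl + d *\<^sub>C C"
    by (simp add: Igl_def clinear_sum[OF D(1)] D(4) g_def sum.distrib clinear_sum[OF lin] sum_const)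
  also have "\<dots> = Igl \<otimes> Igl"
    using d lin by (simp add: C_def scaleC_diff_right scaleC_scaleC scaleC_one clinear_def)
  finally have "D Igl = Igl \<otimes> Igl" .
  moreover have "D (hgl i) = prim (hgl i)" for i
    by (simp add: hgl_def clinear_diff[OF D(1)] clinear_diff[OF lin] D(4) g_def)
  ultimately have "is_coproduct D"
    unfolding is_coproduct_def calg_hom_def using D by (simp add: g_def prim_def)
  then show ?thesis by blast
qed

lemma next_index_greater: "i \<noteq> last_index \<Longrightarrow> i < next_index i"
proof -
  assume "i \<noteq> last_index"
  then have "i < last_index" unfolding last_index_def
    by (metis Max_ge UNIV_I finite order_le_imp_less_or_eq)
  then have "{i<..} \<noteq> {}" by auto
  then show ?thesis unfolding next_index_def by (metis Min_in finite greaterThan_iff)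
qed

lemma coproduct_unique:
  assumes "is_coproduct D" "is_coproduct (D' :: 'n::{finite,linorder} ugl \<Rightarrow> _)"
  shows "D = D'"
proof (rule ugl_hom_unique[where mul = "(*)"])
  have D: "clinear D" "clinear D'" using assms by (simp_all add: is_coproduct_def calg_hom_def)
  show "clinear D" "clinear D'" by (fact D)+
  show "D 1 = D' 1" "\<And>x y. D (x * y) = D x * D y" "\<And>x y. D' (x * y) = D' x * D' y"
    using assms by (simp_all add: is_coproduct_def calg_hom_def)
  define Z where "Z i = D (egl i i) - D' (egl i i)" for i
  have step: "Z i = Z (next_index i)" if "i \<noteq> last_index" for i
  proof -
    have "D (hgl i) = D' (hgl i)" using assms that by (simp add: is_coproduct_def)
    then show ?thesis by (simp add: hgl_def clinear_diff D Z_def algebra_simps)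
  qed
  have const: "Z i = Z last_index" for i
  proof (induction "card {i<..}" arbitrary: i rule: less_induct)
    case less
    show ?case
    proof (cases "i = last_index")
      case False
      then have "card {next_index i<..} < card {i<..}"
        using next_index_greater[OF False] by (intro psubset_card_mono) auto
      then show ?thesis using less step[OF False] by simp
    qed simp
  qed
  have "(\<Sum>i\<in>UNIV. Z i) = D Igl - D' Igl"
    by (simp add: Z_def Igl_def clinear_sum D sum_subtractf)
  also have "\<dots> = 0" using assms by (simp add: is_coproduct_def)
  finally have "(\<Sum>i\<in>(UNIV::'n set). Z last_index) = 0"
    using sum.cong[OF refl, of "UNIV :: 'n set" Z "\<lambda>i. Z last_index"] const by simp
  moreover have "(\<Sum>i\<in>A. x) = of_nat (card A) *\<^sub>C x" if "finite A"
    for A :: "'n set" and x :: "('n ugl, 'n ugl) tensor"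
    using that by induction (simp_all add: scaleC_add_left scaleC_one)
  ultimately have "of_nat CARD('n) *\<^sub>C Z last_index = 0" by simp
  then have "(1 / of_nat CARD('n)) *\<^sub>C of_nat CARD('n) *\<^sub>C Z last_index = 0"
    by (metis scaleC_zero_right)
  then have "Z last_index = 0" by (simp add: scaleC_scaleC scaleC_one)
  then show "D (egl i j) = D' (egl i j)" for i j
    using assms const[of i] by (cases "i = j") (auto simp: Z_def is_coproduct_def)
qed

lemma is_coproduct_coproduct: "is_coproduct (coproduct :: 'n::{finite,linorder} ugl \<Rightarrow> ('n ugl, 'n ugl) tensor)"
  unfolding coproduct_def
  using theI'[of is_coproduct] coproduct_exists coproduct_unique by blast

definition matrix_unit :: "'n \<Rightarrow> 'n \<Rightarrow> complex ^ 'n ^ 'n" where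
  "matrix_unit i j = (\<chi> a b. if a = i \<and> b = j then 1 else 0)"

definition is_std_rep :: "('n::finite ugl \<Rightarrow> complex ^ 'n ^ 'n) \<Rightarrow> bool" where
  "is_std_rep r \<longleftrightarrow> clinear r \<and> r 1 = mat 1 \<and> (\<forall>x y. r (x * y) = r x ** r y)
     \<and> (\<forall>i j. r (egl i j) = matrix_unit i j)"

definition std_rep :: "'n::finite ugl \<Rightarrow> complex ^ 'n ^ 'n" where
  "std_rep = (THE r. is_std_rep r)"

lemma matrix_unit_mult:
  "matrix_unit i j ** matrix_unit k l = (if j = k then matrix_unit i l else 0)"
proof -
  have "(\<Sum>m\<in>UNIV. (if a = i \<and> m = j then 1 else 0) * (if m = k \<and> b = l then 1 else 0))
     = (if j = k \<and> a = i \<and> b = l then 1 else (0::complex))" for a b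
  proof -
    have "(\<Sum>m\<in>UNIV. (if a = i \<and> m = j then 1 else 0) * (if m = k \<and> b = l then 1 else 0))
       = (\<Sum>m\<in>UNIV. if m = j then (if j = k \<and> a = i \<and> b = l then 1 else (0::complex)) else 0)"
      by (rule sum.cong) auto
    then show ?thesis by simp
  qed
  then show ?thesis
    by (auto simp: matrix_matrix_mult_def matrix_unit_def vec_eq_iff)
qed

lemma is_std_rep_std_rep: "is_std_rep (std_rep :: 'n::finite ugl \<Rightarrow> _)"
proof -
  have bil: "cbilinear ((**) :: complex ^ 'n ^ 'n \<Rightarrow> complex ^ 'n ^ 'n \<Rightarrow> _)"
    by (auto simp: cbilinear_def clinear_def matrix_matrix_mult_def vec_eq_iff scaleC_vec_def
        scaleC_complex_def sum_distrib_left algebra_simps sum.distrib)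
  have mon: "assoc_unital (**) (mat 1 :: complex ^ 'n ^ 'n)"
    by (simp add: assoc_unital_def matrix_mul_assoc)
  have rel: "matrix_unit i j ** matrix_unit k l - matrix_unit k l ** matrix_unit i j
    = (if j = k then matrix_unit i l else 0) - (if i = l then matrix_unit k j else 0)" for i j k l :: 'n
    by (auto simp: matrix_unit_mult)
  have "\<exists>!r :: 'n ugl \<Rightarrow> _. is_std_rep r"
  proof (rule ex_ex1I)
    show "\<exists>r :: 'n ugl \<Rightarrow> _. is_std_rep r"
      using ugl_hom_exists[OF bil mon rel] unfolding is_std_rep_def .
    show "r = r'" if "is_std_rep r" "is_std_rep r'" for r r' :: "'n ugl \<Rightarrow> _"
      using that unfolding is_std_rep_def by (intro ugl_hom_unique[where mul = "(**)"]) auto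
  qed
  then show ?thesis unfolding std_rep_def by (rule theI')
qed

definition eta :: "'n::finite ugl \<Rightarrow> complex" where
  "eta x = trace (std_rep x) / of_nat CARD('n)"

text \<open>\<open>P = (id \<otimes> \<eta>) \<circ> \<Delta>\<close>, with \<open>U \<otimes> \<complex>\<close> identified with \<open>U\<close>.\<close>

definition P_op :: "'n::{finite,linorder} ugl \<Rightarrow> 'n ugl" where
  "P_op x = tensor_map (\<lambda>y z. eta z *\<^sub>C y) (coproduct x)"

lemma cbilinear_id_eta: "cbilinear (\<lambda>y (z :: 'n::finite ugl). eta z *\<^sub>C (y :: 'n ugl))"
proof -
  have "clinear (std_rep :: 'n ugl \<Rightarrow> _)"
    using is_std_rep_std_rep[where 'n = 'n] unfolding is_std_rep_def by blast
  then have "eta (x + y) = eta x + eta y" "eta (c *\<^sub>C x) = c * eta x" for x y :: "'n ugl" and c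
    by (simp_all add: eta_def clinear_def trace_add add_divide_distrib sum.distrib trace_def scaleC_vec_def
        scaleC_complex_def sum_distrib_left)
  then show ?thesis
    by (simp add: cbilinear_def clinear_def scaleC_add_left scaleC_add_right scaleC_scaleC
        mult.commute)
qed

section \<open>The algebra of local operators\<close>

text \<open>The increasing union \<open>\<Union>n. M\<^sub>d(\<complex>)\<^sup>\<otimes>\<^sup>n\<close> (with \<open>a\<close> identified with \<open>a \<otimes> 1\<close>). Its elements are
  kernels on infinite words; \<open>a \<in> M\<^sub>d(\<complex>)\<^sup>\<otimes>\<^sup>n\<close> has the kernel
  \<open>a (x\<^sub>0 \<dots> x\<^sub>n\<^sub>-\<^sub>1, y\<^sub>0 \<dots> y\<^sub>n\<^sub>-\<^sub>1)\<close> if \<open>x\<close> and \<open>y\<close> agree from position \<open>n\<close> on, and \<open>0\<close> otherwise.\<close>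

definition tail_class :: "nat \<Rightarrow> (nat \<Rightarrow> 'n) \<Rightarrow> (nat \<Rightarrow> 'n) set" where
  "tail_class n x = {y. \<forall>k\<ge>n. y k = x k}"

definition is_local :: "nat \<Rightarrow> ((nat \<Rightarrow> 'n) \<Rightarrow> (nat \<Rightarrow> 'n) \<Rightarrow> complex) \<Rightarrow> bool" where
  "is_local n a \<longleftrightarrow> (\<exists>m :: 'n list \<Rightarrow> 'n list \<Rightarrow> complex. \<forall>x y.
     a x y = (if y \<in> tail_class n x then m (map x [0..<n]) (map y [0..<n]) else 0))"

lemma tail_class_refl [simp]: "x \<in> tail_class n x"
  by (simp add: tail_class_def)

lemma tail_class_sym: "y \<in> tail_class n x \<longleftrightarrow> x \<in> tail_class n y"
  by (auto simp: tail_class_def)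

lemma tail_class_eq: "y \<in> tail_class n x \<Longrightarrow> tail_class n y = tail_class n x"
  by (auto simp: tail_class_def)

lemma tail_class_mono: "n \<le> N \<Longrightarrow> tail_class n x \<subseteq> tail_class N x"
  by (auto simp: tail_class_def)

definition splice_word :: "nat \<Rightarrow> (nat \<Rightarrow> 'n) \<Rightarrow> (nat \<Rightarrow> 'n) \<Rightarrow> nat \<Rightarrow> 'n" where
  "splice_word n x c k = (if k < n then x k else c k)"

lemma tail_class_Suc:
  "bij_betw (\<lambda>(z, i). z(n := i)) (tail_class n c \<times> UNIV) (tail_class (Suc n) c)"
proof (rule bij_betw_byWitness[where f' = "\<lambda>x. (x(n := c n), x n)"], goal_cases)
  case 4
  have "x k = c k" if "\<forall>k\<ge>Suc n. x k = c k" "k \<ge> n" "k \<noteq> n" for x k using that by auto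
  then show ?case by (fastforce simp: tail_class_def)
qed (auto simp: tail_class_def fun_eq_iff)

lemma tail_class_0: "tail_class 0 c = {c}"
  by (auto simp: tail_class_def)

lemma finite_tail_class [simp]: "finite (tail_class n (c :: nat \<Rightarrow> 'n::finite))"
proof (induction n)
  case (Suc n)
  then show ?case using bij_betw_finite[OF tail_class_Suc[of n c]] by simp
qed (simp add: tail_class_0)

lemma card_tail_class: "card (tail_class n (c :: nat \<Rightarrow> 'n::finite)) = CARD('n) ^ n"
proof (induction n)
  case (Suc n)
  then show ?case using bij_betw_same_card[OF tail_class_Suc[of n c]]
    by (simp add: card_cartesian_product mult.commute)
qed (simp add: tail_class_0)

lemma is_local_supp: "is_local n a \<Longrightarrow> a x y \<noteq> 0 \<Longrightarrow> y \<in> tail_class n x"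
  by (auto simp: is_local_def split: if_splits)

lemma is_local_cong:
  assumes "is_local n a" "\<And>k. k < n \<Longrightarrow> x k = x' k" "\<And>k. k < n \<Longrightarrow> y k = y' k"
    "y \<in> tail_class n x" "y' \<in> tail_class n x'"
  shows "a x y = a x' y'"
proof -
  obtain m where m: "\<And>x y. a x y = (if y \<in> tail_class n x then m (map x [0..<n]) (map y [0..<n]) else 0)"
    using assms(1) unfolding is_local_def by blast
  have *: "map x [0..<n] = map x' [0..<n]" "map y [0..<n] = map y' [0..<n]"
    using assms(2,3) by auto
  have "a x y = m (map x [0..<n]) (map y [0..<n])" using m assms(4) by simp
  also have "\<dots> = m (map x' [0..<n]) (map y' [0..<n])" by (simp only: *)
  also have "\<dots> = a x' y'" using m assms(5) by simp
  finally show ?thesis .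
qed

lemma is_localI:
  assumes supp: "\<And>x y. a x y \<noteq> 0 \<Longrightarrow> y \<in> tail_class n x"
    and cong: "\<And>x x' y y'. (\<And>k. k < n \<Longrightarrow> x k = x' k) \<Longrightarrow> (\<And>k. k < n \<Longrightarrow> y k = y' k) \<Longrightarrow>
      y \<in> tail_class n x \<Longrightarrow> y' \<in> tail_class n x' \<Longrightarrow> a x y = a x' y'"
  shows "is_local n a"
proof -
  let ?w = "\<lambda>u k. if k < n then u ! k else undefined"
  have "a x y = (if y \<in> tail_class n x then a (?w (map x [0..<n])) (?w (map y [0..<n])) else 0)" for x y
  proof (cases "y \<in> tail_class n x")
    case True
    then show ?thesis by (simp, intro cong) (auto simp: tail_class_def)
  qed (use supp in auto)
  then show ?thesis unfolding is_local_def by (intro exI[of _ "\<lambda>u v. a (?w u) (?w v)"]) blast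
qed

lemma is_local_mono:
  fixes a :: "(nat \<Rightarrow> 'n) \<Rightarrow> (nat \<Rightarrow> 'n) \<Rightarrow> complex"
  assumes "is_local n a" "n \<le> N" shows "is_local N a"
proof (rule is_localI)
  show "y \<in> tail_class N x" if "a x y \<noteq> 0" for x y
    by (rule subsetD[OF tail_class_mono[OF assms(2)] is_local_supp[OF assms(1), OF that]])
next
  fix x x' y y' :: "nat \<Rightarrow> 'n"
  assume *: "\<And>k. k < N \<Longrightarrow> x k = x' k" "\<And>k. k < N \<Longrightarrow> y k = y' k"
    "y \<in> tail_class N x" "y' \<in> tail_class N x'"
  then have "y k = x k \<longleftrightarrow> y' k = x' k" for k
    by (cases "k < N") (simp_all add: tail_class_def)
  then have iff: "y \<in> tail_class n x \<longleftrightarrow> y' \<in> tail_class n x'"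
    by (simp add: tail_class_def)
  show "a x y = a x' y'"
  proof (cases "y \<in> tail_class n x")
    case True
    show ?thesis
      by (rule is_local_cong[OF assms(1)]) (use True iff * assms(2) in auto)
  next
    case False
    then have "a x y = 0" "a x' y' = 0"
      using iff is_local_supp[OF assms(1), of x y] is_local_supp[OF assms(1), of x' y'] by blast+
    then show ?thesis by simp
  qed
qed

lemma is_local_add: "is_local n a \<Longrightarrow> is_local n b \<Longrightarrow> is_local n (\<lambda>x y. a x y + b x y)"
proof (rule is_localI, goal_cases)
  case (1 x y)
  then have "a x y \<noteq> 0 \<or> b x y \<noteq> 0" by auto
  then show ?case using 1 is_local_supp[of n a x y] is_local_supp[of n b x y] by blast
next
  case (2 x x' y y')
  then show ?case using is_local_cong[of n a x x' y y'] is_local_cong[of n b x x' y y'] by simp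
qed

lemma is_local_scale: "is_local n a \<Longrightarrow> is_local n (\<lambda>x y. c * a x y)"
proof (rule is_localI, goal_cases)
  case (1 x y)
  then show ?case using is_local_supp[of n a x y] by simp
next
  case (2 x x' y y')
  then show ?case using is_local_cong[of n a x x' y y'] by simp
qed

lemma is_local_adj: "is_local n a \<Longrightarrow> is_local n (\<lambda>x y. cnj (a y x))"
proof (rule is_localI, goal_cases)
  case (1 x y)
  then show ?case using is_local_supp[of n a y x] by (simp add: tail_class_sym)
next
  case (2 x x' y y')
  then show ?case using is_local_cong[of n a y y' x x'] by (simp add: tail_class_sym)
qed

definition kmult :: "('w \<Rightarrow> 'w \<Rightarrow> complex) \<Rightarrow> ('w \<Rightarrow> 'w \<Rightarrow> complex) \<Rightarrow> 'w \<Rightarrow> 'w \<Rightarrow> complex" where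
  "kmult a b x y = (\<Sum>z | a x z \<noteq> 0. a x z * b z y)"

lemma kmult_eq:
  assumes "is_local n a" "n \<le> N"
  shows "kmult a b x y = (\<Sum>z\<in>tail_class N x. a x z * b z (y :: nat \<Rightarrow> 'n::finite))"
  unfolding kmult_def
proof (rule sum.mono_neutral_left)
  show "{z. a x z \<noteq> 0} \<subseteq> tail_class N x"
    using is_local_supp[OF is_local_mono[OF assms], of x] by auto
qed auto

lemma is_local_kmult:
  fixes a b :: "(nat \<Rightarrow> 'n::finite) \<Rightarrow> (nat \<Rightarrow> 'n) \<Rightarrow> complex"
  assumes a: "is_local n a" and b: "is_local n b"
  shows "is_local n (kmult a b)"
proof (rule is_localI)
  fix x y assume "kmult a b x y \<noteq> 0"
  then obtain z where "a x z \<noteq> 0" "b z y \<noteq> 0"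
    unfolding kmult_def by (metis (mono_tags, lifting) mult_zero_right sum.neutral mem_Collect_eq)
  then show "y \<in> tail_class n x"
    using is_local_supp[OF a, of x z] is_local_supp[OF b, of z y] tail_class_eq[of z n x] by simp
next
  fix x x' y y' :: "nat \<Rightarrow> 'n"
  assume *: "\<And>k. k < n \<Longrightarrow> x k = x' k" "\<And>k. k < n \<Longrightarrow> y k = y' k"
    "y \<in> tail_class n x" "y' \<in> tail_class n x'"
  have "(\<Sum>z\<in>tail_class n x. a x z * b z y) = (\<Sum>z\<in>tail_class n x'. a x' z * b z y')"
  proof (rule sum.reindex_bij_witness[where i = "\<lambda>z. splice_word n z x" and j = "\<lambda>z. splice_word n z x'"])
    fix z assume z: "z \<in> tail_class n x"
    show "splice_word n (splice_word n z x') x = z" "splice_word n z x' \<in> tail_class n x'"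
      using z by (auto simp: splice_word_def tail_class_def fun_eq_iff not_less)
    have "a x z = a x' (splice_word n z x')"
      using z * by (intro is_local_cong[OF a]) (auto simp: splice_word_def tail_class_def)
    moreover have "b z y = b (splice_word n z x') y'"
      using z * by (intro is_local_cong[OF b]) (auto simp: splice_word_def tail_class_def)
    ultimately show "a x' (splice_word n z x') * b (splice_word n z x') y' = a x z * b z y" by simp
  next
    fix z assume z: "z \<in> tail_class n x'"
    show "splice_word n (splice_word n z x) x' = z" "splice_word n z x \<in> tail_class n x"
      using z by (auto simp: splice_word_def tail_class_def fun_eq_iff not_less)
  qed
  then show "kmult a b x y = kmult a b x' y'" using kmult_eq[OF a order_refl] by metis
qed

typedef 'n locop = "{a :: (nat \<Rightarrow> 'n) \<Rightarrow> (nat \<Rightarrow> 'n) \<Rightarrow> complex. \<exists>n. is_local n a}"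
  morphisms kernel Abs_locop
proof -
  have "is_local 0 (\<lambda>(x :: nat \<Rightarrow> 'n) y. 0)" by (rule is_localI) auto
  then show ?thesis by blast
qed

setup_lifting type_definition_locop

lemma locop_common:
  assumes "\<exists>n. is_local n a" "\<exists>n. is_local n b"
  obtains n where "is_local n a" "is_local n b"
proof -
  obtain i j where "is_local i a" "is_local j b" using assms by blast
  then have "is_local (max i j) a" "is_local (max i j) b" by (auto elim: is_local_mono)
  then show ?thesis by (rule that)
qed

lemma kmult_one_left: "kmult (\<lambda>x y. if x = y then 1 else 0) a = a" for a :: "'w \<Rightarrow> _"
proof (intro ext)
  fix x y :: 'w
  have "{z. (if x = z then 1 else 0) \<noteq> (0::complex)} = {x}" by auto
  then show "kmult (\<lambda>x y. if x = y then 1 else 0) a x y = a x y" by (simp add: kmult_def)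
qed

lemma kmult_one_right:
  assumes "is_local n a" shows "kmult a (\<lambda>x y. if x = y then 1 else 0) = (a :: (nat \<Rightarrow> 'n::finite) \<Rightarrow> _)"
proof (intro ext)
  fix x y
  have "kmult a (\<lambda>x y. if x = y then 1 else 0) x y = (\<Sum>z\<in>tail_class n x. if z = y then a x y else 0)"
    unfolding kmult_eq[OF assms order_refl] by (rule sum.cong) auto
  also have "\<dots> = a x y" using is_local_supp[OF assms, of x y] by auto
  finally show "kmult a (\<lambda>x y. if x = y then 1 else 0) x y = a x y" .
qed

lemma kmult_assoc:
  fixes a b c :: "(nat \<Rightarrow> 'n::finite) \<Rightarrow> (nat \<Rightarrow> 'n) \<Rightarrow> complex"
  assumes a: "is_local n a" and b: "is_local n b"
  shows "kmult (kmult a b) c = kmult a (kmult b c)"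
proof (intro ext)
  fix x y
  have "kmult (kmult a b) c x y
      = (\<Sum>z\<in>tail_class n x. \<Sum>w\<in>tail_class n x. a x w * b w z * c z y)"
    by (simp add: kmult_eq[OF is_local_kmult[OF a b] order_refl] kmult_eq[OF a order_refl] sum_distrib_right)
  also have "\<dots> = (\<Sum>w\<in>tail_class n x. \<Sum>z\<in>tail_class n x. a x w * b w z * c z y)"
    by (rule sum.swap)
  also have "\<dots> = (\<Sum>w\<in>tail_class n x. a x w * (\<Sum>z\<in>tail_class n w. b w z * c z y))"
    by (rule sum.cong) (auto simp: sum_distrib_left mult.assoc dest: tail_class_eq)
  also have "\<dots> = kmult a (kmult b c) x y"
    by (simp add: kmult_eq[OF a order_refl] kmult_eq[OF b order_refl])
  finally show "kmult (kmult a b) c x y = kmult a (kmult b c) x y" .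
qed

lemma is_local_one: "is_local 0 (\<lambda>x y. if x = y then 1 else 0)"
  by (rule is_localI) (auto simp: tail_class_def fun_eq_iff split: if_splits)

instantiation locop :: (finite) complex_algebra_1
begin
lift_definition zero_locop :: "'a locop" is "\<lambda>_ _. 0"
  by (intro exI[of _ 0] is_localI) auto
lift_definition one_locop :: "'a locop" is "\<lambda>x y. if x = y then 1 else 0"
  by (intro exI) (rule is_local_one)
lift_definition plus_locop :: "'a locop \<Rightarrow> 'a locop \<Rightarrow> 'a locop" is "\<lambda>a b x y. a x y + b x y"
  by (erule (1) locop_common) (blast intro: is_local_add)
lift_definition scaleC_locop :: "complex \<Rightarrow> 'a locop \<Rightarrow> 'a locop" is "\<lambda>c a x y. c * a x y"
  by (blast intro: is_local_scale)
lift_definition times_locop :: "'a locop \<Rightarrow> 'a locop \<Rightarrow> 'a locop" is kmult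
  by (erule (1) locop_common) (blast intro: is_local_kmult)
definition uminus_locop :: "'a locop \<Rightarrow> 'a locop" where "uminus_locop a = (- 1) *\<^sub>C a"
definition minus_locop :: "'a locop \<Rightarrow> 'a locop \<Rightarrow> 'a locop" where "minus_locop a b = a + - b"
instance
proof
  fix a b c :: "'a locop" and s t :: complex
  show "a + b + c = a + (b + c)" "a + b = b + a" "0 + a = a" 
    "s *\<^sub>C (a + b) = s *\<^sub>C a + s *\<^sub>C b" "(s + t) *\<^sub>C a = s *\<^sub>C a + t *\<^sub>C a"
    "s *\<^sub>C t *\<^sub>C a = (s * t) *\<^sub>C a" "1 *\<^sub>C a = a"
    by (transfer; simp add: algebra_simps fun_eq_iff)+
  show "- a + a = 0" unfolding uminus_locop_def by transfer (simp add: fun_eq_iff)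
  show "a - b = a + - b" by (simp add: minus_locop_def)
  show "a * b * c = a * (b * c)"
    by transfer (metis kmult_assoc locop_common)
  show "1 * a = a" by transfer (rule kmult_one_left)
  show "a * 1 = a" by transfer (auto intro: kmult_one_right)
  show "a * (b + c) = a * b + a * c"
    by transfer (auto simp: fun_eq_iff kmult_eq[OF _ order_refl] distrib_left sum.distrib)
  show "(a + b) * c = a * c + b * c"
  proof (transfer, intro ext)
    fix a b c :: "(nat \<Rightarrow> 'a) \<Rightarrow> (nat \<Rightarrow> 'a) \<Rightarrow> complex" and x y :: "nat \<Rightarrow> 'a"
    assume *: "\<exists>n. is_local n a" "\<exists>n. is_local n b"
    obtain n where n: "is_local n a" "is_local n b" by (rule locop_common[OF *])
    show "kmult (\<lambda>x y. a x y + b x y) c x y = kmult a c x y + kmult b c x y"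
      by (simp add: kmult_eq[OF is_local_add[OF n] order_refl] kmult_eq[OF n(1) order_refl]
          kmult_eq[OF n(2) order_refl] distrib_right sum.distrib)
  qed
  show "s *\<^sub>C a * b = s *\<^sub>C (a * b)"
  proof (transfer, elim exE, intro ext)
    fix s and a b :: "(nat \<Rightarrow> 'a) \<Rightarrow> (nat \<Rightarrow> 'a) \<Rightarrow> complex" and n m :: nat and x y :: "nat \<Rightarrow> 'a" assume n: "is_local n a"
    show "kmult (\<lambda>x y. s * a x y) b x y = s * kmult a b x y"
      by (simp add: kmult_eq[OF is_local_scale[OF n] order_refl] kmult_eq[OF n order_refl]
          sum_distrib_left mult.assoc)
  qed
  show "a * s *\<^sub>C b = s *\<^sub>C (a * b)"
    by transfer (auto simp: fun_eq_iff kmult_def sum_distrib_left mult_ac)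
qed
end

lift_definition adj :: "'n locop \<Rightarrow> 'n locop" is "\<lambda>a x y. cnj (a y x)"
  by (blast intro: is_local_adj)

text \<open>\<open>1 \<otimes> \<dots> \<otimes> 1 \<otimes> m \<otimes> 1 \<otimes> \<dots>\<close> with \<open>m\<close> at position \<open>k\<close>, positions being counted from \<open>0\<close>.\<close>

lift_definition site :: "nat \<Rightarrow> complex ^ 'n ^ 'n \<Rightarrow> 'n::finite locop"
  is "\<lambda>k m x y. if \<forall>l. l \<noteq> k \<longrightarrow> x l = y l then m $ x k $ y k else 0"
proof -
  fix k and m :: "complex ^ 'n ^ 'n"
  have "is_local (Suc k) (\<lambda>x y. if \<forall>l. l \<noteq> k \<longrightarrow> x l = y l then m $ x k $ y k else 0)"
    (is "is_local _ ?a")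
  proof (rule is_localI)
    show "y \<in> tail_class (Suc k) x" if "?a x y \<noteq> 0" for x y
      using that by (auto simp: tail_class_def split: if_splits)
    fix x x' y y' :: "nat \<Rightarrow> 'n" assume *: "\<And>l. l < Suc k \<Longrightarrow> x l = x' l" "\<And>l. l < Suc k \<Longrightarrow> y l = y' l"
      "y \<in> tail_class (Suc k) x" "y' \<in> tail_class (Suc k) x'"
    then have iff: "(\<forall>l. l \<noteq> k \<longrightarrow> x l = y l) \<longleftrightarrow> (\<forall>l. l \<noteq> k \<longrightarrow> x' l = y' l)"
      unfolding tail_class_def mem_Collect_eq by (metis not_le)
    have "x k = x' k" "y k = y' k" using *(1,2) by auto
    then show "?a x y = ?a x' y'" by (simp only: iff)
  qed
  then show "\<exists>n. is_local n (\<lambda>x y. if \<forall>l. l \<noteq> k \<longrightarrow> x l = y l then m $ x k $ y k else 0)" by blast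
qed

text \<open>The product state \<open>tr\<^sup>\<otimes>\<^sup>\<infinity>\<close>, on \<open>M\<^sub>d(\<complex>)\<^sup>\<otimes>\<^sup>n\<close> the normalized trace. Neither the level \<open>n\<close> nor the
  tail of the words summed over matters.\<close>

definition tr_inf :: "'n::finite locop \<Rightarrow> complex" where
  "tr_inf a = (let n = (LEAST n. is_local n (kernel a)) in
     (\<Sum>x\<in>tail_class n (\<lambda>_. undefined). kernel a x x) / of_nat (CARD('n) ^ n))"

lemma tr_level_Suc:
  fixes a :: "(nat \<Rightarrow> 'n::finite) \<Rightarrow> (nat \<Rightarrow> 'n) \<Rightarrow> complex"
  assumes "is_local n a"
  shows "(\<Sum>x\<in>tail_class (Suc n) c. a x x) = of_nat CARD('n) * (\<Sum>x\<in>tail_class n c. a x x)"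
proof -
  have "(\<Sum>x\<in>tail_class (Suc n) c. a x x) = (\<Sum>(z, i)\<in>tail_class n c \<times> UNIV. a (z(n := i)) (z(n := i)))"
    using sum.reindex_bij_betw[OF tail_class_Suc[of n c], of "\<lambda>x. a x x"]
    by (simp add: case_prod_unfold)
  also have "\<dots> = (\<Sum>(z, i)\<in>tail_class n c \<times> (UNIV :: 'n set). a z z)"
    by (rule sum.cong) (auto intro!: is_local_cong[OF assms])
  also have "\<dots> = of_nat CARD('n) * (\<Sum>x\<in>tail_class n c. a x x)"
    by (simp add: sum_distrib_left flip: sum.cartesian_product)
  finally show ?thesis .
qed

lemma tr_level_tail:
  fixes a :: "(nat \<Rightarrow> 'n::finite) \<Rightarrow> (nat \<Rightarrow> 'n) \<Rightarrow> complex"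
  assumes "is_local n a"
  shows "(\<Sum>x\<in>tail_class n c. a x x) = (\<Sum>x\<in>tail_class n c'. a x x)"
  by (rule sum.reindex_bij_witness[where i = "\<lambda>z. splice_word n z c" and j = "\<lambda>z. splice_word n z c'"])
     (auto simp: splice_word_def tail_class_def fun_eq_iff not_less intro!: is_local_cong[OF assms])

lemma tr_inf_eq:
  fixes a :: "'n::finite locop"
  assumes "is_local n (kernel a)"
  shows "tr_inf a = (\<Sum>x\<in>tail_class n c. kernel a x x) / of_nat (CARD('n) ^ n)"
proof -
  define k where "k = (LEAST n. is_local n (kernel a))"
  have k: "is_local k (kernel a)" unfolding k_def using assms by (rule LeastI)
  have "k \<le> n" unfolding k_def using assms by (rule Least_le)
  then have "(\<Sum>x\<in>tail_class n c. kernel a x x) / of_nat (CARD('n) ^ n)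
      = (\<Sum>x\<in>tail_class k c. kernel a x x) / of_nat (CARD('n) ^ k)"
  proof (induction n rule: dec_induct)
    case (step m)
    then show ?case using tr_level_Suc[OF is_local_mono[OF k step(1)], of c] by simp
  qed simp
  then show ?thesis
    using tr_level_tail[OF k, of c "\<lambda>_. undefined"] by (simp add: tr_inf_def k_def Let_def)
qed

lemma tr_inf_adj_mult:
  fixes a b :: "'n::finite locop"
  assumes "is_local n (kernel a)" "is_local n (kernel b)"
  shows "tr_inf (adj a * b) = (\<Sum>x\<in>tail_class n c. \<Sum>z\<in>tail_class n c. cnj (kernel a z x) * kernel b z x)
    / of_nat (CARD('n) ^ n)"
proof -
  have "is_local n (kernel (adj a * b))"
    using assms by transfer (intro is_local_kmult is_local_adj)
  moreover have "kernel (adj a * b) x x = (\<Sum>z\<in>tail_class n c. cnj (kernel a z x) * kernel b z x)"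
    if "x \<in> tail_class n c" for x
    using assms that by transfer (simp add: kmult_eq[OF is_local_adj order_refl] tail_class_eq)
  ultimately show ?thesis by (simp add: tr_inf_eq[of n _ c])
qed


section \<open>The infinite tensor product von Neumann algebra\<close>

text \<open>The norm of the GNS inner product \<open>\<langle>a, b\<rangle> = \<omega>(a\<^sup>* b)\<close> on local operators.\<close>

definition norm2 :: "'n::finite locop \<Rightarrow> real" where
  "norm2 a = sqrt (Re (tr_inf (adj a * a)))"

lemma norm2_eq:
  fixes a :: "'n::finite locop"
  assumes "is_local n (kernel a)"
  shows "norm2 a = sqrt ((\<Sum>x\<in>tail_class n c. \<Sum>z\<in>tail_class n c. (cmod (kernel a z x))\<^sup>2) / CARD('n) ^ n)"
proof -
  have "tr_inf (adj a * a) = complex_of_real ((\<Sum>x\<in>tail_class n c. \<Sum>z\<in>tail_class n c. (cmod (kernel a z x))\<^sup>2) / CARD('n) ^ n)"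
    unfolding tr_inf_adj_mult[OF assms assms, of c] of_real_divide of_real_sum complex_norm_square
    by (simp add: mult.commute)
  then show ?thesis by (simp add: norm2_def)
qed

lemma locop_local: "\<exists>n. is_local n (kernel a)"
  using kernel by blast

lemma norm2_nonneg: "0 \<le> norm2 a"
proof -
  obtain n where "is_local n (kernel a)" using locop_local by blast
  from norm2_eq[OF this, of undefined] show ?thesis by (simp add: sum_nonneg)
qed

lemma cmod_tr_inf_le: "cmod (tr_inf (adj a)) \<le> norm2 (a :: 'n::finite locop)"
proof -
  obtain n where n: "is_local n (kernel a)" using locop_local by blast
  let ?S = "tail_class n (\<lambda>_. undefined :: 'n)" and ?D = "real (CARD('n) ^ n)"
  have D: "?D > 0" by simp
  have n': "is_local n (kernel (adj a))" using n by transfer (rule is_local_adj)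
  have "cmod (tr_inf (adj a)) = cmod (\<Sum>x\<in>?S. cnj (kernel a x x)) / ?D"
    by (simp add: tr_inf_eq[OF n', of "\<lambda>_. undefined"] adj.rep_eq norm_divide norm_power)
  also have "\<dots> \<le> (\<Sum>x\<in>?S. cmod (kernel a x x)) / ?D"
    by (intro divide_right_mono) (auto intro: order_trans[OF norm_sum])
  also have "\<dots> \<le> norm2 a"
    unfolding norm2_eq[OF n, of "\<lambda>_. undefined"]
  proof (rule real_le_rsqrt)
    have "(\<Sum>x\<in>?S. cmod (kernel a x x) * 1)\<^sup>2 \<le> (\<Sum>x\<in>?S. (cmod (kernel a x x))\<^sup>2) * (\<Sum>x\<in>?S. 1\<^sup>2)"
      by (rule Cauchy_Schwarz_ineq_sum)
    also have "\<dots> = (\<Sum>x\<in>?S. (cmod (kernel a x x))\<^sup>2) * ?D" by (simp add: card_tail_class)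
    also have "\<dots> \<le> (\<Sum>x\<in>?S. \<Sum>z\<in>?S. (cmod (kernel a z x))\<^sup>2) * ?D"
      by (intro mult_right_mono sum_mono member_le_sum[where f = "\<lambda>z. (cmod (kernel a z _))\<^sup>2"]) auto
    finally show "((\<Sum>x\<in>?S. cmod (kernel a x x)) / ?D)\<^sup>2
        \<le> (\<Sum>x\<in>?S. \<Sum>z\<in>?S. (cmod (kernel a z x))\<^sup>2) / ?D"
      using D by (simp add: power_divide power2_eq_square divide_simps)
  qed
  finally show ?thesis .
qed

lemma kernel_bounded: "\<exists>M\<ge>0. \<forall>x y. (cmod (kernel a x y))\<^sup>2 \<le> M" for a :: "'n::finite locop"
proof -
  obtain n where n: "is_local n (kernel a)" using locop_local by blast
  let ?S = "tail_class n (\<lambda>_. undefined :: 'n)"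
  let ?M = "\<Sum>(x, y)\<in>?S \<times> ?S. (cmod (kernel a x y))\<^sup>2"
  have M: "0 \<le> ?M" by (intro sum_nonneg) auto
  have "(cmod (kernel a x y))\<^sup>2 \<le> ?M" for x y
  proof (cases "y \<in> tail_class n x")
    case True
    let ?x = "splice_word n x (\<lambda>_. undefined)" and ?y = "splice_word n y (\<lambda>_. undefined)"
    have in_S: "?x \<in> ?S" "?y \<in> ?S" by (auto simp: splice_word_def tail_class_def)
    have "kernel a x y = kernel a ?x ?y"
      using True by (intro is_local_cong[OF n]) (auto simp: splice_word_def tail_class_def)
    moreover have "(cmod (kernel a ?x ?y))\<^sup>2 \<le> ?M"
      using in_S member_le_sum[of "(?x, ?y)" "?S \<times> ?S" "\<lambda>(x, y). (cmod (kernel a x y))\<^sup>2"] by auto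
    ultimately show ?thesis by simp
  next
    case False
    then have "kernel a x y = 0" using is_local_supp[OF n, of x y] by blast
    then have "(cmod (kernel a x y))\<^sup>2 = 0" by simp
    then show ?thesis using M by linarith
  qed
  then show ?thesis using M by blast
qed

lemma norm2_mult_bound: "\<exists>K\<ge>0. \<forall>b. norm2 (a * b) \<le> K * norm2 b" for a :: "'n::finite locop"
proof -
  obtain n where n: "is_local n (kernel a)" using locop_local by blast
  obtain M where M: "M \<ge> 0" "\<And>x y. (cmod (kernel a x y))\<^sup>2 \<le> M" using kernel_bounded by blast
  let ?d = "real (CARD('n) ^ n)"
  define K where "K = sqrt (?d * M * ?d)"
  have "norm2 (a * b) \<le> K * norm2 b" for b
  proof -
    obtain m where m: "is_local m (kernel b)" using locop_local by blast
    define N where "N = max n m"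
    have aN: "is_local N (kernel a)" and bN: "is_local N (kernel b)"
      using is_local_mono[OF n] is_local_mono[OF m] by (auto simp: N_def)
    have nN: "n \<le> N" by (simp add: N_def)
    have abN: "is_local N (kernel (a * b))" using aN bN by transfer (rule is_local_kmult)
    define S where "S = tail_class N (\<lambda>_. undefined :: 'n)"
    have fin: "finite S" by (simp add: S_def)
    have sub: "tail_class n x \<subseteq> S" if "x \<in> S" for x
      using that tail_class_mono[OF nN, of x] tail_class_eq[of x N] unfolding S_def by blast
    have entry: "(cmod (kernel (a * b) x y))\<^sup>2 \<le> ?d * M * (\<Sum>z\<in>tail_class n x. (cmod (kernel b z y))\<^sup>2)"
      for x y
    proof -
      have "kernel (a * b) x y = (\<Sum>z\<in>tail_class n x. kernel a x z * kernel b z y)"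
        using n by transfer (simp add: kmult_eq)
      then have "(cmod (kernel (a * b) x y))\<^sup>2
          \<le> (\<Sum>z\<in>tail_class n x. cmod (kernel a x z) * cmod (kernel b z y))\<^sup>2"
        by (metis (mono_tags, lifting) norm_ge_zero norm_mult norm_sum power_mono sum.cong)
      also have "\<dots> \<le> (\<Sum>z\<in>tail_class n x. (cmod (kernel a x z))\<^sup>2) * (\<Sum>z\<in>tail_class n x. (cmod (kernel b z y))\<^sup>2)"
        by (rule Cauchy_Schwarz_ineq_sum)
      also have "\<dots> \<le> (?d * M) * (\<Sum>z\<in>tail_class n x. (cmod (kernel b z y))\<^sup>2)"
      proof (intro mult_right_mono sum_nonneg)
        have "(\<Sum>z\<in>tail_class n x. (cmod (kernel a x z))\<^sup>2) \<le> real (card (tail_class n x)) * M"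
          using M(2) by (intro sum_bounded_above) auto
        then show "(\<Sum>z\<in>tail_class n x. (cmod (kernel a x z))\<^sup>2) \<le> ?d * M"
          by (simp add: card_tail_class)
      qed auto
      finally show ?thesis .
    qed
    have count: "(\<Sum>x\<in>S. \<Sum>z\<in>tail_class n x. f z) = ?d * (\<Sum>z\<in>S. f z)" for f :: "(nat \<Rightarrow> 'n) \<Rightarrow> real"
    proof -
      have "(\<Sum>x\<in>S. \<Sum>z\<in>tail_class n x. f z) = (\<Sum>x\<in>S. \<Sum>z | z \<in> S \<and> z \<in> tail_class n x. f z)"
        using sub by (intro sum.cong) auto
      also have "\<dots> = (\<Sum>z\<in>S. \<Sum>x | x \<in> S \<and> z \<in> tail_class n x. f z)"
        by (rule sum.swap_restrict) (use fin in auto)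
      also have "\<dots> = (\<Sum>z\<in>S. \<Sum>x\<in>tail_class n z. f z)"
        using sub by (intro sum.cong) (auto simp: tail_class_sym)
      also have "\<dots> = ?d * (\<Sum>z\<in>S. f z)" by (simp add: card_tail_class sum_distrib_left)
      finally show ?thesis .
    qed
    have "(\<Sum>y\<in>S. \<Sum>x\<in>S. (cmod (kernel (a * b) x y))\<^sup>2)
        \<le> (\<Sum>y\<in>S. \<Sum>x\<in>S. ?d * M * (\<Sum>z\<in>tail_class n x. (cmod (kernel b z y))\<^sup>2))"
      by (intro sum_mono entry)
    also have "\<dots> = (?d * M * ?d) * (\<Sum>y\<in>S. \<Sum>z\<in>S. (cmod (kernel b z y))\<^sup>2)"
      by (simp only: count sum_distrib_left[symmetric] mult.assoc)
    finally show ?thesis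
      unfolding norm2_eq[OF abN, of "\<lambda>_. undefined"] norm2_eq[OF bN, of "\<lambda>_. undefined"] K_def
        S_def[symmetric] real_sqrt_mult[symmetric]
      by (intro real_sqrt_le_mono) (simp add: divide_right_mono)
  qed
  moreover have "K \<ge> 0" using M(1) by (simp add: K_def)
  ultimately show ?thesis by blast
qed

text \<open>The GNS Hilbert space \<open>H\<close> of the state, that is, the completion of the pre-Hilbert space of local
  operators. By the Riesz representation theorem a vector \<open>\<xi> \<in> H\<close> is the same thing as the bounded
  antilinear functional \<open>a \<mapsto> \<langle>a\<Omega>, \<xi>\<rangle>\<close> on that dense subspace, inner products being linear in the second
  argument. So \<open>coef \<xi> a\<close> below is \<open>\<langle>a\<Omega>, \<xi>\<rangle>\<close>.\<close>

typedef 'n gns = "{f :: 'n::finite locop \<Rightarrow> complex.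
    (\<forall>a b. f (a + b) = f a + f b) \<and> (\<forall>c a. f (c *\<^sub>C a) = cnj c * f a) \<and>
    (\<exists>K\<ge>0. \<forall>a. cmod (f a) \<le> K * norm2 a)}"
  morphisms coef Abs_gns
  by (rule exI[of _ "\<lambda>_. 0"]) (auto intro: exI[of _ 0])

setup_lifting type_definition_gns

instantiation gns :: (finite) complex_vector
begin
lift_definition zero_gns :: "'a gns" is "\<lambda>_. 0"
  by (auto intro: exI[of _ 0])
lift_definition plus_gns :: "'a gns \<Rightarrow> 'a gns \<Rightarrow> 'a gns" is "\<lambda>f g a. f a + g a"
proof (intro conjI allI; (elim conjE)?)
  fix f g :: "'a locop \<Rightarrow> complex"
  assume "\<exists>K\<ge>0. \<forall>a. cmod (f a) \<le> K * norm2 a" "\<exists>K\<ge>0. \<forall>a. cmod (g a) \<le> K * norm2 a"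
  then obtain K L where KL: "K \<ge> 0" "L \<ge> 0" "\<And>a. cmod (f a) \<le> K * norm2 a" "\<And>a. cmod (g a) \<le> L * norm2 a"
    by blast
  have "cmod (f a + g a) \<le> (K + L) * norm2 a" for a
    using norm_triangle_ineq[of "f a" "g a"] KL(3,4)[of a] by (simp add: distrib_right)
  then show "\<exists>K\<ge>0. \<forall>a. cmod (f a + g a) \<le> K * norm2 a" using KL(1,2) by (intro exI[of _ "K + L"]) simp
qed (simp_all add: algebra_simps)
lift_definition scaleC_gns :: "complex \<Rightarrow> 'a gns \<Rightarrow> 'a gns" is "\<lambda>c f a. c * f a"
proof (intro conjI allI; (elim conjE)?)
  fix c and f :: "'a locop \<Rightarrow> complex"
  assume "\<exists>K\<ge>0. \<forall>a. cmod (f a) \<le> K * norm2 a"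
  then obtain K where K: "K \<ge> 0" "\<And>a. cmod (f a) \<le> K * norm2 a" by blast
  have "cmod (c * f a) \<le> (cmod c * K) * norm2 a" for a
    using mult_left_mono[OF K(2), of "cmod c" a] by (simp add: norm_mult mult.assoc)
  then show "\<exists>K\<ge>0. \<forall>a. cmod (c * f a) \<le> K * norm2 a" using K(1) by (intro exI[of _ "cmod c * K"]) simp
qed (simp_all add: algebra_simps)
definition uminus_gns :: "'a gns \<Rightarrow> 'a gns" where "uminus_gns f = (- 1) *\<^sub>C f"
definition minus_gns :: "'a gns \<Rightarrow> 'a gns \<Rightarrow> 'a gns" where "minus_gns f g = f + - g"
instance
proof
  fix f g k :: "'a gns" and s t :: complex
  show "f + g + k = f + (g + k)" "f + g = g + f" "0 + f = f" 
    "s *\<^sub>C (f + g) = s *\<^sub>C f + s *\<^sub>C g" "(s + t) *\<^sub>C f = s *\<^sub>C f + t *\<^sub>C f"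
    "s *\<^sub>C t *\<^sub>C f = (s * t) *\<^sub>C f" "1 *\<^sub>C f = f"
    by (transfer; simp add: algebra_simps fun_eq_iff)+
  show "- f + f = 0" unfolding uminus_gns_def by transfer (simp add: fun_eq_iff)
  show "f - g = f + - g" by (simp add: minus_gns_def)
qed
end

instantiation gns :: (finite) real_normed_vector
begin
definition norm_gns :: "'a gns \<Rightarrow> real" where
  "norm_gns f = Inf {K. 0 \<le> K \<and> (\<forall>a. cmod (coef f a) \<le> K * norm2 a)}"
definition scaleR_gns :: "real \<Rightarrow> 'a gns \<Rightarrow> 'a gns" where "scaleR_gns r f = of_real r *\<^sub>C f"
definition sgn_gns :: "'a gns \<Rightarrow> 'a gns" where "sgn_gns f = inverse (norm f) *\<^sub>R f"
definition dist_gns :: "'a gns \<Rightarrow> 'a gns \<Rightarrow> real" where "dist_gns f g = norm (f - g)"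
definition uniformity_gns :: "('a gns \<times> 'a gns) filter" where
  "uniformity_gns = (INF e\<in>{0 <..}. principal {(f, g). dist f g < e})"
definition open_gns :: "'a gns set \<Rightarrow> bool" where
  "open_gns U \<longleftrightarrow> (\<forall>f\<in>U. eventually (\<lambda>(f', g). f' = f \<longrightarrow> g \<in> U) uniformity)"
instance
proof
  have norm_le: "norm f \<le> K" if "0 \<le> K" "\<And>a. cmod (coef f a) \<le> K * norm2 a" for f :: "'a gns" and K
    unfolding norm_gns_def using that by (intro cInf_lower) (auto simp: bdd_below_def)
  have ex: "\<exists>K. K \<in> {K. 0 \<le> K \<and> (\<forall>a. cmod (coef f a) \<le> K * norm2 a)}" for f :: "'a gns"
    using coef[of f] by blast
  have nonneg: "0 \<le> norm f" for f :: "'a gns"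
    unfolding norm_gns_def using ex[of f] by (intro cInf_greatest) blast+
  have bound: "cmod (coef f a) \<le> norm f * norm2 a" for f :: "'a gns" and a
  proof (cases "norm2 a = 0")
    case True
    obtain K where "cmod (coef f a) \<le> K * norm2 a" using ex[of f] by blast
    then show ?thesis using True by simp
  next
    case False
    then have pos: "norm2 a > 0" using norm2_nonneg[of a] by simp
    have "cmod (coef f a) / norm2 a \<le> norm f"
      unfolding norm_gns_def using ex[of f] pos
      by (intro cInf_greatest) (blast, simp add: pos_divide_le_eq)
    then show ?thesis using pos by (simp add: pos_divide_le_eq)
  qed
  fix f g :: "'a gns" and r s :: real
  show "r *\<^sub>R (f + g) = r *\<^sub>R f + r *\<^sub>R g" "(r + s) *\<^sub>R f = r *\<^sub>R f + s *\<^sub>R f"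
    "r *\<^sub>R s *\<^sub>R f = (r * s) *\<^sub>R f" "1 *\<^sub>R f = f"
    by (simp_all add: scaleR_gns_def scaleC_add_right scaleC_add_left scaleC_scaleC scaleC_one)
  show "dist f g = norm (f - g)" by (simp add: dist_gns_def)
  show "sgn f = inverse (norm f) *\<^sub>R f" by (simp add: sgn_gns_def)
  show "uniformity = (INF e\<in>{0 <..}. principal {(f, g :: 'a gns). dist f g < e})"
    by (simp add: uniformity_gns_def)
  show "open U \<longleftrightarrow> (\<forall>f\<in>U. eventually (\<lambda>(f', g). f' = f \<longrightarrow> g \<in> U) uniformity)" for U :: "'a gns set"
    by (simp add: open_gns_def)
  have zero: "norm (0 :: 'a gns) = 0"
    by (intro antisym norm_le nonneg) (auto simp: zero_gns.rep_eq norm2_nonneg)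
  show "norm f = 0 \<longleftrightarrow> f = 0"
  proof
    assume "norm f = 0"
    then have "coef f a = 0" for a using bound[of f a] by simp
    then show "f = 0" by (simp add: zero_gns.rep_eq fun_eq_iff flip: coef_inject)
  qed (simp add: zero)
  show "norm (f + g) \<le> norm f + norm g"
  proof (rule norm_le)
    show "cmod (coef (f + g) a) \<le> (norm f + norm g) * norm2 a" for a
      using bound[of f a] bound[of g a] norm_triangle_ineq[of "coef f a" "coef g a"]
      by (simp add: plus_gns.rep_eq distrib_right)
  qed (simp add: nonneg)
  have scale: "norm (t *\<^sub>R k) \<le> \<bar>t\<bar> * norm k" for t and k :: "'a gns"
  proof (rule norm_le)
    show "cmod (coef (t *\<^sub>R k) a) \<le> (\<bar>t\<bar> * norm k) * norm2 a" for a
      using mult_left_mono[OF bound[of k a], of "\<bar>t\<bar>"]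
      by (simp add: scaleR_gns_def scaleC_gns.rep_eq norm_mult mult.assoc)
  qed (simp add: nonneg)
  show "norm (r *\<^sub>R f) = \<bar>r\<bar> * norm f"
  proof (cases "r = 0")
    case True
    then show ?thesis using scale[of 0 f] nonneg[of "0 *\<^sub>R f"] by simp
  next
    case False
    have "f = (1 / r) *\<^sub>R (r *\<^sub>R f)"
      using False by (simp add: scaleR_gns_def scaleC_scaleC scaleC_one)
    then have "norm f \<le> \<bar>1 / r\<bar> * norm (r *\<^sub>R f)" using scale[of "1 / r" "r *\<^sub>R f"] by simp
    then have "\<bar>r\<bar> * norm f \<le> norm (r *\<^sub>R f)" using False by (simp add: field_simps abs_divide)
    then show ?thesis using scale[of r f] by simp
  qed
qed
end

lemma adj_add: "adj (a + b) = adj a + adj b"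
  by transfer (simp add: fun_eq_iff)

lemma adj_scaleC: "adj (c *\<^sub>C a) = cnj c *\<^sub>C adj a"
  by transfer (simp add: fun_eq_iff)

lemma adj_adj [simp]: "adj (adj a) = a"
  by transfer simp

lemma tr_inf_add: "tr_inf (a + b) = tr_inf a + tr_inf (b :: 'n::finite locop)"
proof -
  obtain n where n: "is_local n (kernel a)" "is_local n (kernel b)"
    using locop_common[OF locop_local locop_local] by blast
  then have "is_local n (kernel (a + b))" by transfer (rule is_local_add)
  then show ?thesis using n
    by (simp add: tr_inf_eq[of n _ undefined] plus_locop.rep_eq sum.distrib add_divide_distrib)
qed

lemma tr_inf_scaleC: "tr_inf (c *\<^sub>C a) = c * tr_inf (a :: 'n::finite locop)"
proof -
  obtain n where n: "is_local n (kernel a)" using locop_local by blast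
  then have "is_local n (kernel (c *\<^sub>C a))" by transfer (rule is_local_scale)
  then show ?thesis using n
    by (simp add: tr_inf_eq[of n _ undefined] scaleC_locop.rep_eq sum_distrib_left)
qed

text \<open>The vacuum \<open>\<Omega>\<close>, and the left multiplication \<open>\<langle>b\<Omega>, a\<xi>\<rangle> = \<langle>a\<^sup>* b\<Omega>, \<xi>\<rangle>\<close>.\<close>

lift_definition vacuum :: "'n::finite gns" is "\<lambda>b. tr_inf (adj b)"
proof (intro conjI allI)
  show "\<exists>K\<ge>0. \<forall>a. cmod (tr_inf (adj a)) \<le> K * norm2 (a :: 'n locop)"
    by (intro exI[of _ 1]) (simp add: cmod_tr_inf_le)
qed (simp_all add: adj_add adj_scaleC tr_inf_add tr_inf_scaleC)

lift_definition gns_rep :: "'n::finite locop \<Rightarrow> 'n gns \<Rightarrow> 'n gns" is "\<lambda>a f b. f (adj a * b)"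
proof (intro conjI allI; (elim conjE)?)
  fix a :: "'n locop" and f :: "'n locop \<Rightarrow> complex"
  assume "\<exists>K\<ge>0. \<forall>a. cmod (f a) \<le> K * norm2 a"
  then obtain K where K: "K \<ge> 0" "\<And>a. cmod (f a) \<le> K * norm2 a" by blast
  obtain L where L: "L \<ge> 0" "\<And>b. norm2 (adj a * b) \<le> L * norm2 b" using norm2_mult_bound by blast
  have "cmod (f (adj a * b)) \<le> (K * L) * norm2 b" for b
    using order_trans[OF K(2) mult_left_mono[OF L(2) K(1)]] by (simp add: mult.assoc)
  then show "\<exists>K\<ge>0. \<forall>b. cmod (f (adj a * b)) \<le> K * norm2 b"
    using K(1) L(1) by (intro exI[of _ "K * L"]) simp
qed (simp_all add: distrib_left scaleC_mult_right)

lemma coef_gns_rep_vacuum: "coef (gns_rep a vacuum) b = tr_inf (adj (adj a * b))"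
  by transfer simp

lemma gns_rep_add: "gns_rep (a + b) f = gns_rep a f + gns_rep b f"
  by transfer (simp add: adj_add distrib_right)

lemma gns_rep_scaleC: "gns_rep (c *\<^sub>C a) f = c *\<^sub>C gns_rep a f"
  by transfer (simp add: adj_scaleC scaleC_mult_left)

definition bounded_clinear :: "('n::finite gns \<Rightarrow> 'n gns) \<Rightarrow> bool" where
  "bounded_clinear T \<longleftrightarrow> bounded_linear T \<and> (\<forall>c f. T (c *\<^sub>C f) = c *\<^sub>C T f)"

text \<open>\<open>T' = T\<^sup>*\<close>, tested on the dense subspace: \<open>\<langle>a\<Omega>, T' b\<Omega>\<rangle> = cnj \<langle>b\<Omega>, T a\<Omega>\<rangle>\<close>.\<close>

definition is_adjoint :: "('n::finite gns \<Rightarrow> 'n gns) \<Rightarrow> ('n gns \<Rightarrow> 'n gns) \<Rightarrow> bool" where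
  "is_adjoint T T' \<longleftrightarrow> (\<forall>a b. coef (T' (gns_rep b vacuum)) a = cnj (coef (T (gns_rep a vacuum)) b))"

definition commutant :: "('n::finite gns \<Rightarrow> 'n gns) set \<Rightarrow> ('n gns \<Rightarrow> 'n gns) set" where
  "commutant S = {T. bounded_clinear T \<and> (\<forall>X\<in>S. T \<circ> X = X \<circ> T)}"

definition von_neumann_algebra :: "('n::finite gns \<Rightarrow> 'n gns) set \<Rightarrow> bool" where
  "von_neumann_algebra M \<longleftrightarrow> commutant (commutant M) = M
     \<and> (\<forall>T\<in>M. \<forall>T'. bounded_clinear T' \<and> is_adjoint T T' \<longrightarrow> T' \<in> M)"

definition W_alg :: "('n::finite gns \<Rightarrow> 'n gns) set" where
  "W_alg = von_neumann_algebra hull range gns_rep"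

definition omega :: "('n::finite gns \<Rightarrow> 'n gns) \<Rightarrow> complex" where
  "omega T = coef (T vacuum) 1"

lemma omega_gns_rep: "omega (gns_rep a) = tr_inf a"
  by (simp add: omega_def coef_gns_rep_vacuum)


section \<open>The quantum Markov process\<close>

text \<open>\<open>\<rho>\<^sup>\<otimes>\<^sup>n\<close> for \<open>n \<ge> 1\<close>, as a local operator on the positions \<open>0, \<dots>, n - 1\<close>; the element \<open>a \<otimes> m\<close> of
  \<open>M\<^sub>d(\<complex>)\<^sup>\<otimes>\<^sup>n \<otimes> M\<^sub>d(\<complex>)\<close> is the local operator \<open>a * site n m\<close>.\<close>

fun rho_tensor :: "nat \<Rightarrow> 'n::{finite,linorder} ugl \<Rightarrow> 'n locop" where
  "rho_tensor (Suc 0) x = site 0 (std_rep x)"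
| "rho_tensor (Suc (Suc n)) x =
     tensor_map (\<lambda>u v. rho_tensor (Suc n) u * site (Suc n) (std_rep v)) (coproduct x)"

lemma clinear_site: "clinear (site k)"
  unfolding clinear_def
proof (intro conjI allI)
  show "site k (x + y) = site k x + site k y" for x y :: "complex ^ 'n ^ 'n"
    by transfer (auto simp: fun_eq_iff)
  show "site k (c *\<^sub>C x) = c *\<^sub>C site k x" for c and x :: "complex ^ 'n ^ 'n"
    by transfer (auto simp: fun_eq_iff scaleC_vec_def scaleC_complex_def)
qed

lemma clinear_compose: "clinear f \<Longrightarrow> clinear g \<Longrightarrow> clinear (\<lambda>x. g (f x))"
  by (simp add: clinear_def)

lemma clinear_rho_tensor:
  "clinear (rho_tensor (Suc n) :: 'n::{finite,linorder} ugl \<Rightarrow> _)"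
  "cbilinear (\<lambda>(u :: 'n ugl) v. rho_tensor (Suc n) u * site (Suc n) (std_rep (v :: 'n ugl)))"
proof -
  have rep: "clinear (std_rep :: 'n ugl \<Rightarrow> _)"
    using is_std_rep_std_rep[where 'n = 'n] unfolding is_std_rep_def by blast
  have site: "clinear (\<lambda>v :: 'n ugl. site k (std_rep v))" for k
    by (rule clinear_compose[OF rep clinear_site])
  have cop: "clinear (coproduct :: 'n ugl \<Rightarrow> _)"
    using is_coproduct_coproduct[where 'n = 'n] unfolding is_coproduct_def calg_hom_def by blast
  have bil: "cbilinear (\<lambda>(u :: 'n ugl) v. rho_tensor (Suc n) u * site (Suc n) (std_rep (v :: 'n ugl)))"
    if "clinear (rho_tensor (Suc n) :: 'n ugl \<Rightarrow> _)" for n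
    using that site[of "Suc n"]
    by (simp add: cbilinear_def clinear_def distrib_left distrib_right scaleC_mult_left scaleC_mult_right)
  have lin: "clinear (rho_tensor (Suc n) :: 'n ugl \<Rightarrow> _)" for n
  proof (induction n)
    case 0
    show ?case using site[of 0] by (simp add: clinear_def)
  next
    case (Suc n)
    show ?case
      using clinear_compose[OF cop tensor_map(1)[OF bil[OF Suc]]] by (simp add: clinear_def)
  qed
  show "clinear (rho_tensor (Suc n) :: 'n ugl \<Rightarrow> _)" by (rule lin)
  show "cbilinear (\<lambda>(u :: 'n ugl) v. rho_tensor (Suc n) u * site (Suc n) (std_rep (v :: 'n ugl)))"
    by (rule bil[OF lin])
qed

definition j_mor :: "nat \<Rightarrow> 'n::{finite,linorder} ugl \<Rightarrow> 'n gns \<Rightarrow> 'n gns" where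
  "j_mor n x = gns_rep (rho_tensor n x)"

lemma j_mor_in_W_alg: "j_mor n x \<in> W_alg"
  unfolding j_mor_def W_alg_def by (intro hull_inc rangeI)

definition quantum_markov_on :: "'n::{finite,linorder} ugl set \<Rightarrow> bool" where
  "quantum_markov_on B \<longleftrightarrow> P_op ` B \<subseteq> B \<and>
     (\<forall>n\<ge>2. \<forall>x\<in>B. \<forall>\<xi>\<in>von_neumann_algebra hull (\<Union>k\<in>{1..n - 1}. j_mor k ` B).
        omega (j_mor n x \<circ> \<xi>) = omega (j_mor (n - 1) (P_op x) \<circ> \<xi>))"

text \<open>Powers and \<open>Tr\<close> of a square matrix whose rows and columns are indexed by the finite set \<open>J\<close>.
  The matrix \<open>E\<close> is \<open>egl\<close> with \<open>J = UNIV\<close>, and its block \<open>E\<^sub>1\<^sub>1\<close> is \<open>egl\<close> with \<open>J = {..<last_index}\<close>.\<close>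

fun mat_pow_on :: "'i set \<Rightarrow> ('i \<Rightarrow> 'i \<Rightarrow> 'a::semiring_1) \<Rightarrow> nat \<Rightarrow> 'i \<Rightarrow> 'i \<Rightarrow> 'a" where
  "mat_pow_on J m 0 i k = (if i = k then 1 else 0)"
| "mat_pow_on J m (Suc r) i k = (\<Sum>l\<in>J. m i l * mat_pow_on J m r l k)"

definition trace_on :: "'i set \<Rightarrow> ('i \<Rightarrow> 'i \<Rightarrow> 'a::semiring_1) \<Rightarrow> 'a" where
  "trace_on J m = (\<Sum>i\<in>J. m i i)"

end

theory Submission
  imports Defs "HOL-Combinatorics.Cycles"
begin

text \<open>For a permutation \<open>\<sigma>\<close> of a set of letters, the patterns
  \<open>\<Sum>\<^sub>f \<Prod>\<^sub>k e\<^bsub>f k, f (\<sigma> k)\<^esub>\<close>, where each index \<open>f k\<close> runs over all indices, over the first \<open>d - 1\<close>,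
  or over \<open>{d}\<close>, span an algebra containing the generators. It is stable under \<open>P\<close>: by
  \<open>(id \<otimes> \<rho>) \<Delta> e\<^sub>i\<^sub>j = e\<^sub>i\<^sub>j \<otimes> 1 + 1 \<otimes> \<epsilon>\<^sub>i\<^sub>j - \<delta>\<^sub>i\<^sub>j/d\<close> with matrix units \<open>\<epsilon>\<^sub>i\<^sub>j\<close>, the operator \<open>P\<close> only
  removes letters and identifies indices.

  Conversely, every pattern with \<open>m\<close> letters lies in the algebra \<open>B\<close> of the theorem, by induction on
  \<open>m\<close>. Commuting letters costs patterns with fewer letters, so a pattern whose \<open>\<sigma>\<close> is not an
  \<open>m\<close>-cycle is a product of shorter ones. If two indices equal \<open>d\<close>, composing the
  cycle \<open>\<sigma>\<close> with their transposition does not change the pattern and breaks the cycle. What is left are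
  the powers \<open>Tr (E\<^sub>1\<^sub>1\<^sup>m)\<close> and \<open>Tr (E\<^sup>m)\<close>, whose difference is, up to elements of \<open>B\<close>, \<open>m\<close> times the pattern with exactly
  one index \<open>d\<close>. For large \<open>m\<close> they are not generators, but an index set with fewer than \<open>m\<close> elements makes the
  signed sum of the patterns over all \<open>\<sigma>\<close> vanish, which takes the place of the Cayley-Hamilton theorem.

  The Markov property holds for every \<open>\<xi>\<close> that commutes with the position \<open>n\<close> and with the right
  multiplications: then \<open>a \<mapsto> \<omega>(a \<xi>)\<close> is tracial in the matrix at that position.\<close>

section \<open>Words in the generators\<close>

definition csubspace :: "'v::complex_vector set \<Rightarrow> bool" where
  "csubspace V \<longleftrightarrow> 0 \<in> V \<and> (\<forall>x\<in>V. \<forall>y\<in>V. x + y \<in> V) \<and> (\<forall>c. \<forall>x\<in>V. c *\<^sub>C x \<in> V)"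

lemma csubspace_add: "csubspace V \<Longrightarrow> x \<in> V \<Longrightarrow> y \<in> V \<Longrightarrow> x + y \<in> V"
  and csubspace_scale: "csubspace V \<Longrightarrow> x \<in> V \<Longrightarrow> c *\<^sub>C x \<in> V"
  and csubspace_zero: "csubspace V \<Longrightarrow> 0 \<in> V"
  by (simp_all add: csubspace_def)

lemma uminus_eq_scaleC: "- x = (- 1) *\<^sub>C (x :: 'v::complex_vector)"
  by (simp add: scaleC_minus_left scaleC_one)

lemma csubspace_diff: "csubspace V \<Longrightarrow> x \<in> V \<Longrightarrow> y \<in> V \<Longrightarrow> x - y \<in> V"
  by (metis csubspace_add csubspace_scale diff_conv_add_uminus uminus_eq_scaleC)

lemma csubspace_sum: "csubspace V \<Longrightarrow> (\<And>i. i \<in> A \<Longrightarrow> f i \<in> V) \<Longrightarrow> sum f A \<in> V"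
  by (induction A rule: infinite_finite_induct) (auto simp: csubspace_def)

lemma csubspace_diff_cancel:
  assumes "csubspace V" "x - y \<in> V" "y \<in> V" shows "x \<in> V"
  using csubspace_add[OF assms] by simp

lemma csubspace_scale_cancel:
  assumes "csubspace V" "c *\<^sub>C x \<in> V" "c \<noteq> 0" shows "x \<in> V"
  using csubspace_scale[OF assms(1,2), of "1 / c"] assms(3) by (simp add: scaleC_scaleC scaleC_one)

lemma sum_const_scaleC: "(\<Sum>i\<in>A. x) = of_nat (card A) *\<^sub>C (x :: 'v::complex_vector)"
  by (induction A rule: infinite_finite_induct) (simp_all add: scaleC_add_left scaleC_one)

lemma sum_PiE_insert:
  assumes "x \<notin> A"
  shows "(\<Sum>f\<in>PiE (insert x A) S. G f) = (\<Sum>i\<in>S x. \<Sum>f\<in>PiE A S. G (f(x := i)))"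
  unfolding PiE_insert_eq
  by (subst sum.reindex[OF inj_combinator[OF assms]])
     (simp add: sum.cartesian_product case_prod_unfold comp_def)

text \<open>A letter \<open>k\<close> has row index \<open>f k\<close> and column index \<open>f (\<sigma> k)\<close>. The letters are labels in an arbitrary
  type, so that they can be removed or reordered without renumbering.\<close>

definition egl_word :: "('v \<Rightarrow> 'n) \<Rightarrow> ('v \<Rightarrow> 'v) \<Rightarrow> 'v list \<Rightarrow> 'n ugl" where
  "egl_word f \<sigma> L = prod_list (map (\<lambda>k. egl (f k) (f (\<sigma> k))) L)"

definition pat :: "'v list \<Rightarrow> ('v \<Rightarrow> 'v) \<Rightarrow> ('v \<Rightarrow> 'n set) \<Rightarrow> 'n ugl" where
  "pat L \<sigma> S = (\<Sum>f\<in>PiE (set L) S. egl_word f \<sigma> L)"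

text \<open>A label in \<open>M\<close> is a letter that a commutator has contracted: the letter is
  gone, its Kronecker delta stays as a constraint, and its index is still summed over.\<close>

definition cpat :: "'v list \<Rightarrow> 'v set \<Rightarrow> ('v \<Rightarrow> 'v) \<Rightarrow> ('v \<Rightarrow> 'n set) \<Rightarrow> 'n ugl" where
  "cpat L M \<sigma> S = (\<Sum>f\<in>PiE (set L \<union> M) S. if \<forall>v\<in>M. f (\<sigma> v) = f v then egl_word f \<sigma> L else 0)"

lemma egl_word_Nil [simp]: "egl_word f \<sigma> [] = 1"
  and egl_word_Cons [simp]: "egl_word f \<sigma> (k # L) = egl (f k) (f (\<sigma> k)) * egl_word f \<sigma> L"
  and egl_word_append: "egl_word f \<sigma> (L @ L') = egl_word f \<sigma> L * egl_word f \<sigma> L'"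
  by (simp_all add: egl_word_def)

lemma egl_word_cong:
  "(\<And>k. k \<in> set L \<Longrightarrow> f k = f' k \<and> f (\<sigma> k) = f' (\<sigma>' k)) \<Longrightarrow> egl_word f \<sigma> L = egl_word f' \<sigma>' L"
  by (induction L) auto

lemma cpat_empty: "cpat L {} \<sigma> S = pat L \<sigma> S"
  by (simp add: cpat_def pat_def)

text \<open>A constraint \<open>f (\<sigma> v) = f v\<close> is eliminated by composing \<open>\<sigma>\<close> with the transposition of \<open>v\<close> and
  \<open>\<sigma> v\<close> and intersecting the index sets of both.\<close>

lemma cpat_mem:
  assumes V: "csubspace V" and F: "\<And>A B. A \<in> F \<Longrightarrow> B \<in> F \<Longrightarrow> A \<inter> B \<in> F"
    and pat: "\<And>\<sigma> S. \<sigma> permutes set L \<Longrightarrow> (\<And>k. S k \<in> F) \<Longrightarrow> pat L \<sigma> (S :: 'v \<Rightarrow> 'n::finite set) \<in> V"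
  shows "finite M \<Longrightarrow> set L \<inter> M = {} \<Longrightarrow> \<sigma> permutes (set L \<union> M) \<Longrightarrow> (\<And>k. S k \<in> F) \<Longrightarrow> cpat L M \<sigma> S \<in> V"
proof (induction M arbitrary: \<sigma> S rule: finite_induct)
  case empty
  then show ?case by (simp add: cpat_empty pat)
next
  case (insert v M)
  define U where "U = set L \<union> M"
  have v: "v \<notin> U" and U: "set L \<union> insert v M = insert v U" using insert by (auto simp: U_def)
  define \<tau> where "\<tau> = Transposition.transpose v (\<sigma> v) \<circ> \<sigma>"
  have perm: "\<tau> permutes U"
    using insert.prems(2) unfolding U \<tau>_def by (rule permutes_insert_lemma)
  have tU: "\<tau> k \<in> U" if "k \<in> U" for k using perm that by (simp add: permutes_in_image)
  have IH: "cpat L M \<tau> T \<in> V" if "\<And>k. T k \<in> F" for T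
    using insert perm that by (auto simp: U_def)
  \<comment> \<open>The constraint gives \<open>v\<close> and \<open>\<sigma> v\<close> the same
    index, so exchanging them as values of \<open>\<sigma>\<close> is invisible to
    \<open>f\<close>.\<close>
  have same: "f (\<tau> k) = f (\<sigma> k)" if "f (\<sigma> v) = f v" for f :: "'v \<Rightarrow> 'n" and k
    using that by (auto simp: \<tau>_def Transposition.transpose_def)
  define g where "g f = (if \<forall>u\<in>M. f (\<tau> u) = f u then egl_word f \<tau> L else 0)" for f :: "'v \<Rightarrow> 'n"
  have g_upd: "g (f(v := i)) = g f" for f i
  proof -
    have "(f(v := i)) k = f k" if "k \<in> U" for k using that v by auto
    then show ?thesis using tU unfolding g_def U_def
      by (intro if_cong ball_cong egl_word_cong refl) (metis Un_iff)+
  qed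
  have "cpat L (insert v M) \<sigma> S = (\<Sum>f\<in>PiE (insert v U) S. if f (\<sigma> v) = f v then g f else 0)"
    unfolding cpat_def U g_def
    by (rule sum.cong[OF refl]) (simp add: same egl_word_def cong: map_cong)
  also have "\<dots> = (\<Sum>i\<in>S v. \<Sum>f\<in>PiE U S. if (f(v := i)) (\<sigma> v) = i then g f else 0)"
    by (simp add: sum_PiE_insert[OF v] g_upd cong: if_cong)
  finally have eq: "cpat L (insert v M) \<sigma> S
    = (\<Sum>i\<in>S v. \<Sum>f\<in>PiE U S. if (f(v := i)) (\<sigma> v) = i then g f else 0)" .
  show ?case
  proof (cases "\<sigma> v = v")
    case True
    then have "cpat L (insert v M) \<sigma> S = of_nat (card (S v)) *\<^sub>C cpat L M \<tau> S"
      unfolding eq by (simp add: sum_const_scaleC cpat_def g_def U_def del: sum_constant)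
    then show ?thesis using IH[of S] insert.prems(3) by (simp add: csubspace_scale[OF V])
  next
    case False
    let ?x = "\<sigma> v"
    have x: "?x \<in> U" using False insert.prems(2) unfolding U by (metis insertE insertI1 permutes_in_image)
    define T where "T = S(?x := S ?x \<inter> S v)"
    have T: "PiE U T = {f \<in> PiE U S. f ?x \<in> S v}"
      using x by (auto simp: T_def PiE_iff extensional_def split: if_splits)
    have fin: "finite (PiE U S)" by (rule finite_PiE) (auto simp: U_def insert)
    have "cpat L (insert v M) \<sigma> S = (\<Sum>f\<in>PiE U S. \<Sum>i\<in>S v. if f ?x = i then g f else 0)"
      unfolding eq by (subst sum.swap) (simp add: False)
    also have "\<dots> = (\<Sum>f\<in>PiE U S. if f ?x \<in> S v then g f else 0)"
      by simp
    also have "\<dots> = (\<Sum>f\<in>PiE U T. g f)"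
      unfolding T by (rule sum.inter_filter[symmetric]) (rule fin)
    also have "\<dots> = cpat L M \<tau> T" by (simp add: cpat_def g_def U_def)
    finally show ?thesis using IH[of T] insert.prems(3) F by (simp add: T_def)
  qed
qed

text \<open>The commutator of the letters \<open>k\<close> and \<open>l\<close> has two terms. In
  each, one letter survives with the column of the other, as composing with the transposition
  prescribes, and the other letter becomes a constraint.\<close>

lemma pat_swap:
  fixes \<sigma> :: "'v \<Rightarrow> 'v"
  assumes "distinct (A @ k # l # C)"
  shows "pat (A @ k # l # C) \<sigma> S - pat (A @ l # k # C) \<sigma> S =
    cpat (A @ k # C) {l} (\<sigma> \<circ> Transposition.transpose k l) S - cpat (A @ l # C) {k} (\<sigma> \<circ> Transposition.transpose k l) S"
proof -
  have sets: "set (A @ k # l # C) = set (A @ k # C) \<union> {l}" "set (A @ l # k # C) = set (A @ k # C) \<union> {l}"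
    "set (A @ l # C) \<union> {k} = set (A @ k # C) \<union> {l}" by auto
  have comm: "a * (x * (y * c)) - a * (y * (x * c)) = a * (x * y - y * x) * c" for a x y c :: "'b ugl"
    by (simp add: algebra_simps)
  have outer: "egl_word f (\<sigma> \<circ> Transposition.transpose k l) A = egl_word f \<sigma> A"
    "egl_word f (\<sigma> \<circ> Transposition.transpose k l) C = egl_word f \<sigma> C" for f :: "'v \<Rightarrow> 'b"
    using assms by (auto intro!: egl_word_cong simp: Transposition.transpose_def)
  show ?thesis
    unfolding pat_def cpat_def sets sum_subtractf[symmetric]
    by (rule sum.cong[OF refl])
       (auto simp: egl_word_append comm egl_commutator outer algebra_simps)
qed

section \<open>Transitive permutations\<close>

text \<open>Insertion sort: first the tail of \<open>L\<close> is brought into the order of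
  \<open>L'\<close>, then the head moves right by adjacent swaps to its place. The prefix
  \<open>A\<close> lets the induction work behind the head.\<close>

lemma adjacent_swaps_connect:
  assumes refl: "\<And>xs. R xs xs" and trans: "\<And>xs ys zs. R xs ys \<Longrightarrow> R ys zs \<Longrightarrow> R xs zs"
    and swap: "\<And>A k l C. mset (A @ k # l # C) = N \<Longrightarrow> R (A @ k # l # C) (A @ l # k # C)"
    and "mset L = N" "mset L' = N"
  shows "R L L'"
proof -
  have bubble: "R (A @ x # C @ D) (A @ C @ x # D)" if "mset (A @ x # C @ D) = N" for A C x D
    using that
  proof (induction C arbitrary: A)
    case (Cons y C)
    have "R (A @ x # y # C @ D) (A @ y # x # C @ D)" using Cons.prems by (intro swap) simp
    moreover have "R ((A @ [y]) @ x # C @ D) ((A @ [y]) @ C @ x # D)"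
      using Cons.prems by (intro Cons.IH) (simp add: add_mset_commute)
    ultimately show ?case using trans by simp
  qed (simp add: refl)
  have "R (A @ L) (A @ L')" if "mset (A @ L) = N" "mset (A @ L') = N" for A
    using that
  proof (induction L arbitrary: A L')
    case (Cons x L)
    have "mset (x # L) = mset L'" using Cons.prems by (metis add_left_cancel mset_append)
    then have "x \<in> set L'" by (metis list.set_intros(1) set_mset_mset)
    then obtain C D where L': "L' = C @ x # D" by (meson split_list)
    have "R ((A @ [x]) @ L) ((A @ [x]) @ C @ D)"
      using Cons.prems L' by (intro Cons.IH) auto
    moreover have "R (A @ x # C @ D) (A @ C @ x # D)"
      using Cons.prems L' by (intro bubble) simp
    ultimately show ?case using trans L' by simp
  qed (auto simp: refl)
  from this[of "[]"] show ?thesis using assms(4,5) by simp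
qed

text \<open>For a permutation of a finite nonempty set this means a single cycle. In terms of
  invariant subsets, its failure yields at once the subset along which a pattern factors.\<close>

definition transitive_on :: "('v \<Rightarrow> 'v) \<Rightarrow> 'v set \<Rightarrow> bool" where
  "transitive_on \<sigma> U \<longleftrightarrow> (\<forall>K\<subseteq>U. K \<noteq> {} \<longrightarrow> \<sigma> ` K \<subseteq> K \<longrightarrow> K = U)"

lemma transitive_onD: "transitive_on \<sigma> U \<Longrightarrow> K \<subseteq> U \<Longrightarrow> K \<noteq> {} \<Longrightarrow> \<sigma> ` K \<subseteq> K \<Longrightarrow> K = U"
  by (simp add: transitive_on_def)

text \<open>Composing with a transposition cuts one point \<open>v\<close> out of the cycle, which
  flips the sign and leaves a cycle on the rest.\<close>

lemma sign_transitive: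
  assumes "finite U" "U \<noteq> {}" "\<sigma> permutes U" "transitive_on \<sigma> U"
  shows "sign \<sigma> = (- 1) ^ (card U - 1)"
  using assms
proof (induction "card U" arbitrary: U \<sigma> rule: less_induct)
  case less
  obtain v where v: "v \<in> U" using less.prems by blast
  show ?case
  proof (cases "\<sigma> v = v")
    case True
    then have "U = {v}" using less.prems(4)[unfolded transitive_on_def, rule_format, of "{v}"] v by simp
    then have "\<sigma> = id" using less.prems(3) by (simp add: permutes_sing)
    then show ?thesis by (simp add: \<open>U = {v}\<close> sign_id)
  next
    case False
    define \<tau> where "\<tau> = Transposition.transpose v (\<sigma> v) \<circ> \<sigma>"
    have \<sigma>v: "\<sigma> v \<in> U - {v}" using False v less.prems(3) by (simp add: permutes_in_image)
    have "\<sigma> permutes insert v (U - {v})" using less.prems(3) v by (simp add: insert_absorb)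
    then have perm: "\<tau> permutes U - {v}" unfolding \<tau>_def by (rule permutes_insert_lemma)
    have inj: "\<sigma> x = \<sigma> y \<longleftrightarrow> x = y" for x y using less.prems(3) by (metis permutes_inj injD)
    have "transitive_on \<tau> (U - {v})"
      unfolding transitive_on_def
    proof (intro allI impI)
      fix K assume K: "K \<subseteq> U - {v}" "K \<noteq> {}" "\<tau> ` K \<subseteq> K"
      have \<tau>: "\<tau> k = (if \<sigma> k = v then \<sigma> v else \<sigma> k)" if "k \<in> K" for k
        using K(1) that inj[of k v] by (auto simp: \<tau>_def Transposition.transpose_def)
      have \<tau>K: "\<tau> k \<in> K" if "k \<in> K" for k using K(3) that by blast
      show "K = U - {v}"
      \<comment> \<open>If \<open>\<sigma>\<close> leads from \<open>K\<close> to \<open>v\<close>,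
        then \<open>K\<close> together with \<open>v\<close> is invariant under
        \<open>\<sigma>\<close>; otherwise \<open>K\<close> itself is.\<close>
      proof (cases "v \<in> \<sigma> ` K")
        case True
        then obtain k where "k \<in> K" "\<sigma> k = v" by auto
        then have "\<sigma> v \<in> K" using \<tau>K[of k] \<tau>[of k] by simp
        moreover have "\<sigma> k \<in> insert v K" if "k \<in> K" for k
          using \<tau>K[OF that] \<tau>[OF that] by (cases "\<sigma> k = v") simp_all
        ultimately have "\<sigma> ` insert v K \<subseteq> insert v K"
          by (simp add: image_subset_iff)
        then have "insert v K = U"
          using K(1) v by (intro transitive_onD[OF less.prems(4)]) auto
        then show ?thesis using K(1) by blast
      next
        case False
        then have "\<sigma> k \<in> K" if "k \<in> K" for k
          using \<tau>K[OF that] \<tau>[OF that] that by (cases "\<sigma> k = v") auto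
        then have "\<sigma> ` K \<subseteq> K" by (simp add: image_subset_iff)
        then have "K = U"
          using K(1,2) by (intro transitive_onD[OF less.prems(4)]) auto
        then show ?thesis using K(1) by blast
      qed
    qed
    moreover have "card (U - {v}) < card U" using less.prems(1) v by (rule card_Diff1_less)
    ultimately have IH: "sign \<tau> = (- 1) ^ (card (U - {v}) - 1)"
      using less.hyps[of "U - {v}" \<tau>] less.prems(1) \<sigma>v perm by blast
    have pts: "permutation \<sigma>" using less.prems(1,3) by (metis permutation_permutes)
    have neg: "sign \<tau> = - sign \<sigma>"
      unfolding \<tau>_def using False by (subst sign_compose) (auto simp: pts permutation_swap_id sign_swap_id)
    have "card U \<ge> 2"
      using card_mono[OF less.prems(1), of "{v, \<sigma> v}"] \<sigma>v v by auto
    then obtain c where c: "card U = Suc (Suc c)"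
      by (metis One_nat_def Suc_1 Suc_le_D Suc_le_mono)
    then show ?thesis using IH v less.prems(1) neg by simp
  qed
qed

text \<open>The orbit of \<open>a\<close>, listed along \<open>\<sigma>\<close>, is invariant and
  therefore exhausts \<open>U\<close>. That \<open>\<sigma>\<close> rotates the list is the form in
  which a cycle is matched with a cyclic matrix product.\<close>

lemma transitive_rotation_list:
  assumes "finite U" "\<sigma> permutes U" "transitive_on \<sigma> U" "a \<in> U"
  obtains as where "distinct (a # as)" "set (a # as) = U" "map \<sigma> (a # as) = as @ [a]"
proof -
  have perm: "permutation \<sigma>" using assms(1,2) by (metis permutation_permutes)
  define n where "n = least_power \<sigma> a"
  have n: "(\<sigma> ^^ n) a = a" "n > 0" unfolding n_def using least_power_of_permutation[OF perm] by auto
  define as where "as = map (\<lambda>i. (\<sigma> ^^ Suc i) a) [0..<n - 1]"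
  have "[0..<Suc k] = 0 # map Suc [0..<k]" for k
    by (simp add: map_Suc_upt upt_conv_Cons del: upt_Suc)
  from this[of "n - 1"] have sup: "support \<sigma> a = a # as"
    unfolding n_def[symmetric] as_def using n(2) by (simp add: comp_def)
  have dist: "distinct (a # as)" using cycle_of_permutation[OF perm, of a] unfolding sup .
  have rot: "map \<sigma> (a # as) = as @ [a]"
  proof -
    have "map \<sigma> (a # as) = map (\<lambda>i. (\<sigma> ^^ Suc i) a) [0..<n]"
      unfolding sup[symmetric] n_def[symmetric] by simp
    also have "\<dots> = as @ [(\<sigma> ^^ n) a]" unfolding as_def using n(2) by (cases n) simp_all
    finally show ?thesis using n(1) by simp
  qed
  have inU: "(\<sigma> ^^ i) a \<in> U" for i
    by (induction i) (simp_all add: assms permutes_in_image[OF assms(2)])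
  have "set (a # as) \<subseteq> U" unfolding sup[symmetric] using inU by auto
  moreover have "\<sigma> ` set (a # as) \<subseteq> set (a # as)"
    unfolding set_map[symmetric] rot by auto
  ultimately have "set (a # as) = U" by (intro transitive_onD[OF assms(3)]) auto
  then show ?thesis using that dist rot by blast
qed

lemma rotation_transitive:
  assumes "map \<sigma> (a # as) = as @ [a]"
  shows "transitive_on \<sigma> (set (a # as))"
  unfolding transitive_on_def
proof (intro allI impI)
  fix K assume K: "K \<subseteq> set (a # as)" "K \<noteq> {}" "\<sigma> ` K \<subseteq> K"
  define L where "L = a # as"
  have step: "\<sigma> (L ! i) = (as @ [a]) ! i" if "i < length L" for i
    using assms that unfolding L_def by (metis nth_map)
  have up: "L ! (i + j) \<in> K" if "L ! i \<in> K" "i + j < length L" for i j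
    using that(2)
  proof (induction j)
    case (Suc j)
    then have "L ! (i + Suc j) = \<sigma> (L ! (i + j))"
      using step[of "i + j"] by (simp add: L_def nth_append)
    then show ?case using Suc K(3) by auto
  qed (use that in simp)
  obtain i where i: "i < length L" "L ! i \<in> K" using K(1,2) unfolding L_def by (metis all_not_in_conv in_set_conv_nth subsetD)
  \<comment> \<open>From the known member, walk to the end of the list, wrap around to its head, and
    reach every position from there.\<close>
  have "L ! (length L - 1) \<in> K" using up[OF i(2), of "length L - 1 - i"] i(1) by simp
  then have "\<sigma> (L ! (length L - 1)) \<in> K" using K(3) by auto
  then have "L ! 0 \<in> K" using step[of "length L - 1"] by (simp add: L_def)
  then have "L ! j \<in> K" if "j < length L" for j using up[of 0 j] that by simp
  then have "set L \<subseteq> K" by (metis in_set_conv_nth subsetI)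
  then show "K = set (a # as)" using K(1) unfolding L_def by blast
qed

lemma restrict_permutes:
  assumes "finite A" "\<sigma> permutes U" "\<sigma> ` A \<subseteq> A"
  shows "(\<lambda>x. if x \<in> A then \<sigma> x else x) permutes A"
proof (rule bij_imp_permutes)
  have "inj_on \<sigma> A" using permutes_inj[OF assms(2)] by (rule inj_on_subset) simp
  then have "bij_betw \<sigma> A A" using assms by (simp add: bij_betw_def endo_inj_surj)
  then show "bij_betw (\<lambda>x. if x \<in> A then \<sigma> x else x) A A"
    by (rule bij_betw_cong[THEN iffD1, rotated]) simp
qed simp

section \<open>Patterns\<close>

lemma pat_cong:
  "(\<And>k. k \<in> set L \<Longrightarrow> \<sigma> k = \<sigma>' k) \<Longrightarrow> (\<And>k. k \<in> set L \<Longrightarrow> S k = S' k) \<Longrightarrow> pat L \<sigma> S = pat L \<sigma>' S'"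
  unfolding pat_def by (intro sum.cong PiE_cong egl_word_cong) auto

text \<open>No letter of one part refers to an index of the other, so an index function on the union
  is a pair of independent ones.\<close>

lemma pat_append:
  assumes disj: "set L \<inter> set L' = {}" and inv: "\<sigma> ` set L \<subseteq> set L" "\<sigma> ` set L' \<subseteq> set L'"
  shows "pat (L @ L') \<sigma> S = pat L \<sigma> S * pat L' \<sigma> S"
proof -
  have inv': "\<sigma> k \<in> set L" if "k \<in> set L" for k using inv that by blast
  moreover have "\<sigma> k \<in> set L' \<and> \<sigma> k \<notin> set L" if "k \<in> set L'" for k using inv disj that by blast
  ultimately have inv': "(k \<in> set L \<longrightarrow> \<sigma> k \<in> set L) \<and> (k \<in> set L' \<longrightarrow> \<sigma> k \<in> set L' \<and> \<sigma> k \<notin> set L)" for k by blast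
  let ?i = "\<lambda>(g, h) x. if x \<in> set L then g x else h x"
  have "pat L \<sigma> S * pat L' \<sigma> S
      = (\<Sum>(g, h)\<in>PiE (set L) S \<times> PiE (set L') S. egl_word g \<sigma> L * egl_word h \<sigma> L')"
    by (simp add: pat_def sum_product sum.cartesian_product)
  also have "\<dots> = (\<Sum>f\<in>PiE (set (L @ L')) S. egl_word f \<sigma> L * egl_word f \<sigma> L')"
  proof (rule sum.reindex_bij_witness[where j = ?i and i = "\<lambda>f. (restrict f (set L), restrict f (set L'))"])
    fix p assume p: "p \<in> PiE (set L) S \<times> PiE (set L') S"
    obtain g h where gh: "p = (g, h)" by (cases p)
    have g: "g k = undefined" if "k \<notin> set L" for k using p that PiE_arb[of g "set L" S k] by (simp add: gh)
    have h: "h k = undefined" if "k \<notin> set L'" for k using p that PiE_arb[of h "set L'" S k] by (simp add: gh)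
    show "(restrict (?i p) (set L), restrict (?i p) (set L')) = p"
      using disj g h by (auto simp: gh restrict_def fun_eq_iff)
    show "?i p \<in> PiE (set (L @ L')) S"
      using p by (auto simp: gh PiE_iff extensional_def)
    have "egl_word (?i p) \<sigma> L = egl_word g \<sigma> L" "egl_word (?i p) \<sigma> L' = egl_word h \<sigma> L'"
      using disj inv' by (auto simp: gh intro!: egl_word_cong)
    then show "egl_word (?i p) \<sigma> L * egl_word (?i p) \<sigma> L'
        = (case p of (g, h) \<Rightarrow> egl_word g \<sigma> L * egl_word h \<sigma> L')" by (simp add: gh)
  next
    fix f assume f: "f \<in> PiE (set (L @ L')) S"
    show "?i (restrict f (set L), restrict f (set L')) = f"
      using f by (auto simp: fun_eq_iff PiE_iff extensional_def)
    show "(restrict f (set L), restrict f (set L')) \<in> PiE (set L) S \<times> PiE (set L') S"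
      using f by (auto simp: PiE_iff)
  qed
  finally show ?thesis by (simp add: pat_def egl_word_append)
qed

lemma pat_rename:
  assumes "inj g" "\<And>k. k \<in> set L \<Longrightarrow> \<sigma>' (g k) = g (\<sigma> k)" "\<And>k. S' (g k) = S k" "\<sigma> ` set L \<subseteq> set L"
  shows "pat (map g L) \<sigma>' S' = pat L \<sigma> S"
proof -
  have [simp]: "g x = g y \<longleftrightarrow> x = y" for x y using assms(1) by (auto dest: injD)
  have inv: "inv g (g x) = x" for x using assms(1) by simp
  show ?thesis
    unfolding pat_def
  proof (rule sum.reindex_bij_witness[where i = "\<lambda>f. restrict (f \<circ> inv g) (set (map g L))" 
      and j = "\<lambda>f. restrict (f \<circ> g) (set L)"])
    fix f assume f: "f \<in> PiE (set (map g L)) S'"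
    show "restrict (restrict (f \<circ> g) (set L) \<circ> inv g) (set (map g L)) = f"
      using f inv by (fastforce simp: fun_eq_iff PiE_iff extensional_def restrict_def)
    show "restrict (f \<circ> g) (set L) \<in> PiE (set L) S"
      using f assms(3) by (auto simp: PiE_iff)
    have "egl_word (restrict (f \<circ> g) (set L)) \<sigma> L = prod_list (map (\<lambda>k. egl (f (g k)) (f (g (\<sigma> k)))) L)"
      unfolding egl_word_def using assms(4) by (intro arg_cong[of _ _ prod_list] map_cong) auto
    also have "\<dots> = egl_word f \<sigma>' (map g L)"
      unfolding egl_word_def map_map by (intro arg_cong[of _ _ prod_list] map_cong) (auto simp: assms(2))
    finally show "egl_word (restrict (f \<circ> g) (set L)) \<sigma> L = egl_word f \<sigma>' (map g L)" .
  next
    fix f assume f: "f \<in> PiE (set L) S"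
    show "restrict (restrict (f \<circ> inv g) (set (map g L)) \<circ> g) (set L) = f"
      using f inv by (auto simp: fun_eq_iff PiE_iff extensional_def)
    show "restrict (f \<circ> inv g) (set (map g L)) \<in> PiE (set (map g L)) S'"
      using f assms(3) inv by (auto simp: PiE_iff)
  qed
qed

text \<open>An entry of a product of copies of \<open>E\<close> whose intermediate indices are
  confined to the listed sets; \<open>cycle_sum\<close> is the corresponding trace. Separate sets at
  each place allow for traces in which one index alone equals \<open>last_index\<close>.\<close>

fun path_sum :: "'n set list \<Rightarrow> 'n \<Rightarrow> 'n \<Rightarrow> 'n ugl" where
  "path_sum [] i j = egl i j"
| "path_sum (T # Ts) i j = (\<Sum>l\<in>T. egl i l * path_sum Ts l j)"

definition cycle_sum :: "'n set \<Rightarrow> 'n set list \<Rightarrow> 'n ugl" where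
  "cycle_sum T Ts = (\<Sum>i\<in>T. path_sum Ts i i)"

text \<open>\<open>h\<close> carries the end indices and absorbs one more label at each step of the
  induction. Since \<open>a = b\<close> is allowed, the path may close up to a cycle.\<close>

lemma sum_path:
  assumes "distinct as" "a \<notin> set as" "b \<notin> set as" "map \<sigma> (a # as) = as @ [b]"
  shows "(\<Sum>g\<in>PiE (set as) S. egl_word (\<lambda>k. if k \<in> set as then g k else h k) \<sigma> (a # as))
    = path_sum (map S as) (h a) (h b)"
  using assms
proof (induction as arbitrary: a h)
  case Nil
  then show ?case by simp
next
  case (Cons c as)
  let ?F = "\<lambda>g l k. if k \<in> set as then g k else (h(c := l)) k"
  have fn: "(\<lambda>k. if k \<in> set (c # as) then (g(c := l)) k else h k) = ?F g l" for g l
    using Cons.prems(1) by (auto simp: fun_eq_iff)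
  have "(\<Sum>g\<in>PiE (set (c # as)) S. egl_word (\<lambda>k. if k \<in> set (c # as) then g k else h k) \<sigma> (a # c # as))
     = (\<Sum>l\<in>S c. \<Sum>g\<in>PiE (set as) S. egl_word (?F g l) \<sigma> (a # c # as))"
    unfolding list.set(2)[of c as] by (subst sum_PiE_insert) (use Cons.prems(1) fn in auto)
  also have "\<dots> = (\<Sum>l\<in>S c. egl (h a) l * (\<Sum>g\<in>PiE (set as) S. egl_word (?F g l) \<sigma> (c # as)))"
    unfolding sum_distrib_left using Cons.prems
    by (intro sum.cong refl) auto
  also have "\<dots> = (\<Sum>l\<in>S c. egl (h a) l * path_sum (map S as) l (h b))"
  proof (rule sum.cong[OF refl])
    fix l
    have "(\<Sum>g\<in>PiE (set as) S. egl_word (?F g l) \<sigma> (c # as)) = path_sum (map S as) ((h(c := l)) c) ((h(c := l)) b)"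
      using Cons.prems by (intro Cons.IH) auto
    then show "egl (h a) l * (\<Sum>g\<in>PiE (set as) S. egl_word (?F g l) \<sigma> (c # as))
       = egl (h a) l * path_sum (map S as) l (h b)" using Cons.prems by simp
  qed
  finally show ?case by simp
qed

lemma pat_rotation:
  assumes "distinct (a # as)" "map \<sigma> (a # as) = as @ [a]"
  shows "pat (a # as) \<sigma> S = cycle_sum (S a) (map S as)"
proof -
  have sub: "\<sigma> k \<in> set (a # as)" if "k \<in> set (a # as)" for k
    using that imageI[OF that, of \<sigma>] unfolding set_map[symmetric] assms(2) by auto
  have "pat (a # as) \<sigma> S = (\<Sum>i\<in>S a. \<Sum>g\<in>PiE (set as) S. egl_word (g(a := i)) \<sigma> (a # as))"
    unfolding pat_def list.set(2) by (rule sum_PiE_insert) (use assms in simp)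
  also have "\<dots> = (\<Sum>i\<in>S a. \<Sum>g\<in>PiE (set as) S. egl_word (\<lambda>k. if k \<in> set as then g k else i) \<sigma> (a # as))"
  proof (intro sum.cong refl egl_word_cong)
    fix i g k assume "k \<in> set (a # as)"
    then show "(g(a := i)) k = (if k \<in> set as then g k else i) \<and> 
        (g(a := i)) (\<sigma> k) = (if \<sigma> k \<in> set as then g (\<sigma> k) else i)"
      using assms(1) sub[of k] by auto
  qed
  also have "\<dots> = (\<Sum>i\<in>S a. path_sum (map S as) i i)"
    using assms by (intro sum.cong refl sum_path[where h = "\<lambda>_. _"]) auto
  finally show ?thesis by (simp add: cycle_sum_def)
qed

text \<open>With \<open>r\<close> intermediate indices there are \<open>r + 1\<close> factors. The
  membership \<open>k \<in> J\<close> lets the identity matrix at the end of the recursion select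
  the column \<open>k\<close>.\<close>

lemma path_sum_replicate:
  assumes "k \<in> J" "finite J"
  shows "path_sum (replicate r J) i k = mat_pow_on J egl (Suc r) i k"
proof (induction r arbitrary: i)
  case 0
  then show ?case using assms by (simp add: if_distrib cong: if_cong)
qed simp

lemma trace_on_mat_pow:
  "finite J \<Longrightarrow> trace_on J (mat_pow_on J egl (Suc r)) = cycle_sum J (replicate r J)"
  unfolding trace_on_def cycle_sum_def by (intro sum.cong refl) (simp only: path_sum_replicate)

lemma eq_minus_self_imp_zero:
  fixes x :: "'v::complex_vector" assumes "x = - x" shows "x = 0"
proof -
  have "x + x = 0" using assms by (metis add.right_inverse)
  then have "(1 / 2) *\<^sub>C (x + x) = 0" by simp
  then have "(1 / 2 + 1 / 2) *\<^sub>C x = 0" by (simp only: scaleC_add_left scaleC_add_right)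
  then show ?thesis by (simp add: scaleC_one)
qed

text \<open>By the pigeonhole principle an index function repeats a value at some \<open>p\<close>
  and \<open>q\<close>. Composing \<open>\<sigma>\<close> with their transposition flips the sign
  but changes no factor of the word, so the terms cancel without any letters being commuted.\<close>

lemma sum_sign_pat:
  fixes J :: "'n::finite set"
  assumes "card J < length L" "distinct L"
  shows "(\<Sum>\<sigma> | \<sigma> permutes set L. of_int (sign \<sigma>) *\<^sub>C pat L \<sigma> (\<lambda>_. J)) = 0"
proof -
  have "(\<Sum>\<sigma> | \<sigma> permutes set L. of_int (sign \<sigma>) *\<^sub>C egl_word f \<sigma> L) = 0"
    if f: "f \<in> PiE (set L) (\<lambda>_. J)" for f
  proof -
    have "f ` set L \<subseteq> J" using f by auto
    then have "card (f ` set L) < card (set L)"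
      using assms card_mono[of J "f ` set L"] by (simp add: distinct_card)
    then have "\<not> inj_on f (set L)" using card_image by fastforce
    then obtain p q where pq: "p \<in> set L" "q \<in> set L" "p \<noteq> q" "f p = f q" unfolding inj_on_def by blast
    let ?t = "\<lambda>\<sigma>. Transposition.transpose p q \<circ> \<sigma>"
    let ?s = "\<Sum>\<sigma> | \<sigma> permutes set L. of_int (sign \<sigma>) *\<^sub>C egl_word f \<sigma> L"
    have word: "egl_word f (?t \<sigma>) L = egl_word f \<sigma> L" for \<sigma>
      using pq by (intro egl_word_cong) (auto simp: Transposition.transpose_def)
    have sgn: "sign (?t \<sigma>) = - sign \<sigma>" if "\<sigma> permutes set L" for \<sigma>
      using pq sign_compose[OF permutation_swap_id, of \<sigma> p q] permutation_permutes that by (auto simp: sign_swap_id)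
    have "?s = (\<Sum>\<sigma> | \<sigma> permutes set L. of_int (sign (?t \<sigma>)) *\<^sub>C egl_word f (?t \<sigma>) L)"
      by (rule sum.reindex_bij_witness[where i = ?t and j = ?t])
         (auto simp: o_assoc intro!: permutes_compose permutes_swap_id pq)
    also have "\<dots> = - ?s"
      unfolding sum_negf[symmetric] by (rule sum.cong) (auto simp: word sgn scaleC_minus_left)
    finally show ?thesis by (rule eq_minus_self_imp_zero)
  qed
  then show ?thesis
    unfolding pat_def scaleC_sum_right by (subst sum.swap) simp
qed

section \<open>Reduction of patterns to the generators\<close>

text \<open>The empty set makes the family closed under intersection, which the elimination of a
  constraint requires.\<close>

definition index_sets :: "'n::{finite,linorder} set set" where
  "index_sets = {{}, {..<last_index}, {last_index}, UNIV}"

lemma le_last_index: "i \<le> (last_index :: 'n::{finite,linorder})"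
  by (simp add: last_index_def)

lemma not_less_last_index: "\<not> i < last_index \<longleftrightarrow> i = last_index"
  using le_last_index[of i] by auto

lemma index_sets_Int: "A \<in> index_sets \<Longrightarrow> B \<in> index_sets \<Longrightarrow> A \<inter> B \<in> index_sets"
  by (auto simp: index_sets_def)

definition pats :: "'n::{finite,linorder} ugl set" where
  "pats = {pat L \<sigma> S | L \<sigma> S. distinct (L :: nat list) \<and> \<sigma> permutes set L \<and> range S \<subseteq> index_sets}"

lemma pat_split_indices:
  assumes "finite (set L)"
  shows "pat L \<sigma> S = (\<Sum>T\<in>Pow (set L). pat L \<sigma> (\<lambda>k. S k \<inter> (if k \<in> T then {last_index} else {..<last_index :: 'n::{finite,linorder}})))"
proof -
  let ?S = "\<lambda>T k. S k \<inter> (if k \<in> T then {last_index} else {..<last_index})"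
  have eq: "{f \<in> PiE (set L) S. {k \<in> set L. f k = last_index} = T} = PiE (set L) (?S T)" if "T \<subseteq> set L" for T
    using that not_less_last_index by (auto simp: PiE_iff extensional_def split: if_splits)
  have "pat L \<sigma> S = (\<Sum>T\<in>Pow (set L). \<Sum>f | f \<in> PiE (set L) S \<and> {k \<in> set L. f k = last_index} = T. egl_word f \<sigma> L)"
    unfolding pat_def by (rule sum.group[symmetric]) (auto intro: finite_PiE)
  also have "\<dots> = (\<Sum>T\<in>Pow (set L). pat L \<sigma> (?S T))"
    unfolding pat_def by (intro sum.cong refl) (use eq in auto)
  finally show ?thesis .
qed

lemma pat_empty_index: "k \<in> set L \<Longrightarrow> S k = {} \<Longrightarrow> pat L \<sigma> S = 0"
  unfolding pat_def by (subst PiE_eq_empty_iff[THEN iffD2]) auto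

lemma subalgebra_csubspace: "subalgebra B \<Longrightarrow> csubspace B"
  unfolding subalgebra_def csubspace_def by (metis scaleC_zero_left)

text \<open>The induction step of the reduction: patterns with fewer than \<open>m\<close> letters
  are known to lie in \<open>B\<close>, and those with \<open>m\<close> letters are compared modulo
  \<open>B\<close>.\<close>

context
  fixes B :: "'n::{finite,linorder} ugl set" and m :: nat
  assumes B: "subalgebra B"
    and lower: "\<And>L \<sigma> S. length L < m \<Longrightarrow> distinct (L :: nat list) \<Longrightarrow> \<sigma> permutes set L \<Longrightarrow> range S \<subseteq> index_sets \<Longrightarrow> pat L \<sigma> S \<in> B"
begin

lemma B_subspace: "csubspace B" using B by (rule subalgebra_csubspace)

text \<open>Each adjacent swap costs two constrained patterns with \<open>m - 1\<close> letters,
  which \<open>cpat_mem\<close> reduces to ordinary ones covered by \<open>lower\<close>.\<close>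

lemma pat_reorder_mem:
  assumes L: "distinct (L :: nat list)" "length L = m" "\<sigma> permutes set L" "range S \<subseteq> index_sets" "mset L = mset L'"
  shows "pat L \<sigma> S - pat L' \<sigma> S \<in> B"
proof (rule adjacent_swaps_connect[where N = "mset L" and R = "\<lambda>xs ys. pat xs \<sigma> S - pat ys \<sigma> S \<in> B"])
  show "pat xs \<sigma> S - pat xs \<sigma> S \<in> B" for xs using csubspace_zero[OF B_subspace] by simp
  show "pat xs \<sigma> S - pat zs \<sigma> S \<in> B" if "pat xs \<sigma> S - pat ys \<sigma> S \<in> B" "pat ys \<sigma> S - pat zs \<sigma> S \<in> B" for xs ys zs
    using csubspace_add[OF B_subspace that] by simp
  fix A C k l assume *: "mset (A @ k # l # C) = mset L"
  have dist: "distinct (A @ k # l # C)" using L(1) mset_eq_imp_distinct_iff[OF *] by simp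
  have set: "insert k (insert l (set A \<union> set C)) = set L" using mset_eq_setD[OF *] by auto
  have len: "Suc (Suc (length A + length C)) = m" using mset_eq_length[OF *] L(2) by simp
  have perm: "\<sigma> \<circ> Transposition.transpose k l permutes set L"
    using L(3) set by (intro permutes_compose permutes_swap_id) auto
  have S: "S v \<in> index_sets" for v using L(4) by auto
  have mem: "cpat (A @ x # C) {y} (\<sigma> \<circ> Transposition.transpose k l) S \<in> B" 
    if "{x, y} = {k, l}" "x \<noteq> y" for x y
  proof (rule cpat_mem[OF B_subspace index_sets_Int])
    show "pat (A @ x # C) \<tau> T \<in> B" if "\<tau> permutes set (A @ x # C)" "\<And>k. T k \<in> index_sets" for \<tau> T
      using that len dist \<open>{x, y} = {k, l}\<close> by (intro lower) (auto simp: doubleton_eq_iff)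
    show "set (A @ x # C) \<inter> {y} = {}" using dist that by (auto simp: doubleton_eq_iff)
    have "set (A @ x # C) \<union> {y} = set L" using that set by (auto simp: doubleton_eq_iff)
    then show "\<sigma> \<circ> Transposition.transpose k l permutes set (A @ x # C) \<union> {y}" using perm by (simp only:)
  qed (use S in auto)
  show "pat (A @ k # l # C) \<sigma> S - pat (A @ l # k # C) \<sigma> S \<in> B"
    unfolding pat_swap[OF dist] using dist by (intro csubspace_diff[OF B_subspace] mem) auto
qed (use L in auto)

lemma pat_nontransitive_mem:
  assumes L: "distinct (L :: nat list)" "length L = m" "\<sigma> permutes set L" "range S \<subseteq> index_sets" "\<not> transitive_on \<sigma> (set L)"
  shows "pat L \<sigma> S \<in> B"
proof -
  obtain K where K: "K \<subseteq> set L" "K \<noteq> {}" "\<sigma> ` K \<subseteq> K" "K \<noteq> set L"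
    using L(5) unfolding transitive_on_def by blast
  define L1 L2 where "L1 = filter (\<lambda>k. k \<in> K) L" and "L2 = filter (\<lambda>k. k \<notin> K) L"
  have sets: "set L1 = K" "set L2 = set L - K" using K(1) by (auto simp: L1_def L2_def)
  have dist: "distinct L1" "distinct L2" using L(1) by (simp_all add: L1_def L2_def)
  have len: "length L1 + length L2 = m" unfolding L1_def L2_def L(2)[symmetric] by (rule sum_length_filter_compl)
  have pos: "length L1 > 0" "length L2 > 0" using sets K by auto
  have ms: "mset L = mset (L1 @ L2)" by (simp add: L1_def L2_def multiset_partition)
  have inj: "inj \<sigma>" using L(3) by (rule permutes_inj)
  have finK: "finite K" using K(1) finite_subset by auto
  \<comment> \<open>Injectivity on a finite set turns invariance into equality, so the complement of
    \<open>K\<close> is invariant as well and the pattern factors.\<close>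
  have "\<sigma> ` K = K" using K(3) finK inj by (intro endo_inj_surj) (auto intro: inj_on_subset)
  then have inv2: "\<sigma> ` (set L - K) \<subseteq> set L - K"
    using inj L(3) by (simp add: image_set_diff permutes_image)
  have part: "pat L' \<sigma> S \<in> B" if "distinct L'" "length L' < m" "\<sigma> ` set L' \<subseteq> set L'" for L'
  proof -
    have "pat L' \<sigma> S = pat L' (\<lambda>x. if x \<in> set L' then \<sigma> x else x) S" by (rule pat_cong) auto
    also have "\<dots> \<in> B"
      using that L(4) restrict_permutes[OF _ L(3), of "set L'"] by (intro lower) auto
    finally show ?thesis .
  qed
  have "pat (L1 @ L2) \<sigma> S = pat L1 \<sigma> S * pat L2 \<sigma> S"
    using K(3) inv2 by (intro pat_append) (auto simp: sets)
  also have "\<dots> \<in> B"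
    using B part[of L1] part[of L2] dist len pos K(3) inv2 sets unfolding subalgebra_def by simp
  finally show ?thesis
    using csubspace_diff_cancel[OF B_subspace pat_reorder_mem[OF L(1-4) ms]] by simp
qed

text \<open>Reordering the letters along the cycle, starting at \<open>a\<close>, makes the pattern
  a trace. As all other index sets agree, that trace is the same for every full cycle.\<close>

lemma pat_transitive_cong:
  assumes L: "distinct (L :: nat list)" "length L = m" "\<sigma> permutes set L" "range S \<subseteq> index_sets" "transitive_on \<sigma> (set L)"
    and a: "a \<in> set L" "\<And>k. k \<in> set L \<Longrightarrow> k \<noteq> a \<Longrightarrow> S k = T"
  shows "pat L \<sigma> S - cycle_sum (S a) (replicate (m - 1) T) \<in> B"
proof -
  obtain as where as: "distinct (a # as)" "set (a # as) = set L" "map \<sigma> (a # as) = as @ [a]"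
    using transitive_rotation_list[OF _ L(3,5) a(1)] by auto
  have ms: "mset L = mset (a # as)" using as(1,2) L(1) set_eq_iff_mset_eq_distinct by blast
  have len: "length as = m - 1" using mset_eq_length[OF ms] L(2) by simp
  have "S k = T" if "k \<in> set as" for k using a(2)[of k] that as(1,2) by auto
  then have "map S as = map (\<lambda>_. T) as" by (intro map_cong) auto
  then have "map S as = replicate (m - 1) T" by (simp add: len map_replicate_const)
  then show ?thesis
    using pat_reorder_mem[OF L(1-4) ms] pat_rotation[OF as(1,3), of S] by simp
qed

text \<open>In the vanishing signed sum, the permutations other than full cycles contribute elements
  of \<open>B\<close>, and the full cycles contribute the same trace modulo \<open>B\<close> with
  the same sign. So a nonzero multiple of the trace lies in \<open>B\<close>.\<close>

lemma cycle_sum_mem: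
  assumes "card J < m" "J \<in> index_sets"
  shows "cycle_sum J (replicate (m - 1) J) \<in> B"
proof -
  obtain r where m: "m = Suc r" using assms(1) by (cases m) auto
  define L where "L = [0..<m]"
  have L: "distinct L" "length L = m" "finite (set L)" "set L \<noteq> {}" by (auto simp: L_def m)
  let ?c = "cycle_sum J (replicate (m - 1) J)"
  let ?P = "{\<sigma>. \<sigma> permutes set L}"
  define Q where "Q = {\<sigma> \<in> ?P. transitive_on \<sigma> (set L)}"
  have fin: "finite ?P" by (rule finite_permutations) (rule L(3))
  have rot: "map (cycle_of_list L) (0 # [1..<m]) = [1..<m] @ [0]"
    using cyclic_rotation[OF L(1), of 1] by (simp add: L_def m upt_conv_Cons del: upt_Suc)
  have L0: "L = 0 # [1..<m]" by (simp add: L_def m upt_conv_Cons del: upt_Suc)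
  \<comment> \<open>One full cycle suffices to make that multiple nonzero.\<close>
  have "cycle_of_list L \<in> Q"
    unfolding Q_def using cycle_permutes[of L] rotation_transitive[OF rot] L0 by simp
  then have N: "card Q \<noteq> 0" using fin by (auto simp: Q_def)
  define s where "s = (of_int ((- 1) ^ (m - 1)) :: complex)"
  have diff: "of_int (sign \<sigma>) *\<^sub>C pat L \<sigma> (\<lambda>_. J) - (if \<sigma> \<in> Q then s *\<^sub>C ?c else 0) \<in> B" if "\<sigma> \<in> ?P" for \<sigma>
  proof (cases "\<sigma> \<in> Q")
    case True
    then have t: "transitive_on \<sigma> (set L)" by (simp add: Q_def)
    have "of_int (sign \<sigma>) = s"
      using sign_transitive[OF L(3,4) _ t] that by (simp add: s_def distinct_card[OF L(1)] L(2))
    moreover have "pat L \<sigma> (\<lambda>_. J) - ?c \<in> B"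
      using pat_transitive_cong[OF L(1,2) _ _ t, of "\<lambda>_. J" 0 J] that assms L0 by auto
    ultimately show ?thesis using True csubspace_scale[OF B_subspace] by (simp flip: scaleC_diff_right)
  next
    case False
    then have "pat L \<sigma> (\<lambda>_. J) \<in> B"
      using that assms by (intro pat_nontransitive_mem) (auto simp: L Q_def)
    then show ?thesis using False csubspace_scale[OF B_subspace] by simp
  qed
  have "(\<Sum>\<sigma>\<in>?P. of_int (sign \<sigma>) *\<^sub>C pat L \<sigma> (\<lambda>_. J) - (if \<sigma> \<in> Q then s *\<^sub>C ?c else 0)) \<in> B"
    by (intro csubspace_sum[OF B_subspace] diff)
  moreover have "(\<Sum>\<sigma>\<in>?P. of_int (sign \<sigma>) *\<^sub>C pat L \<sigma> (\<lambda>_. J)) = 0"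
    using assms(1) L by (intro sum_sign_pat) auto
  moreover have "(\<Sum>\<sigma>\<in>?P. if \<sigma> \<in> Q then s *\<^sub>C ?c else 0) = (\<Sum>\<sigma>\<in>Q. s *\<^sub>C ?c)"
  proof -
    have "(\<Sum>\<sigma>\<in>?P. if \<sigma> \<in> Q then s *\<^sub>C ?c else 0)
        = (\<Sum>\<sigma>\<in>?P. if transitive_on \<sigma> (set L) then s *\<^sub>C ?c else 0)"
      by (rule sum.cong) (auto simp: Q_def)
    also have "\<dots> = (\<Sum>\<sigma>\<in>Q. s *\<^sub>C ?c)" unfolding Q_def by (rule sum.inter_filter[OF fin, symmetric])
    finally show ?thesis .
  qed
  ultimately have "- ((of_nat (card Q) * s) *\<^sub>C ?c) \<in> B"
    by (simp add: sum_subtractf sum_const_scaleC scaleC_scaleC del: sum_constant)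
  then have "(- (of_nat (card Q) * s)) *\<^sub>C ?c \<in> B" by (simp add: scaleC_minus_left)
  then show ?thesis by (rule csubspace_scale_cancel[OF B_subspace]) (use N in \<open>simp add: s_def\<close>)
qed

lemma pat_mem_step:
  assumes J: "cycle_sum {..<last_index} (replicate (m - 1) {..<last_index}) \<in> B"
    and E: "cycle_sum UNIV (replicate (m - 1) UNIV) \<in> B"
    and L: "distinct (L :: nat list)" "length L = m" "\<sigma> permutes set L" "range S \<subseteq> index_sets"
  shows "pat L \<sigma> S \<in> B"
proof (cases "m = 0")
  case True
  then show ?thesis using L(2) B by (simp add: pat_def subalgebra_def)
next
  case False
  let ?J = "{..<last_index :: 'n}" and ?d = "{last_index :: 'n}"
  let ?S = "\<lambda>T k. if k \<in> T then ?d else ?J"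
  let ?u = "cycle_sum ?d (replicate (m - 1) ?J)"
  have S: "range (?S T) \<subseteq> index_sets" for T by (auto simp: index_sets_def)
  have two: "pat L \<tau> (?S T) \<in> B" if "\<tau> permutes set L" "p \<in> T" "q \<in> T" "p \<noteq> q" "T \<subseteq> set L" for \<tau> T p q
  proof (cases "transitive_on \<tau> (set L)")
    case True
    let ?t = "Transposition.transpose p q \<circ> \<tau>"
    have perm: "?t permutes set L" using that by (intro permutes_compose permutes_swap_id) auto
    \<comment> \<open>All full cycles have the same sign, so this flip shows that \<open>?t\<close>
      is no longer one.\<close>
    have "sign ?t = - sign \<tau>"
      using that sign_compose[OF permutation_swap_id, of \<tau> p q] permutation_permutes by (auto simp: sign_swap_id)
    moreover have "L \<noteq> []" using that by auto
    ultimately have "\<not> transitive_on ?t (set L)"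
      using sign_transitive[OF _ _ that(1) True] sign_transitive[OF _ _ perm] by auto
    then have "pat L ?t (?S T) \<in> B" by (intro pat_nontransitive_mem L perm S)
    moreover have "egl_word f ?t L = egl_word f \<tau> L" if "f \<in> PiE (set L) (?S T)" for f
    proof -
      have "p \<in> set L" "q \<in> set L" using \<open>p \<in> T\<close> \<open>q \<in> T\<close> \<open>T \<subseteq> set L\<close> by auto
      then have "f p = last_index" "f q = last_index"
        using PiE_mem[OF that, of p] PiE_mem[OF that, of q] \<open>p \<in> T\<close> \<open>q \<in> T\<close> by auto
      then show ?thesis by (intro egl_word_cong) (auto simp: Transposition.transpose_def)
    qed
    ultimately show ?thesis unfolding pat_def by simp
  qed (intro pat_nontransitive_mem L S that)
  have none: "pat L \<tau> (?S {}) \<in> B" if "\<tau> permutes set L" for \<tau>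
  proof (cases "transitive_on \<tau> (set L)")
    case True
    obtain a where "a \<in> set L" using L(2) False by (cases L) auto
    from pat_transitive_cong[OF L(1,2) that S True this, of "{}" ?J] J show ?thesis
      using csubspace_diff_cancel[OF B_subspace] by simp
  qed (intro pat_nontransitive_mem L S that)
  have one: "pat L \<tau> (?S {p}) - ?u \<in> B" if "\<tau> permutes set L" "transitive_on \<tau> (set L)" "p \<in> set L" for \<tau> p
    using pat_transitive_cong[OF L(1,2) that(1) S that(2,3), of "{p}" ?J] by simp
  have subsets: "T = {} \<or> (\<exists>p\<in>set L. T = {p}) \<or> (\<exists>p q. p \<in> T \<and> q \<in> T \<and> p \<noteq> q)" if "T \<subseteq> set L" for T
    using that by blast
  have u: "?u \<in> B"
  proof -
    obtain r where m: "m = Suc r" using False by (cases m) auto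
    obtain a as where La: "L = a # as" using L(2) False by (cases L) auto
    have rot: "map (cycle_of_list L) (a # as) = as @ [a]"
      using cyclic_rotation[OF L(1), of 1] by (simp add: La)
    let ?c = "cycle_of_list L"
    have c: "?c permutes set L" "transitive_on ?c (set L)"
      using cycle_permutes[of L] rotation_transitive[OF rot] by (simp_all add: La)
    have all: "pat L ?c (\<lambda>_. UNIV) \<in> B"
    proof -
      have "pat L ?c (\<lambda>_. UNIV) - cycle_sum UNIV (replicate (m - 1) UNIV) \<in> B"
        by (rule pat_transitive_cong[OF L(1,2) c(1) _ c(2), of "\<lambda>_. UNIV" a UNIV])
           (auto simp: La index_sets_def)
      then show ?thesis using E by (rule csubspace_diff_cancel[OF B_subspace])
    qed
    \<comment> \<open>The part of each summand not yet known to lie in \<open>B\<close>: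
      \<open>?u\<close> for each of the \<open>m\<close> singletons, nothing otherwise. As the whole
      sum is in \<open>B\<close>, so is \<open>m\<close> times \<open>?u\<close>.\<close>
    define h where "h T = (if \<exists>p. T = {p} then ?u else 0)" for T :: "nat set"
    have "pat L ?c (?S T) - h T \<in> B" if "T \<subseteq> set L" for T
      using subsets[OF that]
    proof (elim disjE bexE exE conjE)
      assume "T = {}"
      then show ?thesis using none[OF c(1)] by (simp add: h_def)
    next
      fix p assume "p \<in> set L" "T = {p}"
      then show ?thesis using one[OF c] by (simp add: h_def)
    next
      fix p q assume pq: "p \<in> T" "q \<in> T" "p \<noteq> q"
      then have "h T = 0" by (auto simp: h_def)
      then show ?thesis using two[OF c(1) pq that] by simp
    qed
    then have "(\<Sum>T\<in>Pow (set L). pat L ?c (?S T) - h T) \<in> B"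
      by (intro csubspace_sum[OF B_subspace]) auto
    moreover have "(\<Sum>T\<in>Pow (set L). pat L ?c (?S T)) = pat L ?c (\<lambda>_. UNIV)"
      using pat_split_indices[of L ?c "\<lambda>_. UNIV :: 'n set"] by simp
    moreover have "(\<Sum>T\<in>Pow (set L). h T) = of_nat m *\<^sub>C ?u"
    proof -
      have "(\<Sum>T\<in>Pow (set L). h T) = (\<Sum>T\<in>(\<lambda>p. {p}) ` set L. ?u)"
        by (rule sum.mono_neutral_cong_right) (auto simp: h_def)
      also have "\<dots> = of_nat m *\<^sub>C ?u"
        unfolding sum_const_scaleC using distinct_card[OF L(1)] L(2) by (simp add: card_image)
      finally show ?thesis .
    qed
    ultimately have "pat L ?c (\<lambda>_. UNIV) - of_nat m *\<^sub>C ?u \<in> B" by (simp add: sum_subtractf)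
    from csubspace_diff[OF B_subspace all this] have "of_nat m *\<^sub>C ?u \<in> B" by simp
    then show ?thesis by (rule csubspace_scale_cancel[OF B_subspace]) (use False in simp)
  qed
  have base: "pat L \<sigma> (?S T) \<in> B" if "T \<subseteq> set L" for T
    using subsets[OF that]
  proof (elim disjE bexE exE conjE)
    assume "T = {}"
    then show ?thesis using none[OF L(3)] by simp
  next
    fix p assume p: "p \<in> set L" "T = {p}"
    show ?thesis
    proof (cases "transitive_on \<sigma> (set L)")
      case True
      from csubspace_diff_cancel[OF B_subspace one[OF L(3) True p(1)] u] show ?thesis using p by simp
    qed (intro pat_nontransitive_mem L S)
  next
    fix p q assume pq: "p \<in> T" "q \<in> T" "p \<noteq> q"
    then show ?thesis using two[OF L(3) pq that] by simp
  qed
  show ?thesis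
    unfolding pat_split_indices[OF finite_set, of L \<sigma> S]
  proof (intro csubspace_sum[OF B_subspace])
    fix T assume T: "T \<in> Pow (set L)"
    let ?R = "\<lambda>k. S k \<inter> ?S T k"
    \<comment> \<open>Every admissible index set contains or misses each of the blocks
      \<open>?J\<close> and \<open>?d\<close>, so each summand is either zero or a base
      case.\<close>
    have R: "?R k = {} \<or> ?R k = ?S T k" for k
    proof -
      have disj: "?J \<inter> ?d = {}" "?d \<inter> ?J = {}" by auto
      have "S k = {} \<or> S k = ?J \<or> S k = ?d \<or> S k = UNIV"
        using L(4) unfolding index_sets_def by blast
      then show ?thesis by (elim disjE; cases "k \<in> T"; simp add: disj)
    qed
    show "pat L \<sigma> ?R \<in> B"
    proof (cases "\<exists>k\<in>set L. ?R k = {}")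
      case True
      then obtain k where "k \<in> set L" "?R k = {}" by blast
      then show ?thesis using pat_empty_index[of k L ?R] csubspace_zero[OF B_subspace] by simp
    next
      case False
      then have "pat L \<sigma> ?R = pat L \<sigma> (?S T)" using R by (intro pat_cong) blast+
      then show ?thesis using base T by simp
    qed
  qed
qed

end

text \<open>Strong induction on the number of letters. The trace of the power of that order is given
  as long as it does not exceed the number of indices; beyond that, \<open>cycle_sum_mem\<close>
  derives it from shorter patterns.\<close>

lemma pats_subset:
  fixes B :: "'n::{finite,linorder} ugl set"
  assumes B: "subalgebra B"
    and J: "\<And>m. 1 \<le> m \<Longrightarrow> m \<le> card {..<last_index :: 'n} \<Longrightarrow> trace_on {..<last_index} (mat_pow_on {..<last_index} egl m) \<in> B"
    and E: "\<And>m. 1 \<le> m \<Longrightarrow> m \<le> CARD('n) \<Longrightarrow> trace_on UNIV (mat_pow_on UNIV egl m) \<in> B"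
  shows "pats \<subseteq> B"
proof -
  have "pat L \<sigma> S \<in> B" if "distinct (L :: nat list)" "\<sigma> permutes set L" "range S \<subseteq> index_sets" for L \<sigma> S
    using that
  proof (induction "length L" arbitrary: L \<sigma> S rule: less_induct)
    case less
    have lower: "pat L' \<sigma>' (S' :: nat \<Rightarrow> 'n set) \<in> B"
      if "length L' < length L" "distinct L'" "\<sigma>' permutes set L'" "range S' \<subseteq> index_sets" for L' \<sigma>' S'
      by (rule less.hyps) (use that in auto)
    show ?case
    proof (cases "L = []")
      case True
      then show ?thesis using B by (simp add: pat_def subalgebra_def)
    next
      case False
      then obtain r where r: "length L = Suc r" by (cases L) auto
      have cyc: "cycle_sum A (replicate (length L - 1) A) \<in> B"
        if "A \<in> index_sets" "\<And>m. 1 \<le> m \<Longrightarrow> m \<le> card A \<Longrightarrow> trace_on A (mat_pow_on A egl m) \<in> B" for A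
      proof (cases "card A < length L")
        case True
        show ?thesis by (rule cycle_sum_mem[OF B lower True that(1)])
      next
        case False
        then show ?thesis using that(2)[of "length L"] by (simp add: r trace_on_mat_pow)
      qed
      show ?thesis
        by (rule pat_mem_step[OF B lower cyc cyc]) (use J E less.prems in \<open>auto simp: index_sets_def\<close>)
    qed
  qed
  then show ?thesis unfolding pats_def by blast
qed

section \<open>The coproduct and stability under \<open>P\<close>\<close>

lemma scaleC_sum_left: "(\<Sum>i\<in>A. c i) *\<^sub>C (x :: 'v::complex_vector) = (\<Sum>i\<in>A. c i *\<^sub>C x)"
  by (induction A rule: infinite_finite_induct) (simp_all add: scaleC_add_left)

lemma clinear_coproduct: "clinear (coproduct :: 'n::{finite,linorder} ugl \<Rightarrow> _)"
  and coproduct_one: "coproduct (1 :: 'n ugl) = 1"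
  and coproduct_mult: "coproduct (x * y :: 'n ugl) = coproduct x * coproduct y"
  and coproduct_Igl: "coproduct (Igl :: 'n ugl) = Igl \<otimes> Igl"
  and coproduct_off_diagonal: "i \<noteq> j \<Longrightarrow> coproduct (egl i j :: 'n ugl) = 1 \<otimes> egl i j + egl i j \<otimes> 1"
  and coproduct_hgl: "i \<noteq> last_index \<Longrightarrow> coproduct (hgl i :: 'n ugl) = 1 \<otimes> hgl i + hgl i \<otimes> 1"
  using is_coproduct_coproduct[where 'n = 'n] by (simp_all add: is_coproduct_def calg_hom_def)

lemma clinear_std_rep: "clinear (std_rep :: 'n::finite ugl \<Rightarrow> _)"
  and std_rep_one: "std_rep (1 :: 'n ugl) = mat 1"
  and std_rep_mult: "std_rep (x * y :: 'n ugl) = std_rep x ** std_rep y"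
  and std_rep_egl: "std_rep (egl i j :: 'n ugl) = matrix_unit i j"
  using is_std_rep_std_rep[where 'n = 'n] by (simp_all add: is_std_rep_def)

lemma std_rep_Igl: "std_rep (Igl :: 'n::finite ugl) = mat 1"
  unfolding Igl_def clinear_sum[OF clinear_std_rep] std_rep_egl
  by (simp add: vec_eq_iff sum_component matrix_unit_def mat_def if_distrib if_distribR
      cong: if_cong) (auto intro!: sum.neutral simp: sum.delta')

text \<open>The defining conditions of the coproduct only see the differences \<open>h\<^sub>i\<close> of diagonal elements
  and their sum \<open>I\<close>, so the primitivity defect is the same for all diagonal \<open>e\<^sub>i\<^sub>i\<close>.\<close>

lemma coproduct_egl:
  fixes i j :: "'n::{finite,linorder}"
  shows "coproduct (egl i j) = 1 \<otimes> egl i j + egl i j \<otimes> 1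
    + (if i = j then (1 / of_nat CARD('n)) *\<^sub>C (Igl \<otimes> Igl - 1 \<otimes> Igl - Igl \<otimes> 1) else 0)"
proof -
  define prim where "prim x = 1 \<otimes> x + x \<otimes> 1" for x :: "'n ugl"
  have lin: "clinear prim"
    by (simp add: clinear_def prim_def tensor_add_left tensor_add_right tensor_scaleC_left
        tensor_scaleC_right scaleC_add_right)
  define Z where "Z i = coproduct (egl i i) - prim (egl i i)" for i :: 'n
  have step: "Z i = Z (next_index i)" if "i \<noteq> last_index" for i
  proof -
    have "coproduct (hgl i) = prim (hgl i)" using coproduct_hgl[OF that] by (simp add: prim_def)
    then have "coproduct (egl i i) - coproduct (egl (next_index i) (next_index i))
        = prim (egl i i) - prim (egl (next_index i) (next_index i))"
      by (simp only: hgl_def clinear_diff[OF clinear_coproduct] clinear_diff[OF lin])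
    then show ?thesis by (simp add: Z_def algebra_simps)
  qed
  have const: "Z i = Z last_index" for i
  proof (induction "card {i<..}" arbitrary: i rule: less_induct)
    case less
    show ?case
    proof (cases "i = last_index")
      case False
      then have "card {next_index i<..} < card {i<..}"
        using next_index_greater[OF False] by (intro psubset_card_mono) auto
      then show ?thesis using less step[OF False] by simp
    qed simp
  qed
  let ?d = "of_nat CARD('n) :: complex"
  have "coproduct Igl - prim Igl = (\<Sum>i\<in>(UNIV :: 'n set). Z i)"
    by (simp add: Z_def Igl_def clinear_sum[OF clinear_coproduct] clinear_sum[OF lin] sum_subtractf)
  also have "\<dots> = (\<Sum>k\<in>(UNIV :: 'n set). Z i)"
  proof (rule sum.cong[OF refl])
    show "Z k = Z i" for k using const[of k] const[of i] by simp
  qed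
  finally have "Igl \<otimes> Igl - prim Igl = ?d *\<^sub>C Z i" by (simp only: sum_const_scaleC coproduct_Igl)
  then have "Z i = (1 / ?d) *\<^sub>C (Igl \<otimes> Igl - prim Igl)"
    by (simp add: scaleC_scaleC scaleC_one)
  then show ?thesis
    using coproduct_off_diagonal[of i j] by (cases "i = j") (auto simp: Z_def prim_def algebra_simps)
qed

section \<open>(id \<otimes> \<rho>) \<Delta> as a matrix over the enveloping algebra\<close>

definition slice :: "'n \<Rightarrow> 'n \<Rightarrow> ('n::finite ugl, 'n ugl) tensor \<Rightarrow> 'n ugl" where
  "slice p q = tensor_map (\<lambda>y z. (std_rep z $ p $ q) *\<^sub>C y)"

text \<open>Up to the factor 1/d, \<open>P_op\<close> is the trace of this matrix. The matrix
  depends multiplicatively on \<open>x\<close>, so it can be computed letter by letter.\<close>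

definition Phi :: "'n::{finite,linorder} ugl \<Rightarrow> 'n \<Rightarrow> 'n \<Rightarrow> 'n ugl" where
  "Phi x p q = slice p q (coproduct x)"

lemma cbilinear_slice: "cbilinear (\<lambda>(y :: 'n::finite ugl) z. (std_rep (z :: 'n ugl) $ p $ q) *\<^sub>C y)"
  using clinear_std_rep[where 'n = 'n]
  by (simp add: cbilinear_def clinear_def scaleC_add_left scaleC_add_right scaleC_scaleC
      scaleC_vec_def scaleC_complex_def mult.commute)

lemma clinear_slice: "clinear (slice p q)"
  and slice_tensor: "slice p q (y \<otimes> z) = (std_rep z $ p $ q) *\<^sub>C y"
  unfolding slice_def by (rule tensor_map[OF cbilinear_slice])+

lemma slice_add: "slice p q (s + t) = slice p q s + slice p q t"
  and slice_scaleC: "slice p q (c *\<^sub>C t) = c *\<^sub>C slice p q t"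
  using clinear_slice[of p q] by (simp_all add: clinear_def)

lemma slice_left: "slice p q ((x \<otimes> 1) * t) = x * slice p q t"
  by (induction t rule: tensor_induct)
     (simp_all add: tensor_mult slice_tensor slice_add distrib_left scaleC_mult_right)

lemma slice_right: "slice p q ((1 \<otimes> egl i j) * t) = (if p = i then slice j q t else 0)"
proof (induction t rule: tensor_induct)
  case (simple x y)
  have "(matrix_unit i j ** m) $ p $ q = (if p = i then m $ j $ q else 0)" for m :: "complex ^ 'a ^ 'a"
    by (simp add: matrix_matrix_mult_def matrix_unit_def if_distrib if_distribR cong: if_cong)
  then show ?case by (simp add: tensor_mult slice_tensor std_rep_mult std_rep_egl)
qed (simp add: slice_add distrib_left)

text \<open>\<rho>(I) is the identity matrix, so the first and the last summand cancel under id
  \<otimes> \<rho> and only - 1 remains.\<close>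

lemma slice_Igl: "slice p q ((Igl \<otimes> Igl - 1 \<otimes> Igl - Igl \<otimes> 1) * t) = - slice p q t"
proof (induction t rule: tensor_induct)
  case (simple x y)
  then show ?case
    by (simp add: left_diff_distrib tensor_mult clinear_diff[OF clinear_slice] slice_tensor std_rep_mult std_rep_Igl)
qed (simp add: slice_add distrib_left)

lemma Phi_one: "Phi 1 p q = (if p = q then 1 else 0)"
  by (simp add: Phi_def coproduct_one one_tensor_one[symmetric] slice_tensor std_rep_one mat_def scaleC_one)

text \<open>A letter is kept, or replaced by the scalar - 1/d if it is diagonal, or its matrix unit
  moves the row index from \<open>i\<close> to \<open>j\<close>.\<close>

lemma Phi_egl_mult:
  fixes x :: "'n::{finite,linorder} ugl"
  shows "Phi (egl i j * x) p q = egl i j * Phi x p q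
    - (if i = j then (1 / of_nat CARD('n)) *\<^sub>C Phi x p q else 0) + (if p = i then Phi x j q else 0)"
  unfolding Phi_def coproduct_mult coproduct_egl distrib_right slice_add slice_left slice_right
  by (auto simp: scaleC_mult_left slice_scaleC slice_Igl scaleC_minus_right clinear_zero[OF clinear_slice])

lemma P_op_Phi:
  fixes x :: "'n::{finite,linorder} ugl"
  shows "P_op x = (1 / of_nat CARD('n)) *\<^sub>C (\<Sum>p\<in>UNIV. Phi x p p)"
proof -
  have "tensor_map (\<lambda>y z. eta z *\<^sub>C y) t = (1 / of_nat CARD('n)) *\<^sub>C (\<Sum>p\<in>UNIV. slice p p t)"
    for t :: "('n ugl, 'n ugl) tensor"
  proof (induction t rule: tensor_induct)
    case (simple x y)
    have "(\<Sum>p\<in>UNIV. (std_rep y $ p $ p) *\<^sub>C x) = trace (std_rep y) *\<^sub>C x"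
      by (simp add: trace_def scaleC_sum_left)
    then show ?case
      unfolding tensor_map(2)[OF cbilinear_id_eta] slice_tensor by (simp add: eta_def scaleC_scaleC)
  next
    case (add s t)
    moreover have "clinear (tensor_map (\<lambda>y (z :: 'n ugl). eta z *\<^sub>C (y :: 'n ugl)))"
      by (rule tensor_map(1)[OF cbilinear_id_eta])
    ultimately show ?case
      by (simp add: clinear_def slice_add sum.distrib scaleC_add_right)
  qed
  then show ?thesis by (simp add: P_op_def Phi_def)
qed

lemma clinear_P_op: "clinear P_op"
  using clinear_compose[OF clinear_coproduct tensor_map(1)[OF cbilinear_id_eta]] by (simp add: clinear_def P_op_def)

text \<open>\<open>insertion A M a \<sigma> S K\<close> is a trace into which the matrix unit with indices \<open>f a\<close> and
  \<open>f (\<sigma> a)\<close> has been inserted: the letters \<open>A\<close> are processed, those in \<open>M\<close> are contracted, and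
  those in \<open>K\<close> remain. Multiplying by one more matrix unit \<open>k\<close> contracts \<open>k\<close> and composes \<open>\<sigma>\<close> with the
  transposition of \<open>a\<close> and \<open>k\<close>, so one open matrix unit suffices throughout.\<close>

definition insertion ::
    "'v list \<Rightarrow> 'v set \<Rightarrow> 'v \<Rightarrow> ('v \<Rightarrow> 'v) \<Rightarrow> ('v \<Rightarrow> 'n set) \<Rightarrow> 'v list \<Rightarrow> 'n::{finite,linorder} ugl" where
  "insertion A M a \<sigma> S K = (\<Sum>f\<in>PiE (insert a (set A \<union> set K \<union> M)) S. if \<forall>v\<in>M. f (\<sigma> v) = f v
     then egl_word f \<sigma> A * Phi (egl_word f \<sigma> K) (f (\<sigma> a)) (f a) else 0)"

text \<open>The stage before any matrix unit has been inserted, with the trace over \<open>p\<close>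
  still free. The first letter to contribute its matrix unit becomes the label \<open>a\<close> of
  an \<open>insertion\<close>.\<close>

definition insertion_trace ::
    "'v list \<Rightarrow> 'v set \<Rightarrow> ('v \<Rightarrow> 'v) \<Rightarrow> ('v \<Rightarrow> 'n set) \<Rightarrow> 'v list \<Rightarrow> 'n::{finite,linorder} ugl" where
  "insertion_trace A M \<sigma> S K = (\<Sum>f\<in>PiE (set A \<union> set K \<union> M) S. if \<forall>v\<in>M. f (\<sigma> v) = f v
     then egl_word f \<sigma> A * (\<Sum>p\<in>UNIV. Phi (egl_word f \<sigma> K) p p) else 0)"

lemma insertion_mem:
  fixes V :: "'n::{finite,linorder} ugl set" and A :: "nat list"
  assumes V: "csubspace V" "pats \<subseteq> V" and S: "\<And>k. S k \<in> index_sets"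
  shows "finite M \<Longrightarrow> distinct (a # A @ K) \<Longrightarrow> M \<inter> set (a # A @ K) = {} \<Longrightarrow>
    \<sigma> permutes insert a (set A \<union> set K \<union> M) \<Longrightarrow> insertion A M a \<sigma> S K \<in> V"
proof (induction K arbitrary: A M \<sigma>)
  case Nil
  \<comment> \<open>With no letters left, the identity matrix closes the open matrix unit, and
    \<open>a\<close> becomes one more constraint.\<close>
  have "insertion A M a \<sigma> S [] = cpat A (insert a M) \<sigma> S"
    unfolding insertion_def cpat_def by (rule sum.cong) (auto simp: Phi_one)
  also have "\<dots> \<in> V"
  proof (rule cpat_mem[OF V(1) index_sets_Int])
    show "pat A \<tau> T \<in> V" if "\<tau> permutes set A" "\<And>k. T k \<in> index_sets" for \<tau> T
      using that V(2) Nil.prems unfolding pats_def by fastforce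
  qed (use Nil.prems S in \<open>auto simp: Un_commute\<close>)
  finally show ?case .
next
  case (Cons k K)
  let ?t = "\<sigma> \<circ> Transposition.transpose a k"
  have sets: "insert a (set (A @ [k]) \<union> set K \<union> M) = insert a (set A \<union> set (k # K) \<union> M)"
    "insert a (set A \<union> set K \<union> insert k M) = insert a (set A \<union> set (k # K) \<union> M)" by auto
  have perm: "?t permutes insert a (set A \<union> set (k # K) \<union> M)"
    using Cons.prems by (intro permutes_compose permutes_swap_id) auto
  have words: "egl_word f ?t A = egl_word f \<sigma> A" "egl_word f ?t K = egl_word f \<sigma> K" for f :: "nat \<Rightarrow> 'n"
    using Cons.prems by (auto intro!: egl_word_cong simp: Transposition.transpose_def)
  have M: "(\<forall>v\<in>insert k M. f (?t v) = f v) \<longleftrightarrow> f (\<sigma> a) = f k \<and> (\<forall>v\<in>M. f (\<sigma> v) = f v)" for f :: "nat \<Rightarrow> 'n"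
    using Cons.prems by (auto simp: Transposition.transpose_def)
  let ?c = "1 / of_nat CARD('n) :: complex"
  \<comment> \<open>In turn, \<open>k\<close> is kept as a processed letter, is contracted with
    itself, or contributes its matrix unit. In the last case \<open>?t\<close> encodes the new
    wiring, and the delta \<open>f (\<sigma> a) = f k\<close> becomes the constraint at
    \<open>k\<close>.\<close>
  have "insertion A M a \<sigma> S (k # K) = insertion (A @ [k]) M a \<sigma> S K
      - ?c *\<^sub>C insertion A (insert k M) a \<sigma> S K + insertion A (insert k M) a ?t S K"
    unfolding insertion_def sets M words scaleC_sum_right sum_subtractf[symmetric] sum.distrib[symmetric]
    by (rule sum.cong[OF refl])
       (auto simp: Phi_egl_mult egl_word_append algebra_simps scaleC_mult_right)
  moreover have "insertion (A @ [k]) M a \<sigma> S K \<in> V" "insertion A (insert k M) a \<sigma> S K \<in> V"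
    by (rule Cons.IH; use Cons.prems sets in auto)+
  moreover have "insertion A (insert k M) a ?t S K \<in> V"
  proof (rule Cons.IH)
    show "?t permutes insert a (set A \<union> set K \<union> insert k M)" unfolding sets by (rule perm)
  qed (use Cons.prems in auto)
  ultimately show ?case
    by (simp add: csubspace_add[OF V(1)] csubspace_diff[OF V(1)] csubspace_scale[OF V(1)])
qed

lemma insertion_trace_mem:
  fixes V :: "'n::{finite,linorder} ugl set" and A :: "nat list"
  assumes V: "csubspace V" "pats \<subseteq> V" and S: "\<And>k. S k \<in> index_sets"
  shows "finite M \<Longrightarrow> distinct (A @ K) \<Longrightarrow> M \<inter> set (A @ K) = {} \<Longrightarrow>
    \<sigma> permutes (set A \<union> set K \<union> M) \<Longrightarrow> insertion_trace A M \<sigma> S K \<in> V"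
proof (induction K arbitrary: A M)
  case Nil
  have "insertion_trace A M \<sigma> S [] = of_nat CARD('n) *\<^sub>C cpat A M \<sigma> S"
    unfolding insertion_trace_def cpat_def scaleC_sum_right
    by (rule sum.cong) (auto simp: Phi_one sum_const_scaleC scaleC_mult_right simp del: sum_constant)
  moreover have "cpat A M \<sigma> S \<in> V"
  proof (rule cpat_mem[OF V(1) index_sets_Int])
    show "pat A \<tau> T \<in> V" if "\<tau> permutes set A" "\<And>k. T k \<in> index_sets" for \<tau> T
      using that V(2) Nil.prems unfolding pats_def by fastforce
  qed (use Nil.prems S in auto)
  ultimately show ?case by (simp add: csubspace_scale[OF V(1)])
next
  case (Cons k K)
  have sets: "set (A @ [k]) \<union> set K \<union> M = set A \<union> set (k # K) \<union> M"
    "set A \<union> set K \<union> insert k M = set A \<union> set (k # K) \<union> M"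
    "insert k (set A \<union> set K \<union> M) = set A \<union> set (k # K) \<union> M" by auto
  let ?c = "1 / of_nat CARD('n) :: complex"
  have "insertion_trace A M \<sigma> S (k # K) = insertion_trace (A @ [k]) M \<sigma> S K
      - ?c *\<^sub>C insertion_trace A (insert k M) \<sigma> S K + insertion A M k \<sigma> S K"
    unfolding insertion_def insertion_trace_def sets scaleC_sum_right sum_subtractf[symmetric] sum.distrib[symmetric]
    by (rule sum.cong[OF refl])
       (auto simp: Phi_egl_mult egl_word_append algebra_simps scaleC_mult_right sum.distrib sum_subtractf
          scaleC_sum_right[symmetric] sum_distrib_left[symmetric])
  moreover have "insertion_trace (A @ [k]) M \<sigma> S K \<in> V" "insertion_trace A (insert k M) \<sigma> S K \<in> V"
    by (rule Cons.IH; use Cons.prems in auto)+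
  moreover have "insertion A M k \<sigma> S K \<in> V"
    by (rule insertion_mem[OF V S]) (use Cons.prems in auto)
  ultimately show ?case
    by (simp add: csubspace_add[OF V(1)] csubspace_diff[OF V(1)] csubspace_scale[OF V(1)])
qed

lemma P_op_pat_mem:
  assumes V: "csubspace V" "pats \<subseteq> V" and x: "x \<in> pats"
  shows "P_op x \<in> V"
proof -
  obtain L :: "nat list" and \<sigma> and S where x: "x = pat L \<sigma> S" "distinct L" "\<sigma> permutes set L" "range S \<subseteq> index_sets"
    using x unfolding pats_def by blast
  have "P_op x = (\<Sum>f\<in>PiE (set L) S. P_op (egl_word f \<sigma> L))"
    unfolding x(1) pat_def by (rule clinear_sum[OF clinear_P_op])
  then have "P_op x = (1 / of_nat CARD('a)) *\<^sub>C insertion_trace [] {} \<sigma> S L"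
    by (simp add: insertion_trace_def P_op_Phi scaleC_sum_right)
  moreover have "insertion_trace [] {} \<sigma> S L \<in> V"
    using x by (intro insertion_trace_mem[OF V]) auto
  ultimately show ?thesis by (simp add: csubspace_scale[OF V(1)])
qed

section \<open>The algebra spanned by the patterns\<close>

lemma csubspace_hull: "csubspace (csubspace hull X)"
  by (rule hull_in) (auto simp: csubspace_def)

lemma subalgebra_hull: "subalgebra (subalgebra hull X)"
  by (rule hull_in) (auto simp: subalgebra_def)

lemma one_in_pats: "1 \<in> pats"
proof -
  have "(1 :: 'n ugl) = pat [] id (\<lambda>_. {})" by (simp add: pat_def)
  then show ?thesis unfolding pats_def by (force simp: index_sets_def)
qed

lemma pats_mult:
  assumes "x \<in> pats" "y \<in> pats" shows "x * y \<in> pats"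
proof -
  obtain L :: "nat list" and \<sigma> and S where x: "x = pat L \<sigma> S" "distinct L" "\<sigma> permutes set L" "range S \<subseteq> index_sets"
    using assms(1) unfolding pats_def by blast
  obtain L' :: "nat list" and \<sigma>' and S' where y: "y = pat L' \<sigma>' S'" "distinct L'" "\<sigma>' permutes set L'" "range S' \<subseteq> index_sets"
    using assms(2) unfolding pats_def by blast
  \<comment> \<open>\<open>N\<close> exceeds all labels of \<open>L\<close>, so shifting the labels
    of \<open>L'\<close> by \<open>N\<close> makes the two patterns disjoint.\<close>
  obtain N where N: "\<And>k. k \<in> set L \<Longrightarrow> k < N"
    using finite_nat_set_iff_bounded[of "set L"] by auto
  let ?g = "\<lambda>k. k + N"
  define \<tau> where "\<tau> k = (if k < N then \<sigma> k else \<sigma>' (k - N) + N)" for k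
  define T where "T k = (if k < N then S k else S' (k - N))" for k
  have lt: "\<sigma> k < N" if "k < N" for k
    using that N permutes_in_image[OF x(3)] permutes_not_in[OF x(3)] by metis
  have img: "\<sigma> k \<in> set L \<longleftrightarrow> k \<in> set L" "\<sigma>' k \<in> set L' \<longleftrightarrow> k \<in> set L'" for k
    using x(3) y(3) by (simp_all add: permutes_in_image)
  have "pat L \<tau> T = x"
    unfolding x(1) by (rule pat_cong) (auto simp: \<tau>_def T_def dest: N)
  moreover have "pat (map ?g L') \<tau> T = y"
    unfolding y(1) by (rule pat_rename) (auto simp: \<tau>_def T_def inj_def img)
  moreover have "pat (L @ map ?g L') \<tau> T = pat L \<tau> T * pat (map ?g L') \<tau> T"
    by (rule pat_append) (auto simp: \<tau>_def img dest: N)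
  moreover have "pat (L @ map ?g L') \<tau> T \<in> pats"
  proof -
    have "inj \<tau>"
    proof (rule injI)
      fix a b assume *: "\<tau> a = \<tau> b"
      have "a < N \<longleftrightarrow> b < N" using * lt[of a] lt[of b] by (auto simp: \<tau>_def split: if_splits)
      then show "a = b" using * permutes_inj[OF x(3)] permutes_inj[OF y(3)]
        by (auto simp: \<tau>_def inj_eq split: if_splits)
    qed
    then have "inj_on \<tau> (set (L @ map ?g L'))" by (rule inj_on_subset) simp
    moreover have "\<tau> ` set (L @ map ?g L') \<subseteq> set (L @ map ?g L')"
      by (auto simp: \<tau>_def img dest: N)
    ultimately have "bij_betw \<tau> (set (L @ map ?g L')) (set (L @ map ?g L'))"
      unfolding bij_betw_def by (intro conjI endo_inj_surj) auto
    moreover have "\<tau> k = k" if "k \<notin> set (L @ map ?g L')" for k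
    proof (cases "k < N")
      case True
      then show ?thesis using that permutes_not_in[OF x(3), of k] by (simp add: \<tau>_def)
    next
      case False
      then have "k - N \<notin> set L'" using that by force
      then show ?thesis using False permutes_not_in[OF y(3)] by (simp add: \<tau>_def)
    qed
    ultimately have "\<tau> permutes set (L @ map ?g L')" by (rule bij_imp_permutes)
    moreover have "range T \<subseteq> index_sets" using x(4) y(4) by (auto simp: T_def)
    moreover have "distinct (L @ map ?g L')"
      using x(2) y(2) by (auto simp: distinct_map dest: N)
    ultimately show ?thesis unfolding pats_def by blast
  qed
  ultimately show ?thesis by simp
qed

lemma csubspace_vimage: "clinear f \<Longrightarrow> csubspace V \<Longrightarrow> csubspace {x. f x \<in> V}"
  by (auto simp: csubspace_def clinear_zero) (auto simp: clinear_def)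

lemma subalgebra_pats_span: "subalgebra (csubspace hull (pats :: 'n::{finite,linorder} ugl set))"
proof -
  let ?V = "csubspace hull (pats :: 'n ugl set)"
  note V = csubspace_hull[of "pats :: 'n ugl set"]
  have right: "clinear (\<lambda>y :: 'n ugl. x * y)" and left: "clinear (\<lambda>y :: 'n ugl. y * x)" for x
    by (simp_all add: clinear_def distrib_left distrib_right scaleC_mult_left scaleC_mult_right)
  have *: "x * y \<in> ?V" if "x \<in> pats" "y \<in> ?V" for x y
    using that(2)
  proof (rule hull_induct)
    show "x * z \<in> ?V" if "z \<in> pats" for z
      using pats_mult[OF \<open>x \<in> pats\<close> that] by (rule hull_inc)
  qed (rule csubspace_vimage[OF right V])
  have "x * y \<in> ?V" if "x \<in> ?V" "y \<in> ?V" for x y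
    using that(1)
  proof (rule hull_induct)
    show "z * y \<in> ?V" if "z \<in> pats" for z using *[OF that \<open>y \<in> ?V\<close>] .
  qed (rule csubspace_vimage[OF left V])
  moreover have "1 \<in> ?V" using one_in_pats by (rule hull_inc)
  ultimately show ?thesis using V unfolding subalgebra_def csubspace_def by blast
qed

lemma trace_power_in_pats_span:
  assumes "J \<in> index_sets"
  shows "trace_on J (mat_pow_on J egl r) \<in> csubspace hull pats"
proof (cases r)
  \<comment> \<open>The zeroth power of the block occurs among the generators, through
    \<open>k = 1\<close>; its trace is a constant.\<close>
  case 0
  have "trace_on J (mat_pow_on J egl 0) = of_nat (card J) *\<^sub>C (1 :: 'a ugl)"
    by (simp add: trace_on_def sum_const_scaleC del: sum_constant)
  then show ?thesis
    using csubspace_scale[OF csubspace_hull hull_inc[OF one_in_pats]] 0 by simp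
next
  case (Suc s)
  let ?L = "[0..<Suc s]"
  have L: "?L = 0 # [1..<Suc s]" by (simp add: upt_conv_Cons del: upt_Suc)
  have rot: "map (cycle_of_list ?L) (0 # [1..<Suc s]) = [1..<Suc s] @ [0]"
    using cyclic_rotation[of ?L 1] unfolding L by (simp del: upt_Suc)
  have "trace_on J (mat_pow_on J egl r) = pat ?L (cycle_of_list ?L) (\<lambda>_. J)"
    unfolding Suc trace_on_mat_pow[OF finite] L
    by (subst pat_rotation) (use rot L in \<open>simp_all add: map_replicate_const del: upt_Suc\<close>)
  also have "\<dots> \<in> pats"
    unfolding pats_def using assms cycle_permutes[of ?L] distinct_upt by (fastforce simp del: upt_Suc)
  finally show ?thesis by (rule hull_inc)
qed

text \<open>\<open>B\<close> is the linear span of the patterns: the generators lie in the span, and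
  \<open>pats_subset\<close> gives the other inclusion. By linearity stability is then a statement
  about single patterns.\<close>

lemma P_op_stable:
  assumes "B = subalgebra hull
     ((\<lambda>k. trace_on {..<last_index :: 'n::{finite,linorder}} (mat_pow_on {..<last_index} egl (k - 1))) ` {1..CARD('n)} \<union>
      (\<lambda>k. trace_on (UNIV :: 'n set) (mat_pow_on UNIV egl k)) ` {1..CARD('n)})" (is "B = subalgebra hull (?G1 \<union> ?G2)")
  shows "P_op ` B \<subseteq> B"
proof -
  let ?V = "csubspace hull (pats :: 'n ugl set)"
  have "?G1 \<union> ?G2 \<subseteq> ?V"
    by (auto intro!: trace_power_in_pats_span simp: index_sets_def)
  then have BV: "B \<subseteq> ?V"
    unfolding assms using subalgebra_pats_span by (rule hull_minimal)
  have B: "subalgebra B" unfolding assms by (rule subalgebra_hull)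
  have gen: "g \<in> B" if "g \<in> ?G1 \<union> ?G2" for g
    unfolding assms using that by (rule hull_inc)
  have "{..<last_index :: 'n} = UNIV - {last_index}"
    using not_less_last_index by auto
  then have card: "card {..<last_index :: 'n} = CARD('n) - 1" by (simp add: card_Diff_singleton)
  have "pats \<subseteq> B"
  proof (rule pats_subset[OF B])
    fix m assume m: "1 \<le> m" "m \<le> card {..<last_index :: 'n}"
    \<comment> \<open>The exponent of the block is \<open>k - 1\<close>, so its power
      \<open>m\<close> is the generator with \<open>k = m + 1\<close>.\<close>
    then have "Suc m \<in> {1..CARD('n)}" by (simp add: card)
    then have "trace_on {..<last_index :: 'n} (mat_pow_on {..<last_index} egl (Suc m - 1)) \<in> ?G1" by (rule imageI)
    then show "trace_on {..<last_index :: 'n} (mat_pow_on {..<last_index} egl m) \<in> B"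
      using gen by simp
  next
    fix m assume "1 \<le> m" "m \<le> CARD('n)"
    then show "trace_on (UNIV :: 'n set) (mat_pow_on UNIV egl m) \<in> B" by (intro gen) auto
  qed
  then have VB: "?V \<subseteq> B" using subalgebra_csubspace[OF B] by (rule hull_minimal)
  have "P_op x \<in> ?V" if "x \<in> ?V" for x
    using that
  proof (rule hull_induct)
    show "P_op y \<in> ?V" if "y \<in> pats" for y
      by (rule P_op_pat_mem[OF csubspace_hull _ that]) (rule hull_subset)
  qed (rule csubspace_vimage[OF clinear_P_op csubspace_hull])
  then show ?thesis using BV VB by blast
qed

section \<open>Local operators and the GNS space\<close>

lemma kernel_mult:
  "is_local n (kernel a) \<Longrightarrow> kernel (a * b) x y = (\<Sum>z\<in>tail_class n x. kernel a x z * kernel (b :: 'n::finite locop) z y)"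
  by transfer (simp add: kmult_eq)

lemma is_local_kernel_mult: "is_local n (kernel a) \<Longrightarrow> is_local n (kernel b) \<Longrightarrow> is_local n (kernel (a * b :: 'n::finite locop))"
  by transfer (rule is_local_kmult)

lemma is_local_kernel_add: "is_local n (kernel a) \<Longrightarrow> is_local n (kernel b) \<Longrightarrow> is_local n (kernel (a + b :: 'n::finite locop))"
  by transfer (rule is_local_add)

lemma is_local_kernel_adj: "is_local n (kernel a) \<Longrightarrow> is_local n (kernel (adj a))"
  by transfer (rule is_local_adj)

lemma locop_eqI:
  assumes "is_local n (kernel a)" "is_local n (kernel b)"
    and "\<And>x y. y \<in> tail_class n x \<Longrightarrow> kernel a x y = kernel b x y"
  shows "a = b"
proof -
  have "kernel a x y = kernel b x y" for x y
    using assms(3)[of y x] is_local_supp[OF assms(1), of x y] is_local_supp[OF assms(2), of x y] by metis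
  then show ?thesis by (simp add: kernel_inject[symmetric] fun_eq_iff)
qed

lemma locop_common_level:
  obtains n where "is_local n (kernel a)" "is_local n (kernel b)"
  using locop_common[OF locop_local locop_local] .

lemma adj_mult: "adj (a * b) = adj b * adj (a :: 'n::finite locop)"
proof -
  obtain n where n: "is_local n (kernel a)" "is_local n (kernel b)" by (rule locop_common_level)
  show ?thesis
  proof (rule locop_eqI[of n])
    show "kernel (adj (a * b)) x y = kernel (adj b * adj a) x y" if "y \<in> tail_class n x" for x y
      using that by (simp add: kernel_mult[OF n(1)] kernel_mult[OF is_local_kernel_adj[OF n(2)]] adj.rep_eq tail_class_eq mult.commute)
  qed (intro is_local_kernel_adj is_local_kernel_mult n)+
qed

lemma adj_one: "adj 1 = (1 :: 'n::finite locop)"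
  by transfer (auto simp: fun_eq_iff)

lemma tr_inf_commute: "tr_inf (a * b) = tr_inf (b * (a :: 'n::finite locop))"
proof -
  obtain n where n: "is_local n (kernel a)" "is_local n (kernel b)" by (rule locop_common_level)
  let ?S = "tail_class n (\<lambda>_. undefined :: 'n)"
  have *: "(\<Sum>x\<in>?S. kernel (c * d) x x) = (\<Sum>x\<in>?S. \<Sum>z\<in>?S. kernel c x z * kernel d z x)"
    if "is_local n (kernel c)" for c d :: "'n locop"
    using that by (intro sum.cong refl) (simp add: kernel_mult[of n] tail_class_eq)
  have "(\<Sum>x\<in>?S. kernel (a * b) x x) = (\<Sum>x\<in>?S. kernel (b * a) x x)"
    unfolding *[OF n(1)] *[OF n(2)] by (subst sum.swap) (simp add: mult.commute)
  then show ?thesis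
    by (simp add: tr_inf_eq[of n _ "\<lambda>_. undefined"] is_local_kernel_mult n)
qed

lemma tr_inf_adj: "tr_inf (adj a) = cnj (tr_inf (a :: 'n::finite locop))"
proof -
  obtain n where n: "is_local n (kernel a)" using locop_local by blast
  show ?thesis
    by (simp add: tr_inf_eq[OF n, of undefined] tr_inf_eq[OF is_local_kernel_adj[OF n], of undefined] adj.rep_eq)
qed

lemma norm2_adj: "norm2 (adj a) = norm2 (a :: 'n::finite locop)"
proof -
  obtain n where n: "is_local n (kernel a)" using locop_local by blast
  show ?thesis
    unfolding norm2_eq[OF n, of undefined] norm2_eq[OF is_local_kernel_adj[OF n], of undefined]
    by (subst sum.swap) (simp add: adj.rep_eq)
qed

lemma norm2_square: "tr_inf (adj a * a) = complex_of_real ((norm2 (a :: 'n::finite locop))\<^sup>2)"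
proof -
  obtain n where n: "is_local n (kernel a)" using locop_local by blast
  show ?thesis
    unfolding norm2_eq[OF n, of undefined] tr_inf_adj_mult[OF n n, of undefined]
    by (subst real_sqrt_pow2, simp add: sum_nonneg,
        unfold of_real_divide of_real_sum complex_norm_square, simp add: mult.commute)
qed

lemma norm2_mult_bound_right: "\<exists>K\<ge>0. \<forall>b. norm2 (b * a) \<le> K * norm2 b" for a :: "'n::finite locop"
proof -
  obtain K where K: "K \<ge> 0" "\<And>b. norm2 (adj a * b) \<le> K * norm2 b" using norm2_mult_bound by blast
  have "norm2 (b * a) \<le> K * norm2 b" for b
    using K(2)[of "adj b"] by (simp add: adj_mult[symmetric] norm2_adj)
  then show ?thesis using K(1) by blast
qed

section \<open>Operators at a single position\<close>

lemma is_local_site: "is_local (Suc k) (kernel (site k m :: 'n::finite locop))"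
proof (rule is_localI)
  fix x y :: "nat \<Rightarrow> 'n"
  show "y \<in> tail_class (Suc k) x" if "kernel (site k m) x y \<noteq> 0"
    using that by (auto simp: site.rep_eq tail_class_def split: if_splits)
next
  fix x x' y y' :: "nat \<Rightarrow> 'n"
  assume *: "\<And>l. l < Suc k \<Longrightarrow> x l = x' l" "\<And>l. l < Suc k \<Longrightarrow> y l = y' l"
    "y \<in> tail_class (Suc k) x" "y' \<in> tail_class (Suc k) x'"
  have "x l = y l \<longleftrightarrow> x' l = y' l" for l
    using * by (cases "l < Suc k") (auto simp: tail_class_def)
  moreover have "x k = x' k" "y k = y' k" using *(1,2) by auto
  ultimately show "kernel (site k m) x y = kernel (site k m) x' y'" by (auto simp: site.rep_eq)
qed

lemma site_commute:
  assumes a: "is_local n (kernel a)" and "n \<le> k"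
  shows "a * site k m = site k m * (a :: 'n::finite locop)"
proof (rule locop_eqI[of "Suc k"])
  have a': "is_local (Suc k) (kernel a)" using is_local_mono[OF a] \<open>n \<le> k\<close> by simp
  then show "is_local (Suc k) (kernel (a * site k m))" "is_local (Suc k) (kernel (site k m * a))"
    by (auto intro: is_local_kernel_mult is_local_site)
  fix x y :: "nat \<Rightarrow> 'n" assume y: "y \<in> tail_class (Suc k) x"
  \<comment> \<open>Only one intermediate word contributes: \<open>a\<close> does not change
    position \<open>k\<close>, and \<open>site k m\<close> changes no other.\<close>
  have "kernel (a * site k m) x y = (\<Sum>z\<in>{y(k := x k)}. kernel a x z * kernel (site k m) z y)"
    unfolding kernel_mult[OF a']
  proof (rule sum.mono_neutral_right)
    show "{y(k := x k)} \<subseteq> tail_class (Suc k) x" using y by (auto simp: tail_class_def)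
    show "\<forall>z\<in>tail_class (Suc k) x - {y(k := x k)}. kernel a x z * kernel (site k m) z y = 0"
    proof
      fix z assume z: "z \<in> tail_class (Suc k) x - {y(k := x k)}"
      show "kernel a x z * kernel (site k m) z y = 0"
      proof (cases "\<forall>l. l \<noteq> k \<longrightarrow> z l = y l")
        case True
        then have "z k \<noteq> x k" using z by (auto simp: fun_eq_iff split: if_splits)
        then have "z \<notin> tail_class n x" using \<open>n \<le> k\<close> by (auto simp: tail_class_def)
        then show ?thesis using is_local_supp[OF a] by auto
      qed (auto simp: site.rep_eq)
    qed
  qed simp
  also have "\<dots> = kernel a x (y(k := x k)) * m $ x k $ y k" by (simp add: site.rep_eq)
  also have "kernel a x (y(k := x k)) = kernel a (x(k := y k)) y"
  proof -
    have iff: "y(k := x k) \<in> tail_class n x \<longleftrightarrow> y \<in> tail_class n (x(k := y k))"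
      by (auto simp: tail_class_def)
    show ?thesis
    proof (cases "y(k := x k) \<in> tail_class n x")
      case True
      then show ?thesis using iff \<open>n \<le> k\<close> by (intro is_local_cong[OF a]) auto
    next
      case False
      then show ?thesis using iff is_local_supp[OF a] by metis
    qed
  qed
  also have "kernel a (x(k := y k)) y * m $ x k $ y k
      = (\<Sum>z\<in>{x(k := y k)}. kernel (site k m) x z * kernel a z y)"
    by (simp add: site.rep_eq)
  also have "\<dots> = kernel (site k m * a) x y"
    unfolding kernel_mult[OF is_local_site]
  proof (rule sum.mono_neutral_left)
    show "{x(k := y k)} \<subseteq> tail_class (Suc k) x" by (auto simp: tail_class_def)
    show "\<forall>z\<in>tail_class (Suc k) x - {x(k := y k)}. kernel (site k m) x z * kernel a z y = 0"
    proof
      fix z assume z: "z \<in> tail_class (Suc k) x - {x(k := y k)}"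
      show "kernel (site k m) x z * kernel a z y = 0"
      proof (cases "\<forall>l. l \<noteq> k \<longrightarrow> x l = z l")
        case True
        then have "z k \<noteq> y k" using z by (auto simp: fun_eq_iff split: if_splits)
        then have "y \<notin> tail_class n z" using \<open>n \<le> k\<close> by (auto simp: tail_class_def)
        then show ?thesis using is_local_supp[OF a] by auto
      qed (auto simp: site.rep_eq)
    qed
  qed simp
  finally show "kernel (a * site k m) x y = kernel (site k m * a) x y" .
qed

lemma site_mult: "site k m * site k m' = (site k (m ** m') :: 'n::finite locop)"
proof (rule locop_eqI[of "Suc k"])
  fix x y :: "nat \<Rightarrow> 'n"
  let ?g = "\<lambda>c. x(k := c)"
  have inj: "inj ?g" by (metis fun_upd_same injI)
  have "kernel (site k m * site k m') x y = (\<Sum>z\<in>range ?g. kernel (site k m) x z * kernel (site k m') z y)"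
    unfolding kernel_mult[OF is_local_site]
  proof (rule sum.mono_neutral_right)
    show "range ?g \<subseteq> tail_class (Suc k) x" by (auto simp: tail_class_def)
    have "z = ?g (z k)" if "\<forall>l. l \<noteq> k \<longrightarrow> x l = z l" for z using that by (auto simp: fun_eq_iff)
    then show "\<forall>z\<in>tail_class (Suc k) x - range ?g. kernel (site k m) x z * kernel (site k m') z y = 0"
      by (auto simp: site.rep_eq) (metis rangeI)
  qed simp
  also have "\<dots> = (\<Sum>c\<in>UNIV. kernel (site k m) x (?g c) * kernel (site k m') (?g c) y)"
    by (simp add: sum.reindex[OF inj])
  also have "\<dots> = kernel (site k (m ** m')) x y"
    by (cases "\<forall>l. l \<noteq> k \<longrightarrow> x l = y l") (auto simp: site.rep_eq matrix_matrix_mult_def intro!: sum.neutral)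
  finally show "kernel (site k m * site k m') x y = kernel (site k (m ** m')) x y" .
qed (intro is_local_kernel_mult is_local_site)+

lemma site_one: "site k (mat 1) = (1 :: 'n::finite locop)"
  by transfer (auto simp: fun_eq_iff mat_def, metis)

lemma adj_site: "adj (site k m) = site k (\<chi> i j. cnj (m $ j $ i))"
  by transfer (auto simp: fun_eq_iff)

section \<open>Norms and approximation in the GNS space\<close>

lemma gns_norm_le: "0 \<le> K \<Longrightarrow> (\<And>a. cmod (coef f a) \<le> K * norm2 a) \<Longrightarrow> norm f \<le> K"
  unfolding norm_gns_def by (intro cInf_lower) (auto simp: bdd_below_def)

lemma gns_norm_bound: "cmod (coef f a) \<le> norm f * norm2 a"
proof -
  obtain K where K: "K \<ge> 0" "\<And>a. cmod (coef f a) \<le> K * norm2 a" using coef[of f] by blast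
  show ?thesis
  proof (cases "norm2 a = 0")
    case False
    then have pos: "norm2 a > 0" using norm2_nonneg[of a] by simp
    have "cmod (coef f a) / norm2 a \<le> norm f"
      unfolding norm_gns_def using K pos by (intro cInf_greatest) (auto simp: pos_divide_le_eq)
    then show ?thesis using pos by (simp add: pos_divide_le_eq)
  qed (use K(2)[of a] in simp)
qed

lemma coef_add_arg: "coef f (a + b) = coef f a + coef f b"
  and coef_scaleC_arg: "coef f (c *\<^sub>C a) = cnj c * coef f a"
  using coef[of f] by auto

lemma coef_diff: "coef (f - g) a = coef f a - coef g a"
  by (simp add: minus_gns_def uminus_gns_def plus_gns.rep_eq scaleC_gns.rep_eq)

lemma coef_eqI: "(\<And>a. coef f a = coef g a) \<Longrightarrow> f = g"
  by (simp add: coef_inject[symmetric] fun_eq_iff)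

text \<open>\<open>bra_ket a b\<close> is the inner product \<open>\<langle>a\<Omega>, b\<Omega>\<rangle>\<close>.\<close>

definition bra_ket :: "'n::finite locop \<Rightarrow> 'n locop \<Rightarrow> complex" where
  "bra_ket a b = tr_inf (adj a * b)"

lemma coef_vector: "coef (gns_rep b vacuum) a = bra_ket a b"
  by (simp add: coef_gns_rep_vacuum bra_ket_def adj_mult)

lemma bra_ket_add_left: "bra_ket (a + a') b = bra_ket a b + bra_ket a' b"
  and bra_ket_add_right: "bra_ket a (b + b') = bra_ket a b + bra_ket a b'"
  and bra_ket_scaleC_left: "bra_ket (c *\<^sub>C a) b = cnj c * bra_ket a b"
  and bra_ket_scaleC_right: "bra_ket a (c *\<^sub>C b) = c * bra_ket a b"
  by (simp_all add: bra_ket_def adj_add adj_scaleC distrib_left distrib_right tr_inf_add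
      scaleC_mult_left scaleC_mult_right tr_inf_scaleC)

lemma bra_ket_cnj: "bra_ket b a = cnj (bra_ket a b)"
  by (simp add: bra_ket_def tr_inf_adj[symmetric] adj_mult)

lemma bra_ket_self: "bra_ket a a = complex_of_real ((norm2 a)\<^sup>2)"
  by (simp only: bra_ket_def norm2_square)

lemma norm2_orthogonal:
  assumes "bra_ket a c = 0"
  shows "(norm2 (u *\<^sub>C a + v *\<^sub>C c))\<^sup>2 = (cmod u)\<^sup>2 * (norm2 a)\<^sup>2 + (cmod v)\<^sup>2 * (norm2 c)\<^sup>2"
proof -
  have "bra_ket c a = 0" using bra_ket_cnj[of c a] assms by simp
  then have "bra_ket (u *\<^sub>C a + v *\<^sub>C c) (u *\<^sub>C a + v *\<^sub>C c) = cnj u * u * bra_ket a a + cnj v * v * bra_ket c c"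
    using assms by (simp add: bra_ket_add_left bra_ket_add_right bra_ket_scaleC_left bra_ket_scaleC_right)
  then have "complex_of_real ((norm2 (u *\<^sub>C a + v *\<^sub>C c))\<^sup>2)
      = complex_of_real ((cmod u)\<^sup>2 * (norm2 a)\<^sup>2 + (cmod v)\<^sup>2 * (norm2 c)\<^sup>2)"
    unfolding bra_ket_self of_real_add of_real_mult complex_norm_square by (simp add: mult.commute)
  then show ?thesis by (simp only: of_real_eq_iff)
qed

lemma norm2_scaleC: "norm2 (c *\<^sub>C a) = cmod c * norm2 a"
proof -
  have "bra_ket a 0 = 0" by (simp add: bra_ket_def) (metis scaleC_zero_left tr_inf_scaleC mult_zero_left)
  then have "(norm2 (c *\<^sub>C a))\<^sup>2 = (cmod c * norm2 a)\<^sup>2"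
    using norm2_orthogonal[of a 0 c 0] by (simp add: power_mult_distrib)
  then show ?thesis by (simp add: norm2_nonneg power2_eq_iff_nonneg)
qed

text \<open>Bessel's inequality for a functional: it is tested at the vector \<open>x\<close> built
  from its own values at the orthogonal vectors \<open>a\<close> and \<open>c\<close>, where the
  value and the squared norm are both \<open>Q\<close>.\<close>

lemma coef_bessel:
  assumes "norm2 a = 1" "bra_ket a c = 0"
  shows "(cmod (coef f c))\<^sup>2 \<le> ((norm f)\<^sup>2 - (cmod (coef f a))\<^sup>2) * (norm2 c)\<^sup>2"
proof (cases "norm2 c = 0")
  case True
  then show ?thesis using gns_norm_bound[of f c] by simp
next
  case False
  define N where "N = (norm2 c)\<^sup>2"
  have N: "N > 0" using False by (simp add: N_def)
  define x where "x = coef f a *\<^sub>C a + (coef f c / of_real N) *\<^sub>C c"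
  define Q where "Q = (cmod (coef f a))\<^sup>2 + (cmod (coef f c))\<^sup>2 / N"
  have "Q \<ge> 0" using N by (simp add: Q_def)
  have "(norm2 x)\<^sup>2 = Q"
    using N unfolding x_def norm2_orthogonal[OF assms(2)] Q_def N_def[symmetric]
    by (simp add: assms(1) norm_divide power_divide power2_eq_square)
  moreover have "coef f x = of_real Q"
    unfolding x_def coef_add_arg coef_scaleC_arg Q_def of_real_add of_real_divide complex_norm_square
    by (simp add: mult.commute)
  then have "Q \<le> norm f * norm2 x" using gns_norm_bound[of f x] \<open>Q \<ge> 0\<close> by simp
  then have "Q\<^sup>2 \<le> (norm f * norm2 x)\<^sup>2" using \<open>Q \<ge> 0\<close> by (rule power_mono)
  ultimately have "Q * Q \<le> (norm f)\<^sup>2 * Q"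
    unfolding power_mult_distrib power2_eq_square[of Q] by simp
  then have "Q \<le> (norm f)\<^sup>2" using \<open>Q \<ge> 0\<close> by (cases "Q = 0") auto
  then have "(cmod (coef f c))\<^sup>2 / N \<le> (norm f)\<^sup>2 - (cmod (coef f a))\<^sup>2" by (simp add: Q_def)
  then show ?thesis using N by (simp add: pos_divide_le_eq N_def[symmetric])
qed

text \<open>If \<open>a\<close> is a unit vector at which the functional \<open>f\<close> nearly attains its norm, then by
  Bessel's inequality \<open>f\<close> is small on the orthogonal complement of \<open>a\<close>.\<close>

lemma local_vectors_dense:
  fixes f :: "'n::finite gns" assumes "e > 0"
  shows "\<exists>b. norm (f - gns_rep b vacuum) \<le> e"
proof (cases "f = 0")
  case True
  have "gns_rep 0 vacuum = (0 :: 'n gns)" using gns_rep_scaleC[of 0 0 vacuum] by simp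
  then show ?thesis using True assms by (intro exI[of _ 0]) simp
next
  case False
  \<comment> \<open>A unit vector at which \<open>f\<close> exceeds \<open>K\<close> leaves at most
    \<open>e\<close> for its orthogonal complement. The maximum with \<open>0\<close> covers an
    \<open>e\<close> larger than the norm of \<open>f\<close>.\<close>
  define K where "K = sqrt (max 0 ((norm f)\<^sup>2 - e\<^sup>2))"
  have K: "0 \<le> K" "K < norm f"
    using False assms by (auto simp: K_def intro!: real_less_lsqrt)
  have K2: "(norm f)\<^sup>2 - e\<^sup>2 \<le> K\<^sup>2" by (simp add: K_def)
  obtain a where a: "cmod (coef f a) > K * norm2 a"
    using gns_norm_le[OF K(1), of f] K(2) by (meson not_le)
  then have "norm2 a \<noteq> 0" using gns_norm_bound[of f a] by auto
  then have pos: "norm2 a > 0" using norm2_nonneg[of a] by simp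
  define a' where "a' = of_real (1 / norm2 a) *\<^sub>C a"
  have a': "norm2 a' = 1" using pos by (simp add: a'_def norm2_scaleC norm_divide)
  have "cmod (coef f a') = cmod (coef f a) / norm2 a"
    using pos by (simp add: a'_def coef_scaleC_arg norm_mult norm_divide)
  then have "K < cmod (coef f a')" using a pos by (simp add: pos_less_divide_eq)
  then have "K\<^sup>2 \<le> (cmod (coef f a'))\<^sup>2" using K(1) by (intro power_mono) auto
  then have small: "(norm f)\<^sup>2 - (cmod (coef f a'))\<^sup>2 \<le> e\<^sup>2" using K2 by simp
  let ?g = "gns_rep (coef f a' *\<^sub>C a') vacuum"
  have "norm (f - ?g) \<le> e"
  proof (rule gns_norm_le)
    fix b
    define t where "t = bra_ket a' b"
    define c where "c = b + (- t) *\<^sub>C a'"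
    have orth: "bra_ket a' c = 0"
      by (simp add: c_def bra_ket_add_right bra_ket_scaleC_right bra_ket_self a' t_def)
    have b: "b = t *\<^sub>C a' + 1 *\<^sub>C c" by (simp add: c_def scaleC_one scaleC_minus_left)
    have "(norm2 b)\<^sup>2 = (cmod t)\<^sup>2 + (norm2 c)\<^sup>2"
      using norm2_orthogonal[OF orth, of t 1] a' by (simp flip: b)
    then have cb: "(norm2 c)\<^sup>2 \<le> (norm2 b)\<^sup>2" by simp
    have "coef (f - ?g) b = coef f c"
      by (simp add: coef_diff gns_rep_scaleC scaleC_gns.rep_eq coef_vector c_def coef_add_arg
          coef_scaleC_arg t_def bra_ket_cnj[of b a'])
    moreover have "(cmod (coef f c))\<^sup>2 \<le> e\<^sup>2 * (norm2 b)\<^sup>2"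
      using order_trans[OF coef_bessel[OF a' orth] mult_right_mono[OF small zero_le_power2]]
        mult_left_mono[OF cb, of "e\<^sup>2"] by fastforce
    then have "cmod (coef f c) \<le> e * norm2 b"
      using assms norm2_nonneg[of b] by (simp add: power_mult_distrib[symmetric] power2_le_iff_abs_le)
    ultimately show "cmod (coef (f - ?g) b) \<le> e * norm2 b" by simp
  qed (use assms in simp)
  then show ?thesis by blast
qed

lemma bounded_linear_eq_on_local_vectors:
  assumes F: "bounded_linear F" and G: "bounded_linear (G :: 'n::finite gns \<Rightarrow> 'n gns)"
    and eq: "\<And>b. F (gns_rep b vacuum) = G (gns_rep b vacuum)"
  shows "F = G"
proof
  fix f
  interpret H: bounded_linear "\<lambda>f. F f - G f" using F G by (rule bounded_linear_sub)
  obtain K where K: "K > 0" "\<And>f. norm (F f - G f) \<le> norm f * K" using H.pos_bounded by blast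
  have "norm (F f - G f) \<le> e" if "e > 0" for e
  proof -
    obtain b where b: "norm (f - gns_rep b vacuum) \<le> e / K"
      using local_vectors_dense[of "e / K" f] \<open>e > 0\<close> K(1) by auto
    have "F f - G f = F (f - gns_rep b vacuum) - G (f - gns_rep b vacuum)"
      using H.diff[of f "gns_rep b vacuum"] by (simp add: eq)
    also have "norm \<dots> \<le> norm (f - gns_rep b vacuum) * K" by (rule K(2))
    also have "\<dots> \<le> e" using b K(1) by (simp add: pos_le_divide_eq)
    finally show ?thesis .
  qed
  then have "norm (F f - G f) \<le> 0" by (rule field_le_epsilon[where y = 0, simplified])
  then show "F f = G f" by simp
qed

section \<open>The Markov property\<close>

lemma gns_rep_mult: "gns_rep (a * b) = gns_rep a \<circ> gns_rep (b :: 'n::finite locop)"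
proof
  fix f show "gns_rep (a * b) f = (gns_rep a \<circ> gns_rep b) f"
    by (rule coef_eqI) (simp add: gns_rep.rep_eq adj_mult mult.assoc)
qed

lemma gns_rep_one: "gns_rep 1 = id"
proof
  show "gns_rep 1 f = id f" for f
    by (rule coef_eqI) (simp add: gns_rep.rep_eq adj_one)
qed

text \<open>Right multiplication by \<open>c\<close>, defined like \<open>gns_rep\<close> through
  the adjoint on the other side of the inner product. That it sends b\<Omega> to (b * c)\<Omega>
  rests on the trace property, in \<open>gns_right_vector\<close>.\<close>

lift_definition gns_right :: "'n::finite locop \<Rightarrow> 'n gns \<Rightarrow> 'n gns" is "\<lambda>c f b. f (b * adj c)"
proof (intro conjI allI; (elim conjE)?)
  fix c :: "'n locop" and f :: "'n locop \<Rightarrow> complex"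
  assume "\<exists>K\<ge>0. \<forall>a. cmod (f a) \<le> K * norm2 a"
  then obtain K where K: "K \<ge> 0" "\<And>a. cmod (f a) \<le> K * norm2 a" by blast
  obtain L where L: "L \<ge> 0" "\<And>b. norm2 (b * adj c) \<le> L * norm2 b" using norm2_mult_bound_right by blast
  have "cmod (f (b * adj c)) \<le> (K * L) * norm2 b" for b
    using order_trans[OF K(2) mult_left_mono[OF L(2) K(1)]] by (simp add: mult.assoc)
  then show "\<exists>K\<ge>0. \<forall>b. cmod (f (b * adj c)) \<le> K * norm2 b"
    using K(1) L(1) by (intro exI[of _ "K * L"]) simp
qed (simp_all add: distrib_right scaleC_mult_left)

lemma bounded_clinear_precompose:
  assumes X: "\<And>f b. coef (X f) b = coef f (\<phi> b)"
    and L: "L \<ge> 0" "\<And>b. norm2 (\<phi> b) \<le> L * norm2 b"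
  shows "bounded_clinear (X :: 'n::finite gns \<Rightarrow> 'n gns)"
proof -
  have scale: "X (c *\<^sub>C f) = c *\<^sub>C X f" for c f
    by (rule coef_eqI) (simp add: X scaleC_gns.rep_eq)
  have "bounded_linear X"
  proof (rule bounded_linear_intro)
    show "X (f + g) = X f + X g" for f g
      by (rule coef_eqI) (simp add: X plus_gns.rep_eq)
    show "X (r *\<^sub>R f) = r *\<^sub>R X f" for r f by (simp add: scaleR_gns_def scale)
    show "norm (X f) \<le> norm f * L" for f
    proof (rule gns_norm_le)
      fix b
      have "cmod (coef (X f) b) \<le> norm f * norm2 (\<phi> b)" unfolding X by (rule gns_norm_bound)
      also have "\<dots> \<le> norm f * (L * norm2 b)" by (intro mult_left_mono L) simp
      finally show "cmod (coef (X f) b) \<le> norm f * L * norm2 b" by (simp add: mult.assoc)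
    qed (use L in simp)
  qed
  then show ?thesis unfolding bounded_clinear_def using scale by blast
qed

lemma bounded_clinear_gns_rep: "bounded_clinear (gns_rep a)"
proof -
  obtain L where "L \<ge> 0" "\<And>b. norm2 (adj a * b) \<le> L * norm2 b" using norm2_mult_bound by blast
  then show ?thesis by (intro bounded_clinear_precompose[where \<phi> = "\<lambda>b. adj a * b"]) (simp_all add: gns_rep.rep_eq)
qed

lemma bounded_clinear_gns_right: "bounded_clinear (gns_right a)"
proof -
  obtain L where "L \<ge> 0" "\<And>b. norm2 (b * adj a) \<le> L * norm2 b" using norm2_mult_bound_right by blast
  then show ?thesis by (intro bounded_clinear_precompose[where \<phi> = "\<lambda>b. b * adj a"]) (simp_all add: gns_right.rep_eq)
qed

lemma gns_rep_right_commute: "gns_rep a \<circ> gns_right c = gns_right c \<circ> gns_rep a"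
proof
  show "(gns_rep a \<circ> gns_right c) f = (gns_right c \<circ> gns_rep a) f" for f
    by (rule coef_eqI) (simp add: gns_rep.rep_eq gns_right.rep_eq mult.assoc)
qed

lemma gns_rep_vector: "gns_rep a (gns_rep b vacuum) = gns_rep (a * b) vacuum"
  by (simp add: gns_rep_mult)

lemma gns_right_vector: "gns_right c (gns_rep b vacuum) = gns_rep (b * c) vacuum"
proof (rule coef_eqI)
  fix a
  have "bra_ket (a * adj c) b = tr_inf ((c * adj a) * b)" by (simp add: bra_ket_def adj_mult)
  also have "\<dots> = bra_ket a (b * c)"
    using tr_inf_commute[of c "adj a * b"] by (simp add: bra_ket_def mult.assoc)
  finally show "coef (gns_right c (gns_rep b vacuum)) a = coef (gns_rep (b * c) vacuum) a"
    by (simp add: gns_right.rep_eq coef_vector)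
qed

text \<open>\<open>X\<close> and \<open>Y\<close> are adjoint to each other, as their actions on
  local vectors and on coefficients show. Taking adjoints in
  \<open>T \<circ> Y = Y \<circ> T\<close> gives the claim on the dense local vectors, hence
  everywhere.\<close>

lemma adjoint_commutes:
  assumes X: "bounded_clinear X" "\<And>b. X (gns_rep b vacuum) = gns_rep (\<psi> b) vacuum" "\<And>f a. coef (X f) a = coef f (\<psi>' a)"
    and Y: "\<And>a. Y (gns_rep a vacuum) = gns_rep (\<psi>' a) vacuum" "\<And>f b. coef (Y f) b = coef f (\<psi> b)"
    and T: "T \<circ> Y = Y \<circ> T" "is_adjoint T T'" "bounded_clinear T'"
  shows "T' \<circ> X = X \<circ> T'"
proof (rule bounded_linear_eq_on_local_vectors)
  have lin: "bounded_linear X" "bounded_linear T'" using X(1) T(3) by (simp_all add: bounded_clinear_def)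
  show "bounded_linear (T' \<circ> X)" "bounded_linear (X \<circ> T')"
    unfolding comp_def by (rule bounded_linear_compose; fact lin)+
  have adj: "coef (T' (gns_rep b vacuum)) a = cnj (coef (T (gns_rep a vacuum)) b)" for a b
    using T(2) by (simp add: is_adjoint_def)
  have TY: "T (Y f) = Y (T f)" for f using T(1) by (simp add: fun_eq_iff)
  show "(T' \<circ> X) (gns_rep b vacuum) = (X \<circ> T') (gns_rep b vacuum)" for b
  proof (rule coef_eqI)
    show "coef ((T' \<circ> X) (gns_rep b vacuum)) a = coef ((X \<circ> T') (gns_rep b vacuum)) a" for a
      using TY[of "gns_rep a vacuum"] by (simp add: X adj Y)
  qed
qed

section \<open>Commutants\<close>

lemma commutant_antimono: "S \<subseteq> S' \<Longrightarrow> commutant S' \<subseteq> commutant S"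
  by (auto simp: commutant_def)

lemma subset_double_commutant: "S \<subseteq> Collect bounded_clinear \<Longrightarrow> S \<subseteq> commutant (commutant S)"
  by (auto simp: commutant_def)

lemma commutant_triple:
  assumes "S \<subseteq> Collect bounded_clinear"
  shows "commutant (commutant (commutant S)) = commutant S"
proof
  show "commutant (commutant (commutant S)) \<subseteq> commutant S"
    by (intro commutant_antimono subset_double_commutant assms)
  show "commutant S \<subseteq> commutant (commutant (commutant S))"
    by (rule subset_double_commutant) (auto simp: commutant_def)
qed

text \<open>Operators commuting with position \<open>k\<close> and with all right multiplications; the latter
  make the vacuum state tracial on them.\<close>

definition off_site :: "nat \<Rightarrow> ('n::finite gns \<Rightarrow> 'n gns) set" where
  "off_site k = commutant (range (\<lambda>m. gns_rep (site k m)) \<union> range gns_right)"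

text \<open>A commutant is its own double commutant. Closure under adjoints holds because the
  adjoints of site operators and of right multiplications are again of these kinds.\<close>

lemma von_neumann_algebra_off_site: "von_neumann_algebra (off_site k)"
  unfolding von_neumann_algebra_def
proof (intro conjI ballI allI impI)
  show "commutant (commutant (off_site k)) = off_site k"
    unfolding off_site_def
    by (rule commutant_triple) (auto simp: bounded_clinear_gns_rep bounded_clinear_gns_right)
next
  fix T T' :: "'a gns \<Rightarrow> 'a gns"
  assume T: "T \<in> off_site k" and T': "bounded_clinear T' \<and> is_adjoint T T'"
  have rep: "T' \<circ> gns_rep (site k m) = gns_rep (site k m) \<circ> T'" for m
  proof (rule adjoint_commutes[where Y = "gns_rep (adj (site k m))" and T = T])
    show "T \<circ> gns_rep (adj (site k m)) = gns_rep (adj (site k m)) \<circ> T"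
      using T unfolding off_site_def commutant_def adj_site by blast
  qed (use T' in \<open>simp_all add: bounded_clinear_gns_rep gns_rep_vector gns_rep.rep_eq\<close>)
  have right: "T' \<circ> gns_right c = gns_right c \<circ> T'" for c
  proof (rule adjoint_commutes[where Y = "gns_right (adj c)" and T = T])
    show "T \<circ> gns_right (adj c) = gns_right (adj c) \<circ> T"
      using T unfolding off_site_def commutant_def by blast
  qed (use T' in \<open>simp_all add: bounded_clinear_gns_right gns_right_vector gns_right.rep_eq\<close>)
  show "T' \<in> off_site k"
    using T' rep right unfolding off_site_def commutant_def by blast
qed

lemma gns_rep_off_site: "is_local n (kernel a) \<Longrightarrow> n \<le> k \<Longrightarrow> gns_rep a \<in> off_site k"
  unfolding off_site_def commutant_def
  by (auto simp: bounded_clinear_gns_rep gns_rep_right_commute site_commute gns_rep_mult[symmetric])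

text \<open>Left and right multiplication by \<open>s\<close> agree on the vacuum, and also when
  tested against it. In between, the right multiplication is moved past \<open>T\<close>.\<close>

lemma omega_commute:
  assumes "\<And>c. T \<circ> gns_right c = gns_right c \<circ> T"
  shows "omega (T \<circ> gns_rep s) = omega (gns_rep s \<circ> T)"
proof -
  have "gns_rep s vacuum = gns_right s vacuum"
    using gns_right_vector[of s 1] by (simp add: gns_rep_one)
  then have "T (gns_rep s vacuum) = gns_right s (T vacuum)" using assms[of s] by (simp add: fun_eq_iff)
  then show ?thesis by (simp add: omega_def gns_right.rep_eq gns_rep.rep_eq)
qed

text \<open>Off-diagonal matrix units are commutators, and any two diagonal ones differ by a
  commutator, so a single constant \<open>c\<close> determines the functional.\<close>

lemma tracial_functional:
  fixes F :: "complex ^ 'n ^ 'n::finite \<Rightarrow> complex"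
  assumes F: "clinear F" and comm: "\<And>m m'. F (m ** m') = F (m' ** m)"
  shows "F m = trace m / of_nat CARD('n) * F (mat 1)"
proof -
  fix j0 :: 'n
  define c where "c = F (matrix_unit j0 j0)"
  have unit: "F (matrix_unit i j) = (if i = j then c else 0)" for i j
  proof (cases "i = j")
    case True
    then show ?thesis using comm[of "matrix_unit i j0" "matrix_unit j0 i"] by (simp add: matrix_unit_mult c_def)
  next
    case False
    then show ?thesis
      using comm[of "matrix_unit i i" "matrix_unit i j"] by (simp add: matrix_unit_mult clinear_zero[OF F])
  qed
  have val: "F m = trace m * c" for m
  proof -
    have swap: "(if P \<and> Q then z else 0) = (if Q then if P then z else 0 else 0)" for P Q and z :: complex
      by simp
    have "m = (\<Sum>i\<in>UNIV. \<Sum>j\<in>UNIV. m $ i $ j *\<^sub>C matrix_unit i j)"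
      by (simp add: vec_eq_iff scaleC_vec_def scaleC_complex_def matrix_unit_def mult_delta_right swap)
    then have "F m = F (\<Sum>i\<in>UNIV. \<Sum>j\<in>UNIV. m $ i $ j *\<^sub>C matrix_unit i j)" by simp
    also have "\<dots> = (\<Sum>i\<in>UNIV. \<Sum>j\<in>UNIV. m $ i $ j * F (matrix_unit i j))"
      using F by (simp add: clinear_sum[OF F] clinear_def scaleC_complex_def)
    also have "\<dots> = trace m * c"
      by (simp add: unit trace_def sum_distrib_right mult_delta_right)
    finally show ?thesis .
  qed
  have "F (mat 1) = of_nat CARD('n) * c"
    using val[of "mat 1"] by (simp add: trace_def mat_def)
  then show ?thesis using val[of m] by simp
qed

lemma omega_site:
  assumes a: "is_local n (kernel a)" "n \<le> k" and \<xi>: "\<xi> \<in> off_site k"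
  shows "omega (gns_rep (a * site k m) \<circ> \<xi>) = trace m / of_nat CARD('n) * omega (gns_rep (a :: 'n::finite locop) \<circ> \<xi>)"
proof -
  define F where "F m = omega (gns_rep (a * site k m) \<circ> \<xi>)" for m
  have "clinear (site k :: _ \<Rightarrow> 'n locop)" by (rule clinear_site)
  then have "clinear F"
    by (simp add: F_def clinear_def omega_def distrib_left scaleC_mult_right gns_rep_add gns_rep_scaleC
        plus_gns.rep_eq scaleC_gns.rep_eq scaleC_complex_def)
  moreover have "F (m ** m') = F (m' ** m)" for m m'
  proof -
    let ?s = "site k m" and ?s' = "site k m'"
    let ?T = "gns_rep (a * ?s) \<circ> \<xi>"
    have \<xi>s: "\<xi> \<circ> gns_rep ?s' = gns_rep ?s' \<circ> \<xi>" and \<xi>r: "\<xi> \<circ> gns_right c = gns_right c \<circ> \<xi>" for c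
      using \<xi> by (auto simp: off_site_def commutant_def)
    \<comment> \<open>The matrix \<open>m'\<close> moves through \<open>\<xi>\<close> to the right
      end, around to the left by \<open>omega_commute\<close>, and back through \<open>a\<close>,
      which acts on other positions.\<close>
    have "F (m ** m') = omega (gns_rep (a * ?s) \<circ> (gns_rep ?s' \<circ> \<xi>))"
      by (simp add: F_def site_mult[symmetric] gns_rep_mult o_assoc)
    also have "\<dots> = omega (?T \<circ> gns_rep ?s')" by (simp only: \<xi>s[symmetric] o_assoc)
    also have "\<dots> = omega (gns_rep ?s' \<circ> ?T)"
    proof (rule omega_commute)
      show "?T \<circ> gns_right c = gns_right c \<circ> ?T" for c
        by (metis \<xi>r gns_rep_right_commute comp_assoc)
    qed
    also have "\<dots> = omega (gns_rep (a * (?s' * ?s)) \<circ> \<xi>)"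
    proof -
      have "?s' * (a * ?s) = a * (?s' * ?s)" by (metis site_commute[OF a] mult.assoc)
      then show ?thesis by (simp only: o_assoc gns_rep_mult[symmetric])
    qed
    also have "\<dots> = F (m' ** m)" by (simp add: F_def site_mult)
    finally show ?thesis .
  qed
  ultimately have "F m = trace m / of_nat CARD('n) * F (mat 1)" by (rule tracial_functional)
  then show ?thesis by (simp add: F_def site_one)
qed

section \<open>Assembling the Markov process\<close>

lemma is_local_rho_tensor: "is_local (Suc n) (kernel (rho_tensor (Suc n) (x :: 'n::{finite,linorder} ugl)))"
proof (induction n arbitrary: x)
  case 0
  show ?case by (simp add: is_local_site)
next
  case (Suc n)
  let ?R = "tensor_map (\<lambda>(u :: 'n ugl) (v :: 'n ugl). rho_tensor (Suc n) u * site (Suc n) (std_rep v))"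
  have R: "clinear ?R" by (rule tensor_map(1)[OF clinear_rho_tensor(2)])
  have "is_local (Suc (Suc n)) (kernel (?R t))" for t
  proof (induction t rule: tensor_induct)
    case (simple u v)
    show ?case
      unfolding tensor_map(2)[OF clinear_rho_tensor(2)]
      by (intro is_local_kernel_mult is_local_site is_local_mono[OF Suc.IH]) simp
  next
    case (add s t)
    then show ?case using R by (simp add: clinear_def is_local_kernel_add)
  qed
  then show ?case by simp
qed

text \<open>By linearity the coproduct of \<open>x\<close> may be replaced by
  \<open>u \<otimes> v\<close>. Then the factor \<open>eta v\<close> comes from averaging over the
  last position on one side and from the definition of \<open>P_op\<close> on the other.\<close>

lemma markov_property:
  fixes x :: "'n::{finite,linorder} ugl"
  assumes \<xi>: "\<xi> \<in> off_site (Suc n)"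
  shows "omega (j_mor (Suc (Suc n)) x \<circ> \<xi>) = omega (j_mor (Suc n) (P_op x) \<circ> \<xi>)"
proof -
  let ?R = "tensor_map (\<lambda>(u :: 'n ugl) (v :: 'n ugl). rho_tensor (Suc n) u * site (Suc n) (std_rep v))"
  let ?E = "tensor_map (\<lambda>(y :: 'n ugl) (z :: 'n ugl). eta z *\<^sub>C y)"
  have R: "clinear ?R" by (rule tensor_map(1)[OF clinear_rho_tensor(2)])
  have E: "clinear ?E" by (rule tensor_map(1)[OF cbilinear_id_eta])
  have rho: "clinear (rho_tensor (Suc n) :: 'n ugl \<Rightarrow> _)" by (rule clinear_rho_tensor(1))
  have "omega (gns_rep (?R t) \<circ> \<xi>) = omega (gns_rep (rho_tensor (Suc n) (?E t)) \<circ> \<xi>)" for t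
  proof (induction t rule: tensor_induct)
    case (simple u v)
    have "omega (gns_rep (?R (u \<otimes> v)) \<circ> \<xi>) = eta v * omega (gns_rep (rho_tensor (Suc n) u) \<circ> \<xi>)"
      unfolding tensor_map(2)[OF clinear_rho_tensor(2)] eta_def
      by (rule omega_site[OF is_local_rho_tensor _ \<xi>]) simp
    also have "\<dots> = omega (gns_rep (rho_tensor (Suc n) (?E (u \<otimes> v))) \<circ> \<xi>)"
      unfolding tensor_map(2)[OF cbilinear_id_eta]
      using rho by (simp add: clinear_def gns_rep_scaleC omega_def scaleC_gns.rep_eq)
    finally show ?case .
  next
    case (add s t)
    then show ?case using R E rho by (simp add: clinear_def gns_rep_add omega_def plus_gns.rep_eq)
  qed
  then show ?thesis by (simp add: j_mor_def P_op_def)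
qed

theorem theorem4p8:
  assumes "2 \<le> CARD('n::{finite,linorder})"
  shows "quantum_markov_on (subalgebra hull
     ((\<lambda>k. trace_on {..<last_index :: 'n} (mat_pow_on {..<last_index} egl (k - 1))) ` {1..CARD('n)} \<union>
      (\<lambda>k. trace_on (UNIV :: 'n set) (mat_pow_on UNIV egl k)) ` {1..CARD('n)}))"
  (is "quantum_markov_on ?B")
  unfolding quantum_markov_on_def
proof (intro conjI allI ballI impI)
  show "P_op ` ?B \<subseteq> ?B" by (rule P_op_stable) (rule refl)
  fix n :: nat and x \<xi>
  assume "2 \<le> n" and \<xi>: "\<xi> \<in> von_neumann_algebra hull (\<Union>k\<in>{1..n - 1}. j_mor k ` ?B)"
  then obtain r where n: "n = Suc (Suc r)" by (metis add_2_eq_Suc le_Suc_ex)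
  \<comment> \<open>For \<open>k \<le> n - 1\<close> the image of \<open>j_mor k\<close> lives on
    positions below \<open>n - 1\<close>, counted from \<open>0\<close>, so it commutes with
    position \<open>Suc r = n - 1\<close>, the last one used by \<open>j_mor n\<close>.\<close>
  have "j_mor k y \<in> off_site (Suc r)" if "k \<in> {1..n - 1}" for k and y :: "'n ugl"
  proof -
    obtain l where l: "k = Suc l" "l \<le> r" using \<open>k \<in> {1..n - 1}\<close> n by (cases k) auto
    show ?thesis unfolding j_mor_def l(1) by (rule gns_rep_off_site[OF is_local_rho_tensor]) (use l in simp)
  qed
  then have "von_neumann_algebra hull (\<Union>k\<in>{1..n - 1}. j_mor k ` ?B) \<subseteq> off_site (Suc r)"
    by (intro hull_minimal von_neumann_algebra_off_site) auto
  then show "omega (j_mor n x \<circ> \<xi>) = omega (j_mor (n - 1) (P_op x) \<circ> \<xi>)"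
    using markov_property[of \<xi> r x] \<xi> n by auto
qed

end
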